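(* Let $n\in\mathbb N$, $B\in\mathcal S_n(\mathcal H)$ with inner Livsic characteristic function, and fix an isometry $J:\mathbb C^n\to\ker(B^*+i)$. Let $U_1\in\mathrm{Ext}(B)$ act on $\mathcal K_1\supseteq\mathcal H$ and $U_2\in\mathrm{Ext}(B)$ act on $\mathcal K_2\supseteq\mathcal H$. Then $\Phi[U_1;B]=\Phi[U_2;B]$ if and only if there exists a unitary $W:\mathcal K_1\to\mathcal K_2$ with $Wh=h$ for all $h\in\mathcal H$ and $WU_1=U_2W$.
   Context: For a separable Hilbert space $\mathcal H$ and $n\in\mathbb N$, $\mathcal S_n(\mathcal H)$ is the set of linear transformations $B$ with domain $\mathrm{dom}(B)\subseteq\mathcal H$ (not necessarily dense) that are symmetric, closed, simple ($\bigcap_{z\in\mathbb C\setminus\mathbb R}\mathrm{ran}(B-z)=\{0\}$) and have deficiency indices $(n,n)$. For $z\in\mathbb C\setminus\mathbb R$ write $\ker(B^*-z):=\mathrm{ran}(B-\bar z)^\perp$. Let $b(z)=\frac{z-i}{z+i}$; the Cayley transform $b(B)=(B-i)(B+i)^{-1}$ is an isometry from $\mathrm{ran}(B+i)$ onto $\mathrm{ran}(B-i)$. The Livsic characteristic function $\Theta_B(z)=b(z)B(z)^{-1}A(z)$, where $B(z)=[\langle w_j(z),u_k\rangle]$, $A(z)=[\langle w_j(z),v_k\rangle]$ with $\{u_k\}$, $\{v_k\}$ orthonormal bases of $\ker(B^*-i)$, $\ker(B^*+i)$ and $\{w_j(z)\}$ a basis of $\ker(B^*-z)$, $z\in\mathbb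 C_+$; it is inner if its boundary values on $\mathbb R$ are unitary a.e. $\mathrm{Ext}(B)$ is the set of unitary operators $U$ on Hilbert spaces $\mathcal K\supseteq\mathcal H$ such that $U$ agrees with $b(B)$ on $\mathrm{ran}(B+i)$ and $\mathcal K$ is the smallest subspace reducing $U$ that contains $\mathcal H$. For $U\in\mathrm{Ext}(B)$ with spectral measure $P_U$ on $\mathbb T$, $G_U(z)=\int_{\mathbb T}\frac{\alpha+b(z)}{\alpha-b(z)}\,J^*P_U(d\alpha)J$ and $\Phi[U;B]:=(G_U-1)(G_U+1)^{-1}$ on $\mathbb C_+$. *)

theory Defs
  imports "HOL-Analysis.Analysis"
begin

class complex_hilbert = banach +
  fixes scaleC :: "complex \<Rightarrow> 'a \<Rightarrow> 'a"
    and cinner :: "'a \<Rightarrow> 'a \<Rightarrow> complex"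
  assumes scaleC_add_right: "scaleC a (x + y) = scaleC a x + scaleC a y"
    and scaleC_add_left: "scaleC (a + b) x = scaleC a x + scaleC b x"
    and scaleC_scaleC: "scaleC a (scaleC b x) = scaleC (a * b) x"
    and scaleC_one: "scaleC 1 x = x"
    and scaleC_of_real: "scaleC (complex_of_real r) x = scaleR r x"
    and cinner_add_left: "cinner (x + y) z = cinner x z + cinner y z"
    and cinner_scaleC_left: "cinner (scaleC a x) y = a * cinner x y"
    and cinner_commute: "cinner y x = cnj (cinner x y)"
    and cinner_self_norm: "cinner x x = complex_of_real ((norm x)\<^sup>2)"

definition csubspace :: "'a::complex_hilbert set \<Rightarrow> bool" where
  "csubspace S \<longleftrightarrow> 0 \<in> S \<and> (\<forall>x\<in>S. \<forall>y\<in>S. x + y \<in> S) \<and> (\<forall>c. \<forall>x\<in>S. scaleC c x \<in> S)"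

definition clinear_map :: "('a::complex_hilbert \<Rightarrow> 'b::complex_hilbert) \<Rightarrow> bool" where
  "clinear_map f \<longleftrightarrow> (\<forall>x y. f (x + y) = f x + f y) \<and> (\<forall>c x. f (scaleC c x) = scaleC c (f x))"

definition orth :: "'a::complex_hilbert set \<Rightarrow> 'a set" where
  "orth S = {y. \<forall>x\<in>S. cinner x y = 0}"

definition isometric_embedding :: "('a::complex_hilbert \<Rightarrow> 'b::complex_hilbert) \<Rightarrow> bool" where
  "isometric_embedding f \<longleftrightarrow> clinear_map f \<and> (\<forall>x y. cinner (f x) (f y) = cinner x y)"

definition unitary_betw :: "('a::complex_hilbert \<Rightarrow> 'b::complex_hilbert) \<Rightarrow> bool" where
  "unitary_betw f \<longleftrightarrow> isometric_embedding f \<and> surj f"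

definition is_onb :: "'a::complex_hilbert set \<Rightarrow> ('n::finite \<Rightarrow> 'a) \<Rightarrow> bool" where
  "is_onb S u \<longleftrightarrow> (\<forall>j k. cinner (u j) (u k) = (if j = k then 1 else 0))
      \<and> S = {\<Sum>j\<in>UNIV. scaleC (c j) (u j) | c. True}"

definition is_basis :: "'a::complex_hilbert set \<Rightarrow> ('n::finite \<Rightarrow> 'a) \<Rightarrow> bool" where
  "is_basis S w \<longleftrightarrow> (\<forall>c. (\<Sum>j\<in>UNIV. scaleC (c j) (w j)) = 0 \<longrightarrow> (\<forall>j. c j = 0))
      \<and> S = {\<Sum>j\<in>UNIV. scaleC (c j) (w j) | c. True}"

text \<open>A linear transformation B is represented by its domain D and its action T on D.\<close>

definition lin_transf :: "'a::complex_hilbert set \<Rightarrow> ('a \<Rightarrow> 'a) \<Rightarrow> bool" where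
  "lin_transf D T \<longleftrightarrow> csubspace D \<and> (\<forall>x\<in>D. \<forall>y\<in>D. T (x + y) = T x + T y)
      \<and> (\<forall>c. \<forall>x\<in>D. T (scaleC c x) = scaleC c (T x))"

definition symmetric_op :: "'a::complex_hilbert set \<Rightarrow> ('a \<Rightarrow> 'a) \<Rightarrow> bool" where
  "symmetric_op D T \<longleftrightarrow> (\<forall>x\<in>D. \<forall>y\<in>D. cinner (T x) y = cinner x (T y))"

definition closed_op :: "'a::complex_hilbert set \<Rightarrow> ('a \<Rightarrow> 'a) \<Rightarrow> bool" where
  "closed_op D T \<longleftrightarrow> closed {(x, T x) | x. x \<in> D}"

definition ran_shift :: "'a::complex_hilbert set \<Rightarrow> ('a \<Rightarrow> 'a) \<Rightarrow> complex \<Rightarrow> 'a set" where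
  "ran_shift D T z = {T x - scaleC z x | x. x \<in> D}"

definition simple_op :: "'a::complex_hilbert set \<Rightarrow> ('a \<Rightarrow> 'a) \<Rightarrow> bool" where
  "simple_op D T \<longleftrightarrow> (\<Inter>{ran_shift D T z | z. Im z \<noteq> 0}) = {0}"

text \<open>ker(B^* - z) := ran(B - conj z)^\<bottom>\<close>
definition defect :: "'a::complex_hilbert set \<Rightarrow> ('a \<Rightarrow> 'a) \<Rightarrow> complex \<Rightarrow> 'a set" where
  "defect D T z = orth (ran_shift D T (cnj z))"

definition in_S_n :: "'n::finite itself \<Rightarrow> 'a::complex_hilbert set \<Rightarrow> ('a \<Rightarrow> 'a) \<Rightarrow> bool" where
  "in_S_n _ D T \<longleftrightarrow> lin_transf D T \<and> symmetric_op D T \<and> closed_op D T \<and> simple_op D T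
      \<and> (\<exists>u::'n \<Rightarrow> 'a. is_onb (defect D T \<i>) u)
      \<and> (\<exists>v::'n \<Rightarrow> 'a. is_onb (defect D T (- \<i>)) v)"

definition bfun :: "complex \<Rightarrow> complex" where
  "bfun z = (z - \<i>) / (z + \<i>)"

definition cadj_mat :: "complex^'n^'m \<Rightarrow> complex^'m^'n" where
  "cadj_mat M = (\<chi> i j. cnj (M $ j $ i))"

definition unitary_mat :: "complex^'n^'n \<Rightarrow> bool" where
  "unitary_mat M \<longleftrightarrow> M ** cadj_mat M = mat 1 \<and> cadj_mat M ** M = mat 1"

text \<open>Theta_B(z) = b(z) B(z)^{-1} A(z) for orthonormal bases u of ker(B^*-i), v of ker(B^*+i),
 and a (chosen) basis w(z) of ker(B^*-z).\<close>
definition livsic_char :: "'a::complex_hilbert set \<Rightarrow> ('a \<Rightarrow> 'a) \<Rightarrow> ('n::finite \<Rightarrow> 'a) \<Rightarrow> ('n \<Rightarrow> 'a)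
    \<Rightarrow> complex \<Rightarrow> complex^'n^'n" where
  "livsic_char D T u v z =
    (let w = (SOME w :: 'n \<Rightarrow> 'a. is_basis (defect D T z) w);
         Bm = (\<chi> j k. cinner (w j) (u k));
         Am = (\<chi> j k. cinner (w j) (v k))
     in map_matrix (\<lambda>c. bfun z * c) (matrix_inv Bm ** Am))"

definition livsic_inner :: "'n::finite itself \<Rightarrow> 'a::complex_hilbert set \<Rightarrow> ('a \<Rightarrow> 'a) \<Rightarrow> bool" where
  "livsic_inner _ D T \<longleftrightarrow>
    (\<forall>(u::'n \<Rightarrow> 'a) (v::'n \<Rightarrow> 'a). is_onb (defect D T \<i>) u \<longrightarrow> is_onb (defect D T (- \<i>)) v \<longrightarrow>
      (AE x in lborel. \<exists>M. ((\<lambda>y. livsic_char D T u v (complex_of_real x + \<i> * complex_of_real y))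
            \<longlongrightarrow> M) (at_right 0) \<and> unitary_mat M))"

definition reduces :: "('k::complex_hilbert \<Rightarrow> 'k) \<Rightarrow> 'k set \<Rightarrow> bool" where
  "reduces U M \<longleftrightarrow> U ` M \<subseteq> M \<and> U ` (orth M) \<subseteq> orth M"

text \<open>U in Ext(B), where the inclusion H \<subseteq> K is given by the isometric embedding iota.\<close>
definition in_Ext :: "'a::complex_hilbert set \<Rightarrow> ('a \<Rightarrow> 'a) \<Rightarrow> ('a \<Rightarrow> 'k::complex_hilbert)
    \<Rightarrow> ('k \<Rightarrow> 'k) \<Rightarrow> bool" where
  "in_Ext D T \<iota> U \<longleftrightarrow> isometric_embedding \<iota> \<and> unitary_betw U
     \<and> (\<forall>x\<in>D. U (\<iota> (T x + scaleC \<i> x)) = \<iota> (T x - scaleC \<i> x))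
     \<and> (\<forall>M. closed M \<and> csubspace M \<and> range \<iota> \<subseteq> M \<and> reduces U M \<longrightarrow> M = UNIV)"

definition unit_circle :: "complex set" where
  "unit_circle = sphere 0 1"

definition circ_borel :: "complex set set" where
  "circ_borel = {A \<in> sets (borel :: complex measure). A \<subseteq> unit_circle}"

definition scalar_spec_measure :: "(complex set \<Rightarrow> 'k \<Rightarrow> 'k) \<Rightarrow> 'k::complex_hilbert \<Rightarrow> complex measure" where
  "scalar_spec_measure P x = measure_of unit_circle circ_borel (\<lambda>A. ennreal ((norm (P A x))\<^sup>2))"

text \<open>\<langle>(\<integral> f dP) x, y\<rangle> by polarization of the positive measures \<langle>P(.)x,x\<rangle>\<close>
definition spec_form :: "(complex set \<Rightarrow> 'k \<Rightarrow> 'k) \<Rightarrow> (complex \<Rightarrow> complex) \<Rightarrow> 'k::complex_hilbert \<Rightarrow> 'k \<Rightarrow> complex" where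
  "spec_form P f x y = (1/4) * (\<Sum>k\<in>{0..3::nat}. \<i> ^ k *
       integral\<^sup>L (scalar_spec_measure P (x + scaleC (\<i> ^ k) y)) f)"

definition is_spectral_measure :: "('k::complex_hilbert \<Rightarrow> 'k) \<Rightarrow> (complex set \<Rightarrow> 'k \<Rightarrow> 'k) \<Rightarrow> bool" where
  "is_spectral_measure U P \<longleftrightarrow>
     (\<forall>A\<in>circ_borel. clinear_map (P A) \<and> P A \<circ> P A = P A
         \<and> (\<forall>x y. cinner (P A x) y = cinner x (P A y)))
   \<and> P unit_circle = id
   \<and> (\<forall>A\<in>circ_borel. \<forall>B\<in>circ_borel. P (A \<inter> B) = P A \<circ> P B)
   \<and> (\<forall>F. range F \<subseteq> circ_borel \<longrightarrow> disjoint_family F \<longrightarrow>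
         (\<forall>x. (\<lambda>m. P (F m) x) sums P (\<Union>(range F)) x))
   \<and> (\<forall>x y. cinner (U x) y = spec_form P (\<lambda>\<alpha>. \<alpha>) x y)"

definition spectral_measure_of :: "('k::complex_hilbert \<Rightarrow> 'k) \<Rightarrow> complex set \<Rightarrow> 'k \<Rightarrow> 'k" where
  "spectral_measure_of U = (SOME P. is_spectral_measure U P)"

text \<open>G_U(z) = J^* (\<integral> (alpha+b(z))/(alpha-b(z)) dP_U(alpha)) J, as an n\<times>n matrix
  (entry (j,k) = \<langle>G e_k, e_j\<rangle>); the inclusion H \<subseteq> K is iota.\<close>
definition G_fun :: "(complex^'n \<Rightarrow> 'a::complex_hilbert) \<Rightarrow> ('a \<Rightarrow> 'k::complex_hilbert) \<Rightarrow> ('k \<Rightarrow> 'k)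
    \<Rightarrow> complex \<Rightarrow> complex^'n^'n" where
  "G_fun J \<iota> U z = (\<chi> j k. spec_form (spectral_measure_of U) (\<lambda>\<alpha>. (\<alpha> + bfun z) / (\<alpha> - bfun z))
        (\<iota> (J (axis k 1))) (\<iota> (J (axis j 1))))"

definition Phi :: "(complex^'n \<Rightarrow> 'a::complex_hilbert) \<Rightarrow> ('a \<Rightarrow> 'k::complex_hilbert) \<Rightarrow> ('k \<Rightarrow> 'k)
    \<Rightarrow> complex \<Rightarrow> complex^'n^'n" where
  "Phi J \<iota> U z = (G_fun J \<iota> U z - mat 1) ** matrix_inv (G_fun J \<iota> U z + mat 1)"

definition fin_isometry_into :: "(complex^'n \<Rightarrow> 'a::complex_hilbert) \<Rightarrow> 'a set \<Rightarrow> bool" where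
  "fin_isometry_into J S \<longleftrightarrow> (\<forall>x y. J (x + y) = J x + J y) \<and> (\<forall>c x. J (c *s x) = scaleC c (J x))
     \<and> (\<forall>x y. cinner (J x) (J y) = (\<Sum>i\<in>UNIV. x $ i * cnj (y $ i))) \<and> range J \<subseteq> S"

end

theory Submission
  imports Defs "HOL-Probability.Levy" "HOL-Complex_Analysis.Complex_Analysis"
begin

text \<open>Let V be the Cayley transform of B and put zeta = cnj (b z). The Herglotz integral of
  the spectral measure turns G_U(z) into the compression of the resolvent (1 - zeta U)^{-1} to the
  orthogonal complement N of ran V, and the Cayley transform between G and Phi loses nothing because
  G has positive real part. Every h' in H can be written as (1 - cnj zeta V^{-1}) V g' + j' with
  j' in N, and every h as (1 - zeta V) g + j with j in N as soon as no nonzero element of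
  ker (B^* - z) is orthogonal to N. The latter means det A(z) is nonzero, which holds along a vertical
  segment ending at a real point because the Livsic function has a unitary boundary value there. For
  such z the compressed resolvent of U on H is determined by its restriction to N; by analytic
  continuation so are all the moments of U on H, and these determine U on the reducing
  subspace generated by H up to unitary equivalence fixing H.

  That the operator chosen as spectral measure is one needs the spectral theorem for
  unitary operators: the scalar measures are weak limits of Fejer means, and the projections come from
  the Riesz representation theorem.\<close>

subsection \<open>Complex Hilbert spaces\<close>

text \<open>The two arguments of the compressed resolvent behave differently. The second splits for
  every zeta, by inverting 1 - cnj zeta \<open>Vadj\<close>, where \<open>Vadj\<close> is the
  adjoint of V extended by zero. The first needs ran (1 - zeta V) + N to be all of H, which can fail
  at single points. Since the resolvent is analytic in zeta, it is enough to know this near one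
  boundary point.

  The conjugate in zeta comes from an adjoint: on the circle (alpha + b) / (alpha - b) = 2 / (1 - b
  cnj alpha) - 1, and cnj alpha stands for the adjoint of U, so U itself appears together with cnj
  b. G sees only the range of J, but an isometry of C^n into the n-dimensional space N is onto.

  The moment problem yields one measure for each vector, chosen independently. Only the moments link
  them, so sesquilinearity and multiplicativity of the polarised forms are checked on monomials and
  carried to all bounded Borel functions by a uniqueness theorem.\<close>

lemma scaleC_of_real_eq: "scaleC (of_real r) (x::'a::complex_hilbert) = r *\<^sub>R x"
  using scaleC_of_real[of r x] by simp

lemma scaleC_zero_left [simp]: "scaleC 0 (x::'a::complex_hilbert) = 0"
  using scaleC_of_real[of 0 x] by simp

lemma scaleC_minus1: "scaleC (- 1) (x::'a::complex_hilbert) = - x"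
  using scaleC_of_real[of "-1" x] by simp

lemma scaleC_zero_right [simp]: "scaleC a (0::'a::complex_hilbert) = 0"
  using scaleC_add_right[of a 0 "0::'a"] by simp

lemma scaleC_minus_right: "scaleC a (- x::'a::complex_hilbert) = - scaleC a x"
  using scaleC_add_right[of a x "- x"] by (simp add: eq_neg_iff_add_eq_0 add.commute)

lemma scaleC_minus_left: "scaleC (- a) (x::'a::complex_hilbert) = - scaleC a x"
  using scaleC_add_left[of a "- a" x] by (simp add: eq_neg_iff_add_eq_0 add.commute)

lemma scaleC_diff_right: "scaleC a (x - y::'a::complex_hilbert) = scaleC a x - scaleC a y"
  using scaleC_add_right[of a x "- y"] by (simp add: scaleC_minus_right)

lemma scaleC_one_left [simp]: "scaleC 1 (x::'a::complex_hilbert) = x"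
  by (rule scaleC_one)

lemma scaleC_scaleR: "scaleC a (r *\<^sub>R x::'a::complex_hilbert) = r *\<^sub>R scaleC a x"
  by (simp add: scaleC_of_real_eq[symmetric] scaleC_scaleC mult.commute)

lemma scaleC_sum_right: "scaleC a (\<Sum>i\<in>I. f i::'a::complex_hilbert) = (\<Sum>i\<in>I. scaleC a (f i))"
  by (induction I rule: infinite_finite_induct) (auto simp: scaleC_add_right)

lemma cinner_zero_left [simp]: "cinner 0 (x::'a::complex_hilbert) = 0"
  using cinner_scaleC_left[of 0 0 x] by simp

lemma cinner_zero_right [simp]: "cinner (x::'a::complex_hilbert) 0 = 0"
  using cinner_commute[of x 0] by simp

lemma cinner_add_right: "cinner (x::'a::complex_hilbert) (y + z) = cinner x y + cinner x z"
  by (metis cinner_add_left cinner_commute complex_cnj_add)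

lemma cinner_scaleC_right: "cinner (x::'a::complex_hilbert) (scaleC a y) = cnj a * cinner x y"
  by (metis cinner_scaleC_left cinner_commute complex_cnj_mult)

lemma cinner_minus_left: "cinner (- x) (y::'a::complex_hilbert) = - cinner x y"
  using cinner_scaleC_left[of "-1" x y] by (simp add: scaleC_minus1)

lemma cinner_minus_right: "cinner (x::'a::complex_hilbert) (- y) = - cinner x y"
  using cinner_scaleC_right[of x "-1" y] by (simp add: scaleC_minus1)

lemma cinner_diff_left: "cinner (x - y) (z::'a::complex_hilbert) = cinner x z - cinner y z"
  using cinner_add_left[of x "- y" z] by (simp add: cinner_minus_left)

lemma cinner_diff_right: "cinner (z::'a::complex_hilbert) (x - y) = cinner z x - cinner z y"
  using cinner_add_right[of z x "- y"] by (simp add: cinner_minus_right)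

lemma cinner_scaleR_left: "cinner (r *\<^sub>R x) (y::'a::complex_hilbert) = of_real r * cinner x y"
  by (simp add: scaleC_of_real_eq[symmetric] cinner_scaleC_left)

lemma cinner_scaleR_right: "cinner (x::'a::complex_hilbert) (r *\<^sub>R y) = of_real r * cinner x y"
  by (simp add: scaleC_of_real_eq[symmetric] cinner_scaleC_right)

lemma cinner_sum_left: "cinner (\<Sum>i\<in>I. f i) (y::'a::complex_hilbert) = (\<Sum>i\<in>I. cinner (f i) y)"
  by (induction I rule: infinite_finite_induct) (auto simp: cinner_add_left)

lemma cinner_sum_right: "cinner (y::'a::complex_hilbert) (\<Sum>i\<in>I. f i) = (\<Sum>i\<in>I. cinner y (f i))"
  by (induction I rule: infinite_finite_induct) (auto simp: cinner_add_right)

lemmas cinner_simps = cinner_add_left cinner_add_right cinner_diff_left cinner_diff_right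
  cinner_scaleC_left cinner_scaleC_right cinner_minus_left cinner_minus_right

lemma cinner_self_eq_0_iff: "cinner x x = 0 \<longleftrightarrow> (x::'a::complex_hilbert) = 0"
  by (simp add: cinner_self_norm)

lemma cinner_ext_left: "(\<And>x::'a::complex_hilbert. cinner x y = cinner x z) \<Longrightarrow> y = z"
  using cinner_self_eq_0_iff[of "y - z"] by (simp add: cinner_diff_right)

lemma norm_scaleC: "norm (scaleC a x::'a::complex_hilbert) = cmod a * norm x"
proof -
  have "complex_of_real ((norm (scaleC a x))\<^sup>2) = a * cnj a * complex_of_real ((norm x)\<^sup>2)"
    by (simp only: cinner_self_norm[symmetric]) (simp add: cinner_simps ac_simps)
  also have "\<dots> = complex_of_real ((cmod a * norm x)\<^sup>2)"
    by (simp only: complex_norm_square[symmetric] power_mult_distrib of_real_mult)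
  finally have "(norm (scaleC a x))\<^sup>2 = (cmod a * norm x)\<^sup>2" using of_real_eq_iff by blast
  then show ?thesis by (simp add: power2_eq_iff_nonneg)
qed

lemma norm_add_sq: "(norm (x + y::'a::complex_hilbert))\<^sup>2 = (norm x)\<^sup>2 + (norm y)\<^sup>2 + 2 * Re (cinner x y)"
proof -
  have "complex_of_real ((norm (x + y))\<^sup>2) = cinner (x + y) (x + y)" by (simp add: cinner_self_norm)
  also have "\<dots> = cinner x x + cinner y y + (cinner x y + cnj (cinner x y))"
    by (simp add: cinner_simps cinner_commute[of y x])
  also have "\<dots> = complex_of_real ((norm x)\<^sup>2 + (norm y)\<^sup>2 + 2 * Re (cinner x y))"
    by (simp add: cinner_self_norm complex_add_cnj)
  finally show ?thesis using of_real_eq_iff by blast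
qed

lemma norm_diff_sq: "(norm (x - y::'a::complex_hilbert))\<^sup>2 = (norm x)\<^sup>2 + (norm y)\<^sup>2 - 2 * Re (cinner x y)"
  using norm_add_sq[of x "- y"] by (simp add: cinner_minus_right)

lemma cinner_Cauchy_Schwarz: "cmod (cinner x y) \<le> norm x * norm (y::'a::complex_hilbert)"
proof (cases "y = 0")
  case False
  \<comment> \<open>\<open>scaleC c y\<close> is the projection of x on the line through y; the
    squared norm of the remainder is nonnegative.\<close>
  define c where "c = cinner x y / complex_of_real ((norm y)\<^sup>2)"
  have ny: "norm y > 0" using False by simp
  have nc: "cmod c = cmod (cinner x y) / (norm y)\<^sup>2" by (simp add: c_def norm_divide norm_power)
  have "0 \<le> (norm (x - scaleC c y))\<^sup>2" by simp
  also have "\<dots> = (norm x)\<^sup>2 + (cmod c * norm y)\<^sup>2 - 2 * Re (cnj c * cinner x y)"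
    by (simp add: norm_diff_sq norm_scaleC cinner_simps)
  also have "cnj c * cinner x y = of_real ((cmod (cinner x y))\<^sup>2 / (norm y)\<^sup>2)"
    unfolding c_def using complex_norm_square[of "cinner x y"] by (simp add: ac_simps)
  also have "(cmod c * norm y)\<^sup>2 = (cmod (cinner x y))\<^sup>2 / (norm y)\<^sup>2"
    using ny by (simp add: nc field_simps power2_eq_square)
  finally have "(cmod (cinner x y))\<^sup>2 / (norm y)\<^sup>2 \<le> (norm x)\<^sup>2" by simp
  then have "(cmod (cinner x y))\<^sup>2 \<le> (norm x * norm y)\<^sup>2"
    using ny by (simp add: divide_le_eq power_mult_distrib)
  then show ?thesis by (rule power2_le_imp_le) simp
qed simp

lemma bounded_bilinear_cinner: "bounded_bilinear (cinner::'a::complex_hilbert \<Rightarrow> 'a \<Rightarrow> complex)"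
  by standard (auto simp: cinner_add_left cinner_add_right cinner_scaleR_left cinner_scaleR_right
      scaleR_conv_of_real intro!: exI[of _ 1] cinner_Cauchy_Schwarz)

lemma bounded_bilinear_scaleC: "bounded_bilinear (scaleC :: complex \<Rightarrow> 'a::complex_hilbert \<Rightarrow> 'a)"
  by standard (auto simp: scaleC_add_left scaleC_add_right scaleC_scaleR scaleC_scaleC
      scaleC_of_real_eq[symmetric] scaleR_conv_of_real norm_scaleC mult.commute intro!: exI[of _ 1])

lemmas tendsto_scaleC = bounded_bilinear.tendsto[OF bounded_bilinear_scaleC]
lemmas bounded_linear_scaleC_right = bounded_bilinear.bounded_linear_right[OF bounded_bilinear_scaleC]

text \<open>Has the powers of \<open>\<i>\<close> and the argument order of
  \<open>spec_form\<close>, so that sums of that shape can be folded back into an inner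
  product.\<close>

lemma cinner_polarization:
  "cinner x (y::'a::complex_hilbert)
    = (1/4) * (\<Sum>k\<in>{0..3::nat}. \<i> ^ k * complex_of_real ((norm (x + scaleC (\<i> ^ k) y))\<^sup>2))"
  by (simp only: cinner_self_norm[symmetric])
    (simp add: eval_nat_numeral cinner_simps algebra_simps scaleC_minus_left scaleC_minus1)

section \<open>Subspaces, orthogonal projection and the Riesz representation\<close>

lemma csubspaceD:
  assumes "csubspace S"
  shows "0 \<in> S" "\<And>x y. x \<in> S \<Longrightarrow> y \<in> S \<Longrightarrow> x + y \<in> S" "\<And>c x. x \<in> S \<Longrightarrow> scaleC c x \<in> S"
    "\<And>x y. x \<in> S \<Longrightarrow> y \<in> S \<Longrightarrow> x - y \<in> S" "\<And>r x. x \<in> S \<Longrightarrow> r *\<^sub>R x \<in> S"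
    "\<And>I f. (\<And>i. i \<in> I \<Longrightarrow> f i \<in> S) \<Longrightarrow> sum f I \<in> S"
proof -
  show 0: "0 \<in> S" and a: "\<And>x y. x \<in> S \<Longrightarrow> y \<in> S \<Longrightarrow> x + y \<in> S" and c: "\<And>c x. x \<in> S \<Longrightarrow> scaleC c x \<in> S"
    using assms by (auto simp: csubspace_def)
  show "x \<in> S \<Longrightarrow> y \<in> S \<Longrightarrow> x - y \<in> S" for x y
    using a[of x "scaleC (-1) y"] c[of y "-1"] by (simp add: scaleC_minus1)
  show "x \<in> S \<Longrightarrow> r *\<^sub>R x \<in> S" for r x
    using c[of x "of_real r"] by (simp add: scaleC_of_real_eq)
  show "(\<And>i. i \<in> I \<Longrightarrow> f i \<in> S) \<Longrightarrow> sum f I \<in> S" for I f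
    by (induction I rule: infinite_finite_induct) (auto simp: 0 a)
qed

lemma csubspace_orth: "csubspace (orth S)"
  by (auto simp: csubspace_def orth_def cinner_simps)

lemma orth_commute: "x \<in> S \<Longrightarrow> y \<in> orth S \<Longrightarrow> cinner y x = 0"
  using cinner_commute[of y x] by (simp add: orth_def)

text \<open>A minimising sequence is Cauchy by the parallelogram law, its limit lies in M by
  closedness, and a residual with a component along some y in M could be shortened.\<close>

theorem orth_projection_exists:
  fixes M :: "'a::complex_hilbert set"
  assumes M: "csubspace M" and cl: "closed M"
  shows "\<exists>m\<in>M. x - m \<in> orth M"
proof -
  define d where "d = (INF m\<in>M. norm (x - m))"
  have bdd: "bdd_below ((\<lambda>m. norm (x - m)) ` M)" by (auto intro: bdd_belowI[of _ 0])
  have ne: "M \<noteq> {}" using csubspaceD(1)[OF M] by auto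
  have dle: "d \<le> norm (x - m)" if "m \<in> M" for m
    unfolding d_def using bdd that by (rule cINF_lower)
  have d0: "d \<ge> 0" unfolding d_def using ne by (auto intro: cINF_greatest)
  have "\<exists>m\<in>M. norm (x - m) < d + 1 / real (Suc n)" for n
  proof -
    have "(INF m\<in>M. norm (x - m)) < d + 1 / real (Suc n)" by (simp add: d_def)
    then show ?thesis by (simp add: cINF_less_iff[OF ne bdd])
  qed
  then obtain m where mM: "\<And>n. m n \<in> M" and mn: "\<And>n. norm (x - m n) < d + 1 / real (Suc n)" by metis
  have lim: "(\<lambda>n. norm (x - m n)) \<longlonglongrightarrow> d"
  proof (rule tendsto_sandwich[of "\<lambda>_. d"])
    show "(\<lambda>n. d + 1 / real (Suc n)) \<longlonglongrightarrow> d"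
      using tendsto_add[OF tendsto_const LIMSEQ_inverse_real_of_nat, of d] by (simp add: inverse_eq_divide)
  qed (use mM mn dle in \<open>auto intro: less_imp_le eventuallyI\<close>)
  \<comment> \<open>Parallelogram law for the residuals: the midpoint of \<open>m p\<close> and
    \<open>m q\<close> lies in M, so its distance from x is at least d.\<close>
  have par: "(norm (m p - m q))\<^sup>2 \<le> 2 * (norm (x - m p))\<^sup>2 + 2 * (norm (x - m q))\<^sup>2 - 4 * d\<^sup>2" for p q
  proof -
    have "(1/2) *\<^sub>R (m p + m q) \<in> M" using mM by (auto intro!: csubspaceD[OF M])
    then have "d \<le> norm (x - (1/2) *\<^sub>R (m p + m q))" by (rule dle)
    then have "d\<^sup>2 \<le> (norm (x - (1/2) *\<^sub>R (m p + m q)))\<^sup>2" using d0 by (rule power_mono)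
    moreover have "(x - m p) + (x - m q) = 2 *\<^sub>R (x - (1/2) *\<^sub>R (m p + m q))"
      by (simp add: algebra_simps scaleR_2)
    then have "(norm ((x - m p) + (x - m q)))\<^sup>2 = 4 * (norm (x - (1/2) *\<^sub>R (m p + m q)))\<^sup>2"
      by (simp add: power_mult_distrib)
    moreover have "(norm (m p - m q))\<^sup>2 = (norm ((x - m q) - (x - m p)))\<^sup>2" by simp
    ultimately show ?thesis
      using norm_add_sq[of "x - m p" "x - m q"] norm_diff_sq[of "x - m q" "x - m p"]
      by (simp add: cinner_commute[of "x - m q"])
  qed
  have "Cauchy m"
  proof (rule CauchyI)
    fix e :: real assume e: "e > 0"
    have "(\<lambda>n. (norm (x - m n))\<^sup>2) \<longlonglongrightarrow> d\<^sup>2" by (intro tendsto_intros lim)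
    then have "eventually (\<lambda>n. (norm (x - m n))\<^sup>2 < d\<^sup>2 + e\<^sup>2 / 4) sequentially"
      by (rule order_tendstoD) (use e in auto)
    then obtain N where N: "\<And>n. n \<ge> N \<Longrightarrow> (norm (x - m n))\<^sup>2 < d\<^sup>2 + e\<^sup>2 / 4"
      by (auto simp: eventually_sequentially)
    show "\<exists>N. \<forall>p\<ge>N. \<forall>q\<ge>N. norm (m p - m q) < e"
    proof (intro exI allI impI)
      fix p q assume "p \<ge> N" "q \<ge> N"
      then have "(norm (m p - m q))\<^sup>2 < e\<^sup>2" using par[of p q] N[of p] N[of q] by simp
      then show "norm (m p - m q) < e" by (rule power2_less_imp_less) (use e in simp)
    qed
  qed
  then obtain l where l: "m \<longlonglongrightarrow> l" using Cauchy_convergent_iff convergentD by blast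
  have lM: "l \<in> M" using closed_sequentially[OF cl] mM l by blast
  have nl: "norm (x - l) = d"
    using LIMSEQ_unique[OF tendsto_norm[OF tendsto_diff[OF tendsto_const l]] lim] .
  have "cinner y (x - l) = 0" if y: "y \<in> M" for y
  proof (cases "y = 0")
    case False
    \<comment> \<open>The best shift along y: it would lower the squared distance by |<x - l, y>|^2
      / |y|^2, which minimality forces to be zero.\<close>
    define c where "c = cinner (x - l) y / complex_of_real ((norm y)\<^sup>2)"
    have ny: "norm y > 0" using False by simp
    have nc: "cmod c = cmod (cinner (x - l) y) / (norm y)\<^sup>2"
      by (simp add: c_def norm_divide norm_power)
    have "l + scaleC c y \<in> M" using lM y by (auto intro!: csubspaceD[OF M])
    then have "norm (x - l) \<le> norm (x - l - scaleC c y)" using dle nl by (metis diff_diff_add)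
    then have "(norm (x - l))\<^sup>2 \<le> (norm (x - l - scaleC c y))\<^sup>2" by simp
    also have "\<dots> = (norm (x - l))\<^sup>2 + (cmod c * norm y)\<^sup>2 - 2 * Re (cnj c * cinner (x - l) y)"
      by (subst norm_diff_sq) (simp add: norm_scaleC cinner_scaleC_right)
    also have "cnj c * cinner (x - l) y = of_real ((cmod (cinner (x - l) y))\<^sup>2 / (norm y)\<^sup>2)"
      unfolding c_def using complex_norm_square[of "cinner (x - l) y"] by (simp add: ac_simps)
    also have "(cmod c * norm y)\<^sup>2 = (cmod (cinner (x - l) y))\<^sup>2 / (norm y)\<^sup>2"
      using ny by (simp add: nc field_simps power2_eq_square)
    finally have "(cmod (cinner (x - l) y))\<^sup>2 / (norm y)\<^sup>2 \<le> 0" by simp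
    then have "cinner (x - l) y = 0" using ny by (simp add: divide_le_0_iff)
    then show ?thesis by (metis cinner_commute complex_cnj_zero)
  qed simp
  with lM show ?thesis by (auto simp: orth_def)
qed

lemma orth_orth:
  assumes M: "csubspace (M::'a::complex_hilbert set)" and "closed M"
  shows "orth (orth M) = M"
proof
  show "M \<subseteq> orth (orth M)" unfolding orth_def[of "orth M"] using orth_commute[of _ M] by auto
  show "orth (orth M) \<subseteq> M"
  proof
    fix x assume x: "x \<in> orth (orth M)"
    obtain m where m: "m \<in> M" "x - m \<in> orth M" using orth_projection_exists[OF assms] by blast
    have "cinner (x - m) (x - m) = cinner (x - m) x - cinner (x - m) m" by (simp add: cinner_diff_right)
    also have "\<dots> = 0" using x m orth_commute[OF m] by (auto simp: orth_def)
    finally show "x \<in> M" using m by (simp add: cinner_self_eq_0_iff)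
  qed
qed

text \<open>Boundedness makes the kernel closed, so a nonzero f has some e orthogonal to its kernel
  with \<open>f e \<noteq> 0\<close>. Modulo the kernel every z is a multiple of e, which determines
  f.\<close>

theorem Riesz_representation:
  fixes f :: "'a::complex_hilbert \<Rightarrow> complex"
  assumes add: "\<And>x y. f (x + y) = f x + f y" and scale: "\<And>c x. f (scaleC c x) = c * f x"
    and bound: "\<And>x. cmod (f x) \<le> K * norm x"
  shows "\<exists>y. \<forall>x. f x = cinner x y"
proof (cases "\<forall>x. f x = 0")
  case True then show ?thesis by (auto intro!: exI[of _ 0])
next
  case False
  then obtain x where x: "f x \<noteq> 0" by blast
  have sR: "f (r *\<^sub>R x) = r *\<^sub>R f x" for r x
    using scale[of "of_real r" x] by (simp add: scaleC_of_real_eq scaleR_conv_of_real)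
  have bl: "bounded_linear f"
    by (rule bounded_linear_intro[of f K]) (auto simp: add sR mult.commute bound)
  have diff: "f (x - y) = f x - f y" for x y
    using bl bounded_linear.linear linear_diff by blast
  define M where "M = {x. f x = 0}"
  have "csubspace M" unfolding csubspace_def M_def using scale[of 0 0] by (auto simp: add scale)
  moreover have "closed M" unfolding M_def
    by (intro closed_Collect_eq continuous_on_const linear_continuous_on bl)
  ultimately obtain m where m: "m \<in> M" "x - m \<in> orth M" using orth_projection_exists by blast
  define e where "e = x - m"
  have fe: "f e = f x" using m by (simp add: e_def diff M_def)
  have ne: "cinner e e \<noteq> 0" using fe x scale[of 0 e] by (auto simp: cinner_self_eq_0_iff)
  have "f z = cinner z (scaleC (cnj (f e / cinner e e)) e)" for z
  proof -
    have "z - scaleC (f z / f e) e \<in> M" using x by (simp add: M_def diff scale fe)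
    then have "cinner (z - scaleC (f z / f e) e) e = 0" using m by (simp add: e_def orth_def)
    then have "cinner z e = (f z / f e) * cinner e e" by (simp add: cinner_simps)
    then show ?thesis using ne x fe by (simp add: cinner_simps)
  qed
  then show ?thesis by blast
qed

lemma cinner_summable_sums:
  assumes "summable f"
  shows "(\<lambda>n. cinner (f n) (y::'a::complex_hilbert)) sums cinner (suminf f) y"
  by (rule bounded_linear.sums[OF bounded_bilinear.bounded_linear_left[OF bounded_bilinear_cinner] summable_sums[OF assms]])

subsection \<open>Contractions and Neumann series\<close>

lemma clinear_mapD:
  assumes "clinear_map f"
  shows "f (x + y) = f x + f y" "f (scaleC c x) = scaleC c (f x)" "f 0 = 0" "f (x - y) = f x - f y"
    "f (r *\<^sub>R x) = r *\<^sub>R f x"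
proof -
  show a: "f (x + y) = f x + f y" and c: "f (scaleC c x) = scaleC c (f x)" for x y c
    using assms by (auto simp: clinear_map_def)
  show "f 0 = 0" using c[of 0 0] by simp
  show "f (x - y) = f x - f y" using a[of "x - y" y] by simp
  show "f (r *\<^sub>R x) = r *\<^sub>R f x" using c[of "of_real r" x] by (simp add: scaleC_of_real_eq)
qed

text \<open>Contractions are the common setting for the resolvents of the unitary extensions and
  those of the zero-extended partial isometry and its adjoint.\<close>

definition ccontraction :: "('a::complex_hilbert \<Rightarrow> 'b::complex_hilbert) \<Rightarrow> bool" where
  "ccontraction S \<longleftrightarrow> clinear_map S \<and> (\<forall>x. norm (S x) \<le> norm x)"

lemma ccontraction_clinear: "ccontraction S \<Longrightarrow> clinear_map S"
  by (simp add: ccontraction_def)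

lemma ccontraction_bounded_linear: "ccontraction S \<Longrightarrow> bounded_linear S"
  by (rule bounded_linear_intro[where K = 1]) (auto simp: ccontraction_def clinear_mapD)

lemma norm_funpow_ccontraction:
  assumes "ccontraction (S::'a::complex_hilbert \<Rightarrow> 'a)" shows "norm ((S ^^ m) x) \<le> norm x"
proof (induction m)
  case (Suc m)
  have "norm (S ((S ^^ m) x)) \<le> norm ((S ^^ m) x)" using assms by (simp add: ccontraction_def)
  then show ?case using Suc by simp
qed simp

text \<open>The resolvent (1 - zeta S)^{-1} on the open unit disc. Paired with a vector, it is a
  power series in \<open>\<zeta>\<close> whose coefficients are moments of S.\<close>

definition neumann :: "('a::complex_hilbert \<Rightarrow> 'a) \<Rightarrow> complex \<Rightarrow> 'a \<Rightarrow> 'a" where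
  "neumann S \<zeta> k = (\<Sum>m. scaleC (\<zeta> ^ m) ((S ^^ m) k))"

lemma summable_neumann:
  assumes "ccontraction (S::'a::complex_hilbert \<Rightarrow> 'a)" "cmod \<zeta> < 1"
  shows "summable (\<lambda>m. scaleC (\<zeta> ^ m) ((S ^^ m) k))"
proof (rule summable_comparison_test')
  show "summable (\<lambda>m. cmod \<zeta> ^ m * norm k)" using assms by (intro summable_mult2 summable_geometric) simp
  show "norm (scaleC (\<zeta> ^ m) ((S ^^ m) k)) \<le> cmod \<zeta> ^ m * norm k" for m
    by (simp add: norm_scaleC norm_power mult_left_mono norm_funpow_ccontraction[OF assms(1)])
qed

lemma neumann_unfold:
  assumes "ccontraction S" "cmod \<zeta> < 1"
  shows "neumann S \<zeta> k = k + scaleC \<zeta> (S (neumann S \<zeta> k))"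
proof -
  let ?f = "\<lambda>m. scaleC (\<zeta> ^ m) ((S ^^ m) k)"
  have "suminf ?f = ?f 0 + (\<Sum>m. ?f (Suc m))" using suminf_split_head[OF summable_neumann[OF assms, of k]] by simp
  also have "(\<lambda>m. ?f (Suc m)) = (\<lambda>m. scaleC \<zeta> (S (?f m)))"
    by (simp add: clinear_mapD[OF ccontraction_clinear[OF assms(1)]] scaleC_scaleC)
  also have "suminf \<dots> = scaleC \<zeta> (S (suminf ?f))"
    using bounded_linear.suminf[OF bounded_linear_compose[OF bounded_linear_scaleC_right
        ccontraction_bounded_linear[OF assms(1)]] summable_neumann[OF assms], of \<zeta>] by simp
  finally show ?thesis unfolding neumann_def power_0 funpow_0 scaleC_one_left .
qed

lemma neumann_inverse:
  assumes "ccontraction S" "cmod \<zeta> < 1"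
  shows "neumann S \<zeta> k - scaleC \<zeta> (S (neumann S \<zeta> k)) = k"
  by (subst (1) neumann_unfold[OF assms]) simp

text \<open>The difference d of two solutions satisfies |d| \<le> |zeta| |d| and vanishes. Linearity
  and intertwining of the resolvent are deduced from this rather than from the series.\<close>

lemma neumann_unique:
  assumes S: "ccontraction S" and z: "cmod \<zeta> < 1" and F: "F - scaleC \<zeta> (S F) = k"
  shows "F = neumann S \<zeta> k"
proof -
  define d where "d = F - neumann S \<zeta> k"
  have "d - scaleC \<zeta> (S d) = (F - scaleC \<zeta> (S F)) - (neumann S \<zeta> k - scaleC \<zeta> (S (neumann S \<zeta> k)))"
    by (simp add: d_def clinear_mapD(4)[OF ccontraction_clinear[OF S]] scaleC_diff_right algebra_simps)
  then have "d = scaleC \<zeta> (S d)" by (simp add: F neumann_inverse[OF S z])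
  then have "norm d = norm (scaleC \<zeta> (S d))" by (rule arg_cong)
  also have "\<dots> = cmod \<zeta> * norm (S d)" by (rule norm_scaleC)
  also have "\<dots> \<le> cmod \<zeta> * norm d" using S by (intro mult_left_mono) (auto simp: ccontraction_def)
  finally have "(1 - cmod \<zeta>) * norm d \<le> 0" by (simp add: algebra_simps)
  then have "norm d = 0" using z by (simp add: mult_le_0_iff)
  then show ?thesis by (simp add: d_def)
qed

lemma neumann_shift:
  assumes "ccontraction S" "cmod \<zeta> < 1"
  shows "neumann S \<zeta> (k - scaleC \<zeta> (S k)) = k"
  by (rule neumann_unique[OF assms, symmetric]) simp

lemma clinear_map_neumann:
  assumes S: "ccontraction S" and z: "cmod \<zeta> < 1"
  shows "clinear_map (neumann S \<zeta>)"
proof -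
  note l = clinear_mapD[OF ccontraction_clinear[OF S]]
  have "neumann S \<zeta> x + neumann S \<zeta> y = neumann S \<zeta> (x + y)" for x y
  proof (rule neumann_unique[OF S z])
    show "neumann S \<zeta> x + neumann S \<zeta> y - scaleC \<zeta> (S (neumann S \<zeta> x + neumann S \<zeta> y)) = x + y"
      by (simp add: l scaleC_add_right add_diff_add neumann_inverse[OF S z])
  qed
  moreover have "scaleC c (neumann S \<zeta> x) = neumann S \<zeta> (scaleC c x)" for c x
  proof (rule neumann_unique[OF S z])
    show "scaleC c (neumann S \<zeta> x) - scaleC \<zeta> (S (scaleC c (neumann S \<zeta> x))) = scaleC c x"
      by (simp add: l mult.commute[of \<zeta>] scaleC_scaleC flip: scaleC_diff_right)
        (simp add: scaleC_scaleC[symmetric] neumann_inverse[OF S z] flip: scaleC_diff_right)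
  qed
  ultimately show ?thesis by (simp add: clinear_map_def)
qed

lemma neumann_eq_0_iff:
  assumes "ccontraction S" "cmod \<zeta> < 1"
  shows "neumann S \<zeta> k = 0 \<longleftrightarrow> k = 0"
  using neumann_inverse[OF assms, of k] clinear_mapD(3)[OF clinear_map_neumann[OF assms]]
    clinear_mapD(3)[OF ccontraction_clinear[OF assms(1)]] by auto

text \<open>With F the resolvent of k, k = F - zeta S F, so the pairing is |F|^2 - <F, zeta S F>,
  and the second term is strictly smaller in modulus. This is what makes G + 1 invertible.\<close>

lemma Re_cinner_neumann_pos:
  assumes S: "ccontraction S" and z: "cmod \<zeta> < 1" and k: "k \<noteq> 0"
  shows "Re (cinner (neumann S \<zeta> k) k) > 0"
proof -
  define F where "F = neumann S \<zeta> k"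
  have Fk: "k = F - scaleC \<zeta> (S F)" using neumann_inverse[OF S z, of k] by (simp add: F_def)
  have F0: "norm F > 0" using k neumann_eq_0_iff[OF S z] by (simp add: F_def)
  have "Re (cinner F (scaleC \<zeta> (S F))) \<le> norm F * (cmod \<zeta> * norm (S F))"
    by (metis cinner_Cauchy_Schwarz complex_Re_le_cmod norm_scaleC order_trans)
  also have "\<dots> \<le> norm F * (cmod \<zeta> * norm F)"
    using S by (intro mult_left_mono) (auto simp: ccontraction_def)
  also have "\<dots> < norm F * (1 * norm F)" using z F0 by (intro mult_strict_left_mono mult_strict_right_mono) auto
  also have "\<dots> = Re (cinner F F)" by (simp add: cinner_self_norm power2_eq_square)
  finally have "Re (cinner F (F - scaleC \<zeta> (S F))) > 0" by (simp add: cinner_diff_right)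
  then show ?thesis unfolding F_def neumann_inverse[OF S z] .
qed

section \<open>Isometries and unitaries\<close>

lemma isometric_embeddingD:
  assumes "isometric_embedding f"
  shows "clinear_map f" "cinner (f x) (f y) = cinner x y" "norm (f x) = norm x" "inj f" "ccontraction f"
proof -
  show l: "clinear_map f" and c: "cinner (f x) (f y) = cinner x y" for x y
    using assms by (auto simp: isometric_embedding_def)
  have "complex_of_real ((norm (f x))\<^sup>2) = complex_of_real ((norm x)\<^sup>2)" for x
    using c[of x x] by (simp only: cinner_self_norm)
  then have n: "norm (f x) = norm x" for x by (subst (asm) of_real_eq_iff) (simp add: power2_eq_iff_nonneg)
  show "norm (f x) = norm x" by (rule n)
  show "inj f"
  proof (rule injI)
    fix x y assume "f x = f y"
    then show "x = y" using n[of "x - y"] by (simp add: clinear_mapD[OF l])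
  qed
  show "ccontraction f" using l n by (simp add: ccontraction_def)
qed

lemma unitary_betwD:
  assumes "unitary_betw U"
  shows "isometric_embedding U" "surj U" "bij U" "U (inv U x) = x" "inv U (U y) = y"
    "cinner (U y) x = cinner y (inv U x)"
proof -
  show i: "isometric_embedding U" and s: "surj U" using assms by (auto simp: unitary_betw_def)
  then show "bij U" using isometric_embeddingD(4) by (auto simp: bij_def)
  show e: "U (inv U x) = x" using s by (simp add: surj_f_inv_f)
  show "inv U (U y) = y" using isometric_embeddingD(4)[OF i] by simp
  show "cinner (U y) x = cinner y (inv U x)" using isometric_embeddingD(2)[OF i, of y "inv U x"] e by simp
qed

lemma unitary_betw_inv:
  assumes "unitary_betw U"
  shows "unitary_betw (inv U)"
proof -
  note u = unitary_betwD[OF assms] note l = clinear_mapD[OF isometric_embeddingD(1)[OF u(1)]]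
  have "inv U (x + y) = inv U x + inv U y" for x y by (metis l(1) u(4,5))
  moreover have "inv U (scaleC c x) = scaleC c (inv U x)" for c x by (metis l(2) u(4,5))
  moreover have "cinner (inv U x) (inv U y) = cinner x y" for x y by (metis u(4,6))
  ultimately show ?thesis
    using bij_imp_bij_inv[OF u(3)] by (auto simp: unitary_betw_def isometric_embedding_def clinear_map_def bij_def)
qed

subsection \<open>Bounded Borel functions on the circle\<close>

text \<open>Bounded only on the circle, because the Herglotz kernel has its pole inside the disc;
  measurable on the whole plane, so that functions never have to be restricted.\<close>

definition circ_bounded :: "(complex \<Rightarrow> complex) \<Rightarrow> bool" where
  "circ_bounded f \<longleftrightarrow> f \<in> borel_measurable borel \<and> (\<exists>C. \<forall>a\<in>unit_circle. cmod (f a) \<le> C)"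

text \<open>The last clause is sequential continuity for bounded pointwise convergence; with constant
  sequences it implies that such a functional only depends on the values on the circle.\<close>

definition cfunctional :: "((complex \<Rightarrow> complex) \<Rightarrow> complex) \<Rightarrow> bool" where
  "cfunctional L \<longleftrightarrow>
     (\<forall>f g. circ_bounded f \<longrightarrow> circ_bounded g \<longrightarrow> L (\<lambda>a. f a + g a) = L f + L g) \<and>
     (\<forall>c f. circ_bounded f \<longrightarrow> L (\<lambda>a. c * f a) = c * L f) \<and>
     (\<forall>F f C. (\<forall>n. circ_bounded (F n)) \<longrightarrow> circ_bounded f \<longrightarrow> (\<forall>n. \<forall>a\<in>unit_circle. cmod (F n a) \<le> C) \<longrightarrow>
        (\<forall>a\<in>unit_circle. (\<lambda>n. F n a) \<longlonglongrightarrow> f a) \<longrightarrow> (\<lambda>n. L (F n)) \<longlonglongrightarrow> L f)"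

lemma circ_bounded_const [intro!]: "circ_bounded (\<lambda>_. c)"
  by (auto simp: circ_bounded_def)

lemma circ_bounded_add [intro!]:
  assumes "circ_bounded f" "circ_bounded g" shows "circ_bounded (\<lambda>a. f a + g a)"
proof -
  obtain C D where "\<forall>a\<in>unit_circle. cmod (f a) \<le> C" "\<forall>a\<in>unit_circle. cmod (g a) \<le> D"
    using assms by (auto simp: circ_bounded_def)
  then have "\<forall>a\<in>unit_circle. cmod (f a + g a) \<le> C + D" by (auto intro: norm_triangle_mono)
  then show ?thesis using assms by (auto simp: circ_bounded_def)
qed

lemma circ_bounded_mult [intro!]:
  assumes "circ_bounded f" "circ_bounded g" shows "circ_bounded (\<lambda>a. f a * g a)"
proof -
  obtain C D where "\<forall>a\<in>unit_circle. cmod (f a) \<le> C" "\<forall>a\<in>unit_circle. cmod (g a) \<le> D"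
    using assms by (auto simp: circ_bounded_def)
  then have "\<forall>a\<in>unit_circle. cmod (f a * g a) \<le> \<bar>C\<bar> * \<bar>D\<bar>"
    by (auto simp: norm_mult intro!: mult_mono)
  then show ?thesis using assms by (auto simp: circ_bounded_def)
qed

lemma circ_bounded_sum [intro!]: "(\<And>i. i \<in> I \<Longrightarrow> circ_bounded (f i)) \<Longrightarrow> circ_bounded (\<lambda>a. \<Sum>i\<in>I. f i a)"
  by (induction I rule: infinite_finite_induct) auto

lemma circ_bounded_cnj [intro!]: "circ_bounded f \<Longrightarrow> circ_bounded (\<lambda>a. cnj (f a))"
  by (auto simp: circ_bounded_def intro: measurable_compose[OF _ borel_measurable_continuous_onI[OF continuous_on_cnj[OF continuous_on_id]]])

lemma circ_bounded_id [intro!]: "circ_bounded (\<lambda>a. a)"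
  by (auto simp: circ_bounded_def unit_circle_def)

lemma circ_bounded_cnj_id [intro!]: "circ_bounded cnj"
  using circ_bounded_cnj[OF circ_bounded_id] by simp

lemma circ_bounded_power [intro!]: "circ_bounded f \<Longrightarrow> circ_bounded (\<lambda>a. f a ^ n)"
  by (induction n) auto

lemma circ_bounded_indicator [intro]: "A \<in> sets borel \<Longrightarrow> circ_bounded (indicator A)"
  by (auto simp: circ_bounded_def indicator_def intro!: exI[of _ 1])

lemma circ_borel_sets: "A \<in> circ_borel \<Longrightarrow> A \<in> sets borel"
  by (simp add: circ_borel_def)

lemma unit_circle_borel [simp]: "unit_circle \<in> sets borel"
  by (simp add: unit_circle_def)

lemma unit_circle_circ_borel [simp]: "unit_circle \<in> circ_borel"
  by (simp add: circ_borel_def)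

context
  fixes L assumes L: "cfunctional L"
begin

lemma cfunctional_add: "circ_bounded f \<Longrightarrow> circ_bounded g \<Longrightarrow> L (\<lambda>a. f a + g a) = L f + L g"
  and cfunctional_cmult: "circ_bounded f \<Longrightarrow> L (\<lambda>a. c * f a) = c * L f"
  and cfunctional_tendsto: "(\<And>n. circ_bounded (F n)) \<Longrightarrow> circ_bounded f \<Longrightarrow>
     (\<And>n a. a \<in> unit_circle \<Longrightarrow> cmod (F n a) \<le> C) \<Longrightarrow>
     (\<And>a. a \<in> unit_circle \<Longrightarrow> (\<lambda>n. F n a) \<longlonglongrightarrow> f a) \<Longrightarrow> (\<lambda>n. L (F n)) \<longlonglongrightarrow> L f"
  using L L[unfolded cfunctional_def, THEN conjunct2, THEN conjunct2, rule_format, of F f C]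
  by (simp_all add: cfunctional_def)

lemma cfunctional_zero: "L (\<lambda>_. 0) = 0"
  using cfunctional_cmult[of "\<lambda>_. 0" 0] by auto

lemma cfunctional_cong:
  assumes f: "circ_bounded f" and g: "circ_bounded g" and e: "\<And>a. a \<in> unit_circle \<Longrightarrow> f a = g a"
  shows "L f = L g"
proof -
  obtain C where "\<forall>a\<in>unit_circle. cmod (f a) \<le> C" using f by (auto simp: circ_bounded_def)
  then have "(\<lambda>n. L f) \<longlonglongrightarrow> L g" using e by (intro cfunctional_tendsto f g) auto
  then show ?thesis by (simp add: LIMSEQ_const_iff)
qed

lemma cfunctional_diff: "circ_bounded f \<Longrightarrow> circ_bounded g \<Longrightarrow> L (\<lambda>a. f a - g a) = L f - L g"
  using cfunctional_add[of f "\<lambda>a. (-1) * g a"] cfunctional_cmult[of g "-1"]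
    circ_bounded_mult[OF circ_bounded_const[of "-1"], of g] by simp

lemma cfunctional_sum:
  "(\<And>i. i \<in> I \<Longrightarrow> circ_bounded (f i)) \<Longrightarrow> L (\<lambda>a. \<Sum>i\<in>I. f i a) = (\<Sum>i\<in>I. L (f i))"
  by (induction I rule: infinite_finite_induct) (auto simp: cfunctional_zero cfunctional_add circ_bounded_sum)

text \<open>Simple functions converging pointwise to f and dominated by 2 |f| are uniformly bounded
  on the circle, so the continuity clause reduces the claim to indicators.\<close>

lemma cfunctional_eq_0_if_indicator:
  assumes ind: "\<And>A. A \<in> circ_borel \<Longrightarrow> L (indicator A) = 0" and f: "circ_bounded f"
  shows "L f = 0"
proof -
  \<comment> \<open>L does not see values off the circle, so a Borel set of the plane may be
    replaced by its part on the circle.\<close>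
  have ind': "L (indicator A) = 0" if "A \<in> sets borel" for A
  proof -
    have m: "A \<inter> unit_circle \<in> circ_borel" using that by (auto simp: circ_borel_def)
    have "L (indicator A) = L (indicator (A \<inter> unit_circle))"
      using that circ_borel_sets[OF m]
      by (intro cfunctional_cong circ_bounded_indicator) (auto simp: indicator_def)
    then show ?thesis using ind[OF m] by simp
  qed
  have fm: "f \<in> borel_measurable borel" using f by (simp add: circ_bounded_def)
  obtain F where F: "\<And>i. simple_function borel (F i)" "\<And>x. (\<lambda>i. F i x) \<longlonglongrightarrow> f x"
    "\<And>i x. dist (F i x) 0 \<le> 2 * dist (f x) 0"
    using borel_measurable_implies_sequence_metric[OF fm, of 0] by auto
  obtain C where C: "\<forall>a\<in>unit_circle. cmod (f a) \<le> C" using f by (auto simp: circ_bounded_def)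
  have bd: "cmod (F i a) \<le> 2 * C" if "a \<in> unit_circle" for i a
  proof -
    have "cmod (F i a) \<le> 2 * cmod (f a)" using F(3)[of i a] by simp
    then show ?thesis using bspec[OF C that] by linarith
  qed
  have fin: "finite (range (F i))" for i using F(1)[of i] by (simp add: simple_function_def)
  have meas: "F i -` {y} \<in> sets borel" for i y
    using measurable_sets[OF borel_measurable_simple_function[OF F(1)[of i]], of "{y}"] by simp
  have cb: "circ_bounded (F i)" for i
    using bd borel_measurable_simple_function[OF F(1)[of i]] by (auto simp: circ_bounded_def)
  have "L (F i) = 0" for i
  proof -
    have "F i = (\<lambda>a. \<Sum>y\<in>range (F i). y * indicator (F i -` {y}) a)"
    proof
      fix a
      have "(\<Sum>y\<in>range (F i). y * indicator (F i -` {y}) a) = (\<Sum>y\<in>range (F i). if y = F i a then y else 0)"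
        by (intro sum.cong) (auto simp: indicator_def)
      also have "\<dots> = F i a" using fin by (simp add: sum.delta)
      finally show "F i a = (\<Sum>y\<in>range (F i). y * indicator (F i -` {y}) a)" by simp
    qed
    then have "L (F i) = L (\<lambda>a. \<Sum>y\<in>range (F i). y * indicator (F i -` {y}) a)" by simp
    also have "\<dots> = (\<Sum>y\<in>range (F i). L (\<lambda>a. y * indicator (F i -` {y}) a))"
      by (rule cfunctional_sum) (auto intro: circ_bounded_indicator meas)
    also have "\<dots> = 0"
    proof (rule sum.neutral, rule ballI)
      fix y
      have "L (\<lambda>a. y * indicator (F i -` {y}) a) = y * L (indicator (F i -` {y}))"
        using cfunctional_cmult[OF circ_bounded_indicator[OF meas]] by simp
      then show "L (\<lambda>a. y * indicator (F i -` {y}) a) = 0" using ind'[OF meas] by simp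
    qed
    finally show ?thesis .
  qed
  moreover have "(\<lambda>i. L (F i)) \<longlonglongrightarrow> L f" by (rule cfunctional_tendsto[OF cb f bd F(2)])
  ultimately show ?thesis by (simp add: LIMSEQ_const_iff)
qed

text \<open>Inserting a spectral projection or a power of U into a form amounts to such a density
  g.\<close>

lemma cfunctional_mult:
  assumes g: "circ_bounded g"
  shows "cfunctional (\<lambda>f. L (\<lambda>a. g a * f a))"
  unfolding cfunctional_def
proof (intro conjI allI impI)
  show "L (\<lambda>a. g a * (f a + h a)) = L (\<lambda>a. g a * f a) + L (\<lambda>a. g a * h a)"
    if "circ_bounded f" "circ_bounded h" for f h
    using cfunctional_add[of "\<lambda>a. g a * f a" "\<lambda>a. g a * h a"] g that by (auto simp: distrib_left)
  show "L (\<lambda>a. g a * (c * f a)) = c * L (\<lambda>a. g a * f a)" if "circ_bounded f" for c f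
    using cfunctional_cmult[of "\<lambda>a. g a * f a" c] g that by (auto simp: ac_simps)
  fix F f C
  assume F: "\<forall>n. circ_bounded (F n)" "circ_bounded f" "\<forall>n. \<forall>a\<in>unit_circle. cmod (F n a) \<le> C"
    "\<forall>a\<in>unit_circle. (\<lambda>n. F n a) \<longlonglongrightarrow> f a"
  obtain K where K: "\<forall>a\<in>unit_circle. cmod (g a) \<le> K" using g by (auto simp: circ_bounded_def)
  show "(\<lambda>n. L (\<lambda>a. g a * F n a)) \<longlonglongrightarrow> L (\<lambda>a. g a * f a)"
  proof (rule cfunctional_tendsto)
    show "cmod (g a * F n a) \<le> \<bar>K\<bar> * \<bar>C\<bar>" if "a \<in> unit_circle" for n a
    proof -
      have "cmod (g a) \<le> \<bar>K\<bar>" "cmod (F n a) \<le> \<bar>C\<bar>"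
        using K F(3) that by (meson abs_ge_self order_trans)+
      then show ?thesis by (simp add: norm_mult mult_mono)
    qed
    show "(\<lambda>n. g a * F n a) \<longlonglongrightarrow> g a * f a" if "a \<in> unit_circle" for a
      using F(4) that by (intro tendsto_mult tendsto_const) blast
    show "circ_bounded (\<lambda>a. g a * f a)" using g F(2) by (rule circ_bounded_mult)
    show "circ_bounded (\<lambda>a. g a * F n a)" for n using g F(1) by (intro circ_bounded_mult) auto
  qed
qed

lemma cfunctional_scale: "cfunctional (\<lambda>f. c * L f)"
proof -
  have "(\<lambda>n. c * L (F n)) \<longlonglongrightarrow> c * L f" if "\<forall>n. circ_bounded (F n)" "circ_bounded f"
    "\<forall>n. \<forall>a\<in>unit_circle. cmod (F n a) \<le> C" "\<forall>a\<in>unit_circle. (\<lambda>n. F n a) \<longlonglongrightarrow> f a" for F f C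
    by (intro tendsto_intros cfunctional_tendsto[where C = C]) (use that in auto)
  then show ?thesis unfolding cfunctional_def
    by (simp add: cfunctional_add cfunctional_cmult distrib_left mult.left_commute)
qed

text \<open>Conjugating inside and outside restores linearity. Exchanging the two vectors of a
  Hermitian form acts on its functional in this way.\<close>

lemma cfunctional_cnj: "cfunctional (\<lambda>f. cnj (L (\<lambda>a. cnj (f a))))"
proof -
  have "(\<lambda>n. cnj (L (\<lambda>a. cnj (F n a)))) \<longlonglongrightarrow> cnj (L (\<lambda>a. cnj (f a)))"
    if "\<forall>n. circ_bounded (F n)" "circ_bounded f"
      "\<forall>n. \<forall>a\<in>unit_circle. cmod (F n a) \<le> C" "\<forall>a\<in>unit_circle. (\<lambda>n. F n a) \<longlonglongrightarrow> f a" for F f C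
    by (intro tendsto_cnj cfunctional_tendsto[where C = C] circ_bounded_cnj) (use that in auto)
  then show ?thesis unfolding cfunctional_def
    by (simp add: cfunctional_add cfunctional_cmult circ_bounded_cnj)
qed

end

lemma cfunctional_plus: "cfunctional L \<Longrightarrow> cfunctional M \<Longrightarrow> cfunctional (\<lambda>f. L f + M f)"
proof -
  assume L: "cfunctional L" and M: "cfunctional M"
  have "(\<lambda>n. L (F n) + M (F n)) \<longlonglongrightarrow> L f + M f" if "\<forall>n. circ_bounded (F n)" "circ_bounded f"
    "\<forall>n. \<forall>a\<in>unit_circle. cmod (F n a) \<le> C" "\<forall>a\<in>unit_circle. (\<lambda>n. F n a) \<longlonglongrightarrow> f a" for F f C
    by (intro tendsto_add cfunctional_tendsto[OF L, where C = C] cfunctional_tendsto[OF M, where C = C])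
      (use that in auto)
  then show ?thesis unfolding cfunctional_def[of "\<lambda>f. L f + M f"]
    by (simp add: cfunctional_add[OF L] cfunctional_add[OF M] cfunctional_cmult[OF L] cfunctional_cmult[OF M]
        distrib_left add_ac)
qed

lemma cfunctional_minus: "cfunctional L \<Longrightarrow> cfunctional M \<Longrightarrow> cfunctional (\<lambda>f. L f - M f)"
  using cfunctional_plus[OF _ cfunctional_scale[of M "-1"], of L] by simp

lemma cfunctional_sum_functionals:
  "(\<And>i. i \<in> I \<Longrightarrow> cfunctional (L i)) \<Longrightarrow> cfunctional (\<lambda>f. \<Sum>i\<in>I. L i f)"
  by (induction I rule: infinite_finite_induct) (auto simp: cfunctional_def[of "\<lambda>_. 0"] intro: cfunctional_plus)

lemma cfunctional_eqI_indicator: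
  assumes "cfunctional L" "cfunctional M" "\<And>A. A \<in> circ_borel \<Longrightarrow> L (indicator A) = M (indicator A)"
    and "circ_bounded f"
  shows "L f = M f"
  using cfunctional_eq_0_if_indicator[OF cfunctional_minus[OF assms(1,2)]] assms(3,4) by simp

lemma space_eq_unit_circle:
  assumes sets: "sets M = circ_borel" shows "space M = unit_circle"
proof
  show "space M \<subseteq> unit_circle" using sets.top[of M] unfolding sets by (simp add: circ_borel_def)
  show "unit_circle \<subseteq> space M" by (rule sets.sets_into_space) (simp add: sets)
qed

text \<open>The continuity clause is dominated convergence with the constant C as majorant.\<close>

lemma cfunctional_integral:
  assumes "finite_measure M" and sets: "sets M = circ_borel"
  shows "cfunctional (\<lambda>f. integral\<^sup>L M f)"
proof -
  interpret finite_measure M by fact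
  have sp: "space M = unit_circle" using sets by (rule space_eq_unit_circle)
  have meas: "f \<in> borel_measurable M" if "f \<in> borel_measurable borel" for f :: "complex \<Rightarrow> complex"
  proof (rule measurableI)
    fix A :: "complex set" assume "A \<in> sets borel"
    then have "f -` A \<in> sets borel" using measurable_sets[OF that] by simp
    then show "f -` A \<inter> space M \<in> sets M" by (simp add: sp sets circ_borel_def sets.Int)
  qed simp
  have int: "integrable M f" if "circ_bounded f" for f
  proof -
    obtain C where "\<forall>a\<in>unit_circle. cmod (f a) \<le> C" using \<open>circ_bounded f\<close> by (auto simp: circ_bounded_def)
    then show ?thesis
      by (intro integrable_const_bound[of _ C] meas) (use that in \<open>auto simp: circ_bounded_def sp intro!: AE_I2\<close>)
  qed
  show ?thesis unfolding cfunctional_def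
  proof (intro conjI allI impI)
    fix F f C
    assume F: "\<forall>n. circ_bounded (F n)" "circ_bounded f" "\<forall>n. \<forall>a\<in>unit_circle. cmod (F n a) \<le> C"
      "\<forall>a\<in>unit_circle. (\<lambda>n. F n a) \<longlonglongrightarrow> f a"
    show "(\<lambda>n. integral\<^sup>L M (F n)) \<longlonglongrightarrow> integral\<^sup>L M f"
      by (rule integral_dominated_convergence[where w = "\<lambda>_. C"])
        (use F in \<open>auto simp: sp circ_bounded_def intro!: AE_I2 meas\<close>)
  qed (auto simp: int Bochner_Integration.integral_add)
qed

subsection \<open>The forms of a spectral measure\<close>

text \<open>The body of \<open>spec_form\<close> for an arbitrary family of measures indexed by
  vectors, so that the form can be studied before any projections exist.\<close>

definition circ_form :: "('k \<Rightarrow> complex measure) \<Rightarrow> (complex \<Rightarrow> complex) \<Rightarrow> 'k::complex_hilbert \<Rightarrow> 'k \<Rightarrow> complex" where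
  "circ_form \<nu> f x y = (1/4) * (\<Sum>k\<in>{0..3::nat}. \<i> ^ k * integral\<^sup>L (\<nu> (x + scaleC (\<i> ^ k) y)) f)"

lemma spec_form_eq_circ_form: "spec_form P f x y = circ_form (scalar_spec_measure P) f x y"
  by (simp add: spec_form_def circ_form_def)

lemma cfunctional_circ_form:
  assumes "\<And>v. finite_measure (\<nu> v)" "\<And>v. sets (\<nu> v) = circ_borel"
  shows "cfunctional (\<lambda>f. circ_form \<nu> f x y)"
  unfolding circ_form_def
  by (intro cfunctional_scale cfunctional_sum_functionals cfunctional_integral assms)

lemma integral_indicator_complex:
  assumes "finite_measure M" "A \<in> sets M"
  shows "integral\<^sup>L M (indicator A) = complex_of_real (measure M A)"
proof -
  interpret finite_measure M by fact
  have "has_bochner_integral M (\<lambda>x. indicator A x *\<^sub>R (1::complex)) (measure M A *\<^sub>R 1)"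
    using assms(2) by (intro has_bochner_integral_indicator) (simp_all add: less_top[symmetric])
  moreover have "(\<lambda>x. indicator A x *\<^sub>R (1::complex)) = indicator A" by (auto simp: indicator_def)
  ultimately show ?thesis by (simp add: has_bochner_integral_integral_eq scaleR_conv_of_real)
qed

lemma circ_borel_eq: "circ_borel = sets (restrict_space borel unit_circle)"
  by (auto simp: sets_restrict_space circ_borel_def image_iff)

lemma circ_borel_Pow: "circ_borel \<subseteq> Pow unit_circle"
  by (auto simp: circ_borel_def)

lemma circ_borel_Int: "A \<in> circ_borel \<Longrightarrow> B \<in> circ_borel \<Longrightarrow> A \<inter> B \<in> circ_borel"
  by (simp add: circ_borel_eq sets.Int)

lemma sigma_sets_circ_borel: "sigma_sets unit_circle circ_borel = circ_borel"
  using sets.sigma_sets_eq[of "restrict_space borel unit_circle :: complex measure"]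
  by (simp add: circ_borel_eq space_restrict_space)

context
  fixes U :: "'k::complex_hilbert \<Rightarrow> 'k" and P
  assumes P: "is_spectral_measure U P"
begin

lemma spectral_projection:
  assumes "A \<in> circ_borel"
  shows "clinear_map (P A)" "P A (P A x) = P A x" "cinner (P A x) y = cinner x (P A y)"
    "cinner (P A x) (P A y) = cinner (P A x) y"
proof -
  show "clinear_map (P A)" and i: "P A (P A x) = P A x" and s: "cinner (P A x) y = cinner x (P A y)" for x y
    using P assms by (auto simp: is_spectral_measure_def fun_eq_iff)
  show "cinner (P A x) (P A y) = cinner (P A x) y" by (simp add: s i)
qed

lemma spectral_projection_Int: "A \<in> circ_borel \<Longrightarrow> B \<in> circ_borel \<Longrightarrow> P (A \<inter> B) x = P A (P B x)"
  and spectral_projection_circle: "P unit_circle x = x"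
  and spectral_projection_sums: "range F \<subseteq> circ_borel \<Longrightarrow> disjoint_family F \<Longrightarrow> (\<lambda>m. P (F m) x) sums P (\<Union>(range F)) x"
  and cinner_eq_spec_form: "cinner (U x) y = spec_form P (\<lambda>a. a) x y"
  using P by (auto simp: is_spectral_measure_def)

lemma norm_spectral_projection: "A \<in> circ_borel \<Longrightarrow> complex_of_real ((norm (P A x))\<^sup>2) = cinner (P A x) x"
  by (simp only: spectral_projection(4) flip: cinner_self_norm)

lemma sets_scalar_spec_measure: "sets (scalar_spec_measure P x) = circ_borel"
  by (simp add: scalar_spec_measure_def sets_measure_of[OF circ_borel_Pow] sigma_sets_circ_borel)

text \<open>\<open>measure_of\<close> returns the given set function only if that is a measure.
  Countable additivity holds because |P(A)x|^2 = <P(A)x, x> depends linearly on P(A)x, so the strong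
  sums of projections can be paired with x.\<close>

lemma emeasure_scalar_spec_measure:
  assumes "A \<in> circ_borel"
  shows "emeasure (scalar_spec_measure P x) A = ennreal ((norm (P A x))\<^sup>2)"
proof (rule emeasure_measure_of[OF scalar_spec_measure_def])
  show "circ_borel \<subseteq> Pow unit_circle" by (rule circ_borel_Pow)
  show "A \<in> sets (scalar_spec_measure P x)" using assms by (simp add: sets_scalar_spec_measure)
  \<comment> \<open>The constant family of empty sets is disjoint; convergence of its sum forces the
    constant term to vanish.\<close>
  have "(\<lambda>m::nat. P {} x) sums P {} x"
    using spectral_projection_sums[of "\<lambda>_. {}" x] by (auto simp: circ_borel_def disjoint_family_on_def)
  then have "P {} x = 0" using summable_LIMSEQ_zero[OF sums_summable] LIMSEQ_const_iff by blast
  then show "positive (sets (scalar_spec_measure P x)) (\<lambda>A. ennreal ((norm (P A x))\<^sup>2))"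
    by (simp add: positive_def)
  show "countably_additive (sets (scalar_spec_measure P x)) (\<lambda>A. ennreal ((norm (P A x))\<^sup>2))"
    unfolding countably_additive_def sets_scalar_spec_measure
  proof (intro allI impI)
    fix F :: "nat \<Rightarrow> complex set"
    assume F: "range F \<subseteq> circ_borel" "disjoint_family F" "\<Union>(range F) \<in> circ_borel"
    have "(\<lambda>m. cinner (P (F m) x) x) sums cinner (P (\<Union>(range F)) x) x"
      by (rule bounded_linear.sums[OF bounded_bilinear.bounded_linear_left[OF bounded_bilinear_cinner]
            spectral_projection_sums[OF F(1,2)]])
    moreover have "cinner (P (F m) x) x = complex_of_real ((norm (P (F m) x))\<^sup>2)" for m
      using F by (intro norm_spectral_projection[symmetric]) auto
    ultimately have "(\<lambda>m. complex_of_real ((norm (P (F m) x))\<^sup>2)) sums complex_of_real ((norm (P (\<Union>(range F)) x))\<^sup>2)"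
      using norm_spectral_projection[OF F(3)] by simp
    then have "(\<lambda>m. (norm (P (F m) x))\<^sup>2) sums (norm (P (\<Union>(range F)) x))\<^sup>2"
      by (simp only: sums_of_real_iff)
    then show "(\<Sum>m. ennreal ((norm (P (F m) x))\<^sup>2)) = ennreal ((norm (P (\<Union>(range F)) x))\<^sup>2)"
      by (rule suminf_ennreal_eq[rotated]) simp
  qed
qed

lemma finite_measure_scalar_spec_measure: "finite_measure (scalar_spec_measure P x)"
  by (rule finite_measureI)
    (simp add: space_eq_unit_circle[OF sets_scalar_spec_measure] emeasure_scalar_spec_measure)

lemma cfunctional_spec_form: "cfunctional (\<lambda>f. spec_form P f x y)"
  unfolding spec_form_eq_circ_form
  by (intro cfunctional_circ_form finite_measure_scalar_spec_measure sets_scalar_spec_measure)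

text \<open>Polarisation applied to P(A)x and P(A)y. Functionals are determined by indicators, so
  each rule for \<open>spec_form\<close> below becomes a statement about the projections.\<close>

lemma spec_form_indicator:
  assumes A: "A \<in> circ_borel"
  shows "spec_form P (indicator A) x y = cinner (P A x) y"
proof -
  have "integral\<^sup>L (scalar_spec_measure P v) (indicator A) = complex_of_real ((norm (P A v))\<^sup>2)" for v
    using A by (subst integral_indicator_complex[OF finite_measure_scalar_spec_measure])
      (simp_all add: sets_scalar_spec_measure measure_def emeasure_scalar_spec_measure)
  then have "spec_form P (indicator A) x y = cinner (P A x) (P A y)"
    by (simp only: spec_form_def cinner_polarization[of "P A x"] clinear_mapD[OF spectral_projection(1)[OF A]])
  then show ?thesis by (simp add: spectral_projection(4)[OF A])
qed

lemma spec_form_add_right: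
  "circ_bounded f \<Longrightarrow> spec_form P f x (y + z) = spec_form P f x y + spec_form P f x z"
  by (rule cfunctional_eqI_indicator[where f = f and L = "\<lambda>f. spec_form P f x (y + z)"
        and M = "\<lambda>f. spec_form P f x y + spec_form P f x z"])
    (auto intro: cfunctional_spec_form cfunctional_plus simp: spec_form_indicator cinner_add_right)

lemma spec_form_scaleC_right:
  "circ_bounded f \<Longrightarrow> spec_form P f x (scaleC c y) = cnj c * spec_form P f x y"
  by (rule cfunctional_eqI_indicator[where f = f and L = "\<lambda>f. spec_form P f x (scaleC c y)"
        and M = "\<lambda>f. cnj c * spec_form P f x y"])
    (auto intro: cfunctional_spec_form cfunctional_scale simp: spec_form_indicator cinner_scaleC_right)

lemma spec_form_projection_right:
  assumes A: "A \<in> circ_borel" and f: "circ_bounded f"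
  shows "spec_form P f x (P A y) = spec_form P (\<lambda>a. indicator A a * f a) x y"
proof (rule cfunctional_eqI_indicator[where f = f and L = "\<lambda>f. spec_form P f x (P A y)"
      and M = "\<lambda>f. spec_form P (\<lambda>a. indicator A a * f a) x y"])
  show "cfunctional (\<lambda>f. spec_form P (\<lambda>a. indicator A a * f a) x y)"
    by (intro cfunctional_mult cfunctional_spec_form circ_bounded_indicator circ_borel_sets A)
  fix B assume B: "B \<in> circ_borel"
  have "(\<lambda>a. indicator A a * indicator B a) = (indicator (A \<inter> B) :: complex \<Rightarrow> complex)"
    by (auto simp: indicator_def)
  then show "spec_form P (indicator B) x (P A y) = spec_form P (\<lambda>a. indicator A a * indicator B a) x y"
    using A B by (simp add: spec_form_indicator circ_borel_Int spectral_projection_Int spectral_projection(3))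
qed (auto intro: cfunctional_spec_form f)

text \<open>On an indicator, <P(A)Ux, y> = <Ux, P(A)y>, and the right side is the integral of the
  identity against the form of x and P(A)y. No commutation of U with P(A) is presupposed.\<close>

lemma spec_form_unitary_left:
  assumes f: "circ_bounded f"
  shows "spec_form P f (U x) y = spec_form P (\<lambda>a. a * f a) x y"
proof (rule cfunctional_eqI_indicator[where f = f and L = "\<lambda>f. spec_form P f (U x) y"
      and M = "\<lambda>f. spec_form P (\<lambda>a. a * f a) x y"])
  show "cfunctional (\<lambda>f. spec_form P (\<lambda>a. a * f a) x y)"
    by (intro cfunctional_mult[where g = "\<lambda>a. a"] cfunctional_spec_form circ_bounded_id)
  fix A assume A: "A \<in> circ_borel"
  have "spec_form P (indicator A) (U x) y = spec_form P (\<lambda>a. a) x (P A y)"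
    by (simp add: spec_form_indicator A spectral_projection(3) cinner_eq_spec_form)
  also have "\<dots> = spec_form P (\<lambda>a. a * indicator A a) x y"
    by (simp add: spec_form_projection_right A circ_bounded_id mult.commute)
  finally show "spec_form P (indicator A) (U x) y = spec_form P (\<lambda>a. a * indicator A a) x y" .
qed (auto intro: cfunctional_spec_form f)

lemma spec_form_swap:
  assumes f: "circ_bounded f"
  shows "spec_form P f y x = cnj (spec_form P (\<lambda>a. cnj (f a)) x y)"
proof (rule cfunctional_eqI_indicator[where f = f and L = "\<lambda>f. spec_form P f y x"
      and M = "\<lambda>f. cnj (spec_form P (\<lambda>a. cnj (f a)) x y)"])
  fix A assume A: "A \<in> circ_borel"
  have "(\<lambda>a. cnj (indicator A a)) = (indicator A :: complex \<Rightarrow> complex)" by (auto simp: indicator_def)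
  then show "spec_form P (indicator A) y x = cnj (spec_form P (\<lambda>a. cnj (indicator A a)) x y)"
    using A by (simp add: spec_form_indicator spectral_projection(3)[of A y] cinner_commute[of y "P A x"])
qed (auto intro: cfunctional_spec_form cfunctional_cnj f)

lemma spec_form_unitary_right:
  assumes f: "circ_bounded f"
  shows "spec_form P f x (U y) = spec_form P (\<lambda>a. cnj a * f a) x y"
proof -
  have "spec_form P f x (U y) = cnj (spec_form P (\<lambda>a. a * cnj (f a)) y x)"
    using f by (subst spec_form_swap) (auto simp: spec_form_unitary_left circ_bounded_cnj)
  also have "\<dots> = spec_form P (\<lambda>a. cnj (a * cnj (f a))) x y"
    using f by (subst spec_form_swap) (auto intro!: circ_bounded_mult circ_bounded_id circ_bounded_cnj)
  finally show ?thesis by simp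
qed

lemma spec_form_one: "spec_form P (\<lambda>_. 1) x y = cinner x y"
proof -
  have "spec_form P (\<lambda>_. 1) x y = spec_form P (indicator unit_circle) x y"
    by (rule cfunctional_cong[OF cfunctional_spec_form]) (auto intro: circ_bounded_indicator)
  then show ?thesis by (simp add: spec_form_indicator spectral_projection_circle)
qed

lemma circ_bounded_Herglotz:
  assumes b: "cmod b < 1"
  shows "circ_bounded (\<lambda>a. (a + b) / (a - b))"
proof -
  have "cmod ((a + b) / (a - b)) \<le> 2 / (1 - cmod b)" if "a \<in> unit_circle" for a
  proof -
    have a: "cmod a = 1" using that by (simp add: unit_circle_def)
    have "cmod (a + b) \<le> 2" using norm_triangle_ineq[of a b] a b by simp
    moreover have "1 - cmod b \<le> cmod (a - b)" using norm_triangle_ineq2[of a b] a by simp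
    ultimately show ?thesis unfolding norm_divide using b by (intro frac_le) auto
  qed
  then show ?thesis by (auto simp: circ_bounded_def)
qed

text \<open>On the circle the kernel f satisfies f (1 - b cnj a) = 1 + b cnj a. Writing y = y' - cnj
  b U y' therefore turns the integral of f against y into the integral of a trigonometric polynomial
  against y'. The second slot is antilinear, hence cnj b.\<close>

theorem spec_form_Herglotz:
  assumes U: "ccontraction U" and b: "cmod b < 1"
  shows "spec_form P (\<lambda>a. (a + b) / (a - b)) x y = 2 * cinner x (neumann U (cnj b) y) - cinner x y"
proof -
  define y' where "y' = neumann U (cnj b) y"
  define f where "f = (\<lambda>a. (a + b) / (a - b))"
  have y: "y = y' + scaleC (- cnj b) (U y')"
    using neumann_inverse[OF U, of "cnj b" y] b by (simp add: y'_def scaleC_minus_left)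
  have f: "circ_bounded f" unfolding f_def by (rule circ_bounded_Herglotz[OF b])
  have fc: "circ_bounded (\<lambda>a. cnj a * f a)" using f by (intro circ_bounded_mult circ_bounded_cnj_id)
  note cf = cfunctional_spec_form[of x y']
  have one: "spec_form P (\<lambda>_. 1) x (U y') = spec_form P (\<lambda>a. cnj a * 1) x y'"
    by (rule spec_form_unitary_right) (rule circ_bounded_const)
  have "spec_form P f x y = spec_form P f x y' + (- b) * spec_form P (\<lambda>a. cnj a * f a) x y'"
    by (subst y) (simp add: spec_form_add_right[OF f] spec_form_scaleC_right[OF f] spec_form_unitary_right[OF f])
  also have "\<dots> = spec_form P (\<lambda>a. f a + (- b) * (cnj a * f a)) x y'"
    using cfunctional_add[OF cf f circ_bounded_mult[OF circ_bounded_const fc], of "- b"]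
      cfunctional_cmult[OF cf fc, of "- b"] by simp
  also have "\<dots> = spec_form P (\<lambda>a. 1 + b * (cnj a * 1)) x y'"
  proof (rule cfunctional_cong[OF cf])
    show "circ_bounded (\<lambda>a. f a + - b * (cnj a * f a))"
      using f fc by (intro circ_bounded_add circ_bounded_mult[OF circ_bounded_const])
    show "circ_bounded (\<lambda>a. 1 + b * (cnj a * 1))"
      by (intro circ_bounded_add circ_bounded_mult circ_bounded_const circ_bounded_cnj_id)
    fix a assume "a \<in> unit_circle"
    then have a: "cmod a = 1" by (simp add: unit_circle_def)
    have ab: "a - b \<noteq> 0" using a b by auto
    have ac: "a * cnj a = 1" using complex_norm_square[of a] a by simp
    have fa: "f a * (a - b) = a + b" using ab by (simp add: f_def)
    have "(f a + - b * (cnj a * f a)) * (a - b) = (1 - b * cnj a) * (f a * (a - b))"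
      by (simp add: algebra_simps)
    also have "\<dots> = (1 - b * cnj a) * (a + b)" by (simp only: fa)
    also have "\<dots> = a + b - b * (a * cnj a) - b * b * cnj a" by (simp add: algebra_simps)
    also have "\<dots> = a - b * b * cnj a" by (simp add: ac)
    also have "\<dots> = a + b * (a * cnj a) - b - b * b * cnj a" by (simp add: ac)
    also have "\<dots> = (1 + b * (cnj a * 1)) * (a - b)" by (simp add: algebra_simps)
    finally show "f a + - b * (cnj a * f a) = 1 + b * (cnj a * 1)" using ab by simp
  qed
  also have "\<dots> = spec_form P (\<lambda>_. 1) x y' + b * spec_form P (\<lambda>a. cnj a * 1) x y'"
    by (subst cfunctional_add[OF cf]) (auto intro!: circ_bounded_mult[OF circ_bounded_const] circ_bounded_cnj_id cfunctional_cmult[OF cf])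
  also have "\<dots> = cinner x y' + cinner x (scaleC (cnj b) (U y'))"
    by (simp only: one[symmetric] spec_form_one cinner_scaleC_right complex_cnj_cnj)
  also have "scaleC (cnj b) (U y') = y' - y" using y by (simp add: scaleC_minus_left)
  finally show ?thesis by (simp add: f_def y'_def cinner_diff_right)
qed

end

subsection \<open>Determination by trigonometric moments\<close>

text \<open>Polynomials in a and \<open>cnj a\<close> on the whole plane instead of Laurent
  polynomials on the circle, so that real polynomials in Re a and Im a are literally of this
  form.\<close>

inductive trig_poly :: "(complex \<Rightarrow> complex) \<Rightarrow> bool" where
  monomial: "trig_poly (\<lambda>a. c * (a ^ j * cnj a ^ k))"
| add: "trig_poly p \<Longrightarrow> trig_poly q \<Longrightarrow> trig_poly (\<lambda>a. p a + q a)"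

lemma circ_bounded_monomial: "circ_bounded (\<lambda>a. a ^ j * cnj a ^ k)"
  by (intro circ_bounded_mult circ_bounded_power circ_bounded_id circ_bounded_cnj_id)

lemma circ_bounded_trig_poly: "trig_poly p \<Longrightarrow> circ_bounded p"
  by (induction rule: trig_poly.induct)
    (intro circ_bounded_mult circ_bounded_const circ_bounded_monomial circ_bounded_add; assumption)+

lemma trig_poly_mult:
  assumes "trig_poly p" "trig_poly q"
  shows "trig_poly (\<lambda>a. p a * q a)"
  using assms(1)
proof induction
  case (monomial c j k)
  show ?case using assms(2)
  proof induction
    case (monomial d l m)
    have "(\<lambda>a. c * (a ^ j * cnj a ^ k) * (d * (a ^ l * cnj a ^ m)))
        = (\<lambda>a. (c * d) * (a ^ (j + l) * cnj a ^ (k + m)))"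
      by (simp add: power_add ac_simps)
    then show ?case by (simp only: trig_poly.monomial)
  next
    case (add p q)
    then show ?case using trig_poly.add[OF add(3,4)] by (simp only: distrib_left)
  qed
next
  case (add p p')
  then show ?case using trig_poly.add[OF add(3,4)] by (simp only: distrib_right)
qed

lemma trig_poly_of_real_polynomial:
  "real_polynomial_function p \<Longrightarrow> trig_poly (\<lambda>a. complex_of_real (p a))"
proof (induction rule: real_polynomial_function.induct)
  case (linear f)
  interpret bounded_linear f by fact
  let ?u = "complex_of_real (f 1)" and ?v = "complex_of_real (f \<i>)"
  \<comment> \<open>The coefficients come from f a = Re a f(1) + Im a f(i), with Re a = (a + cnj a)
    / 2 and Im a = (a - cnj a) / (2 i).\<close>
  have "complex_of_real (f a) = (?u / 2 + ?v / (2 * \<i>)) * (a ^ 1 * cnj a ^ 0) + (?u / 2 - ?v / (2 * \<i>)) * (a ^ 0 * cnj a ^ 1)" for a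
  proof -
    have "a = Re a *\<^sub>R 1 + Im a *\<^sub>R \<i>" by (simp add: complex_eq_iff)
    then have "f a = f (Re a *\<^sub>R 1 + Im a *\<^sub>R \<i>)" by (rule arg_cong)
    also have "\<dots> = Re a * f 1 + Im a * f \<i>" by (simp only: add scaleR real_scaleR_def)
    finally show ?thesis by (simp add: complex_eq_iff Re_divide Im_divide field_simps)
  qed
  then have "(\<lambda>a. complex_of_real (f a)) = (\<lambda>a. (?u / 2 + ?v / (2 * \<i>)) * (a ^ 1 * cnj a ^ 0) + (?u / 2 - ?v / (2 * \<i>)) * (a ^ 0 * cnj a ^ 1))"
    by (rule ext)
  then show ?case by (simp only:) (intro trig_poly.add trig_poly.monomial)
next
  case (const c)
  show ?case using trig_poly.monomial[of "of_real c" 0 0] by simp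
next
  case (add f g)
  show ?case using trig_poly.add[OF add.IH] by simp
next
  case (mult f g)
  show ?case using trig_poly_mult[OF mult.IH] by simp
qed

context
  fixes L
  assumes L: "cfunctional L" and mono: "\<And>j k. L (\<lambda>a. a ^ j * cnj a ^ k) = 0"
begin

lemma cfunctional_trig_poly: "trig_poly p \<Longrightarrow> L p = 0"
proof (induction rule: trig_poly.induct)
  case (monomial c j k)
  show ?case using cfunctional_cmult[OF L circ_bounded_monomial] mono by simp
next
  case (add p q)
  then show ?case using cfunctional_add[OF L circ_bounded_trig_poly circ_bounded_trig_poly] by simp
qed

text \<open>Stone-Weierstrass on the compact circle: the approximating polynomials converge
  uniformly there and stay below C + 1.\<close>

lemma cfunctional_continuous:
  fixes f :: "complex \<Rightarrow> real"
  assumes f: "continuous_on UNIV f"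
  shows "L (\<lambda>a. complex_of_real (f a)) = 0"
proof -
  have c: "compact unit_circle" by (simp add: unit_circle_def)
  have fc: "continuous_on unit_circle f" using f continuous_on_subset by blast
  have "\<exists>g. real_polynomial_function g \<and> (\<forall>x\<in>unit_circle. \<bar>f x - g x\<bar> < 1 / real (Suc n))" for n
    by (rule Stone_Weierstrass_real_polynomial_function[OF c fc, of "1 / real (Suc n)"]) auto
  then obtain g where g: "\<And>n. real_polynomial_function (g n)"
    "\<And>n x. x \<in> unit_circle \<Longrightarrow> \<bar>f x - g n x\<bar> < 1 / real (Suc n)" by metis
  obtain C where C: "\<And>x. x \<in> unit_circle \<Longrightarrow> \<bar>f x\<bar> \<le> C"
    using compact_imp_bounded[OF compact_continuous_image[OF fc c]] by (auto simp: bounded_iff)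
  have "(\<lambda>n. L (\<lambda>a. complex_of_real (g n a))) \<longlonglongrightarrow> L (\<lambda>a. complex_of_real (f a))"
  proof (rule cfunctional_tendsto[OF L])
    show "circ_bounded (\<lambda>a. complex_of_real (g n a))" for n
      by (intro circ_bounded_trig_poly trig_poly_of_real_polynomial g)
    show "circ_bounded (\<lambda>a. complex_of_real (f a))"
      using C borel_measurable_continuous_onI[OF f] by (auto simp: circ_bounded_def)
    fix a :: complex assume a: "a \<in> unit_circle"
    show "cmod (complex_of_real (g n a)) \<le> C + 1" for n
    proof -
      have "1 / real (Suc n) \<le> 1" by simp
      then show ?thesis using g(2)[OF a, of n] C[OF a] unfolding norm_of_real by linarith
    qed
    have "(\<lambda>n. f a - g n a) \<longlonglongrightarrow> 0"
    proof (rule tendsto_rabs_zero_cancel, rule tendsto_sandwich[of "\<lambda>_. 0"])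
      show "(\<lambda>n. 1 / real (Suc n)) \<longlonglongrightarrow> 0"
        using LIMSEQ_inverse_real_of_nat by (simp add: inverse_eq_divide)
    qed (use g(2)[OF a] in \<open>auto intro!: always_eventually less_imp_le\<close>)
    then have "(\<lambda>n. f a - (f a - g n a)) \<longlonglongrightarrow> f a - 0" by (intro tendsto_diff tendsto_const)
    then show "(\<lambda>n. complex_of_real (g n a)) \<longlonglongrightarrow> complex_of_real (f a)"
      by (intro tendsto_of_real) simp
  qed
  then show ?thesis
    using cfunctional_trig_poly[OF trig_poly_of_real_polynomial[OF g(1)]] by (simp add: LIMSEQ_const_iff)
qed

text \<open>The continuous functions max 0 (1 - n dist(a, A)) equal 1 on A and are eventually 0 at
  each point off A.\<close>

lemma cfunctional_closed:
  assumes A: "closed A" shows "L (indicator A) = 0"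
\<comment> \<open>\<open>infdist\<close> to the empty set is 0 by convention, so the approximating
  functions would be constantly 1.\<close>
proof (cases "A = {}")
  case True
  then show ?thesis using cfunctional_zero[OF L] by (simp add: indicator_def[abs_def])
next
  case False
  let ?f = "\<lambda>n a. max 0 (1 - real n * infdist a A)"
  have c: "continuous_on UNIV (?f n)" for n by (intro continuous_intros)
  have b: "?f n a \<le> 1" for n a using infdist_nonneg[of a A] by simp
  have "(\<lambda>n. L (\<lambda>a. complex_of_real (?f n a))) \<longlonglongrightarrow> L (indicator A)"
  proof (rule cfunctional_tendsto[OF L])
    show "circ_bounded (\<lambda>a. complex_of_real (?f n a))" for n
      using borel_measurable_continuous_onI[OF c] b[of n] by (auto simp: circ_bounded_def intro!: exI[of _ 1])
    show "circ_bounded (indicator A)" using A by (intro circ_bounded_indicator) simp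
    show "cmod (complex_of_real (?f n a)) \<le> 1" for n a using b[of n a] by simp
    show "(\<lambda>n. complex_of_real (?f n a)) \<longlonglongrightarrow> indicator A a" for a
    proof (cases "a \<in> A")
      case False
      then have pos: "infdist a A > 0"
        using in_closed_iff_infdist_zero[OF A \<open>A \<noteq> {}\<close>] infdist_nonneg[of a A] by fastforce
      then obtain N where N: "1 < real N * infdist a A" using reals_Archimedean3 by blast
      have "\<forall>\<^sub>F n in sequentially. ?f n a = 0"
        unfolding eventually_sequentially
      proof (intro exI allI impI)
        fix n assume "n \<ge> N"
        then have "real N * infdist a A \<le> real n * infdist a A" using pos by (intro mult_right_mono) auto
        then show "?f n a = 0" using N by simp
      qed
      then have "(\<lambda>n. complex_of_real (?f n a)) \<longlonglongrightarrow> 0"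
        by (intro tendsto_eventually) (auto elim: eventually_mono)
      then show ?thesis using False by simp
    qed simp
  qed
  then show ?thesis using cfunctional_continuous[OF c] by (simp add: LIMSEQ_const_iff)
qed

text \<open>Closed sets are stable under intersection and generate the Borel sets; the sets whose
  indicator L annihilates are closed under complements and disjoint countable unions.\<close>

lemma cfunctional_borel:
  assumes A: "A \<in> sets borel" shows "L (indicator A) = 0"
proof -
  have i: "Int_stable (Collect closed :: complex set set)" by (auto simp: Int_stable_def)
  have pow: "Collect closed \<subseteq> Pow (UNIV :: complex set)" by simp
  have A': "A \<in> sigma_sets UNIV (Collect closed)" using A by (simp add: borel_eq_closed)
  have sb: "B \<in> sets borel" if "B \<in> sigma_sets UNIV (Collect closed)" for B :: "complex set"
    using that by (simp add: borel_eq_closed)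
  show ?thesis using i pow A'
  proof (induction rule: sigma_sets_induct_disjoint)
    case (basic B) then show ?case by (simp add: cfunctional_closed)
  next
    case empty then show ?case by (rule cfunctional_closed) simp
  next
    case (compl B)
    have B: "circ_bounded (indicator B)" using compl sb by (intro circ_bounded_indicator)
    have "(indicator (UNIV - B) :: complex \<Rightarrow> complex) = (\<lambda>a. 1 - indicator B a)" by (auto simp: indicator_def)
    \<comment> \<open>\<open>mono[of 0 0]\<close> says that L annihilates the constant 1.\<close>
    then show ?case using cfunctional_diff[OF L circ_bounded_const[of 1] B] mono[of 0 0] compl by simp
  next
    case (union F)
    have F: "circ_bounded (indicator (F i))" for i using union sb by (intro circ_bounded_indicator) auto
    \<comment> \<open>Additivity handles finite unions; the countable one is their bounded pointwise
      limit.\<close>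
    have fin: "L (indicator (\<Union>i<n. F i)) = 0" for n
    proof -
      have "disjoint_family_on F {..<n}" using union(1) by (auto simp: disjoint_family_on_def)
      then have "(indicator (\<Union>i<n. F i) :: complex \<Rightarrow> complex) = (\<lambda>a. \<Sum>i<n. indicator (F i) a)"
        by (auto simp: indicator_UN_disjoint)
      then show ?thesis using cfunctional_sum[OF L F, where I = "{..<n}"] union by simp
    qed
    have "(\<lambda>n. L (indicator (\<Union>i<n. F i))) \<longlonglongrightarrow> L (indicator (\<Union>i. F i))"
    proof (rule cfunctional_tendsto[OF L])
      show "circ_bounded (indicator (\<Union>i<n. F i))" for n using union sb by (intro circ_bounded_indicator) auto
      show "circ_bounded (indicator (\<Union>i. F i))" using union sb by (intro circ_bounded_indicator) auto
      show "cmod (indicator (\<Union>i<n. F i) a) \<le> 1" for n a by (simp add: indicator_def)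
    qed (rule LIMSEQ_indicator_UN)
    then show ?case by (simp add: fin LIMSEQ_const_iff)
  qed
qed

end

theorem cfunctional_eqI_moments:
  assumes L: "cfunctional L" and M: "cfunctional M"
    and eq: "\<And>j k. L (\<lambda>a. a ^ j * cnj a ^ k) = M (\<lambda>a. a ^ j * cnj a ^ k)"
    and f: "circ_bounded f"
  shows "L f = M f"
proof (rule cfunctional_eqI_indicator[OF L M _ f])
  fix A assume "A \<in> circ_borel"
  then have "L (indicator A) - M (indicator A) = 0"
    by (intro cfunctional_borel[OF cfunctional_minus[OF L M]] circ_borel_sets) (simp_all add: eq)
  then show "L (indicator A) = M (indicator A)" by simp
qed

subsection \<open>The trigonometric moment problem\<close>

lemma has_bochner_integral_cis:
  "has_bochner_integral lborel (\<lambda>t. indicator {0..2*pi} t *\<^sub>R cis (of_int m * t)) (if m = 0 then 2 * pi else 0)"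
proof (cases "m = 0")
  case True
  then show ?thesis
    using has_bochner_integral_FTC_Icc[of 0 "2*pi" complex_of_real "\<lambda>_. 1"]
    by (simp add: has_vector_derivative_def scaleR_conv_of_real bounded_linear_imp_has_derivative bounded_linear_of_real mult.commute)
next
  case False
  let ?F = "\<lambda>t. cis (of_int m * t) / (\<i> * of_int m)"
  have "has_bochner_integral lborel (\<lambda>t. indicator {0..2*pi} t *\<^sub>R cis (of_int m * t)) (?F (2*pi) - ?F 0)"
  proof (rule has_bochner_integral_FTC_Icc)
    fix t :: real
    have "((\<lambda>t. exp (\<i> * of_int m * complex_of_real t) / (\<i> * of_int m)) has_vector_derivative
        exp (\<i> * of_int m * complex_of_real t)) (at t within {0..2*pi})"
    proof -
      have "((\<lambda>z. exp (\<i> * of_int m * z) / (\<i> * of_int m)) has_field_derivative exp (\<i> * of_int m * complex_of_real t))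
          (at (complex_of_real t))"
        using False by (auto intro!: derivative_eq_intros)
      then show ?thesis
        using has_vector_derivative_real_field has_vector_derivative_at_within by blast
    qed
    then show "(?F has_vector_derivative cis (of_int m * t)) (at t within {0..2*pi})"
      by (simp add: cis_conv_exp mult.assoc)
  next
    show "continuous_on {0..2*pi} (\<lambda>t. cis (of_int m * t))" by (intro continuous_intros)
  qed simp
  moreover have "cis (of_int m * (2*pi)) = 1"
    using cis_multiple_2pi[of "of_int m"] by (simp add: ac_simps)
  ultimately show ?thesis using False by simp
qed

lemma cinner_funpow:
  fixes U :: "'k::complex_hilbert \<Rightarrow> 'k"
  assumes "isometric_embedding U"
  shows "cinner ((U ^^ m) x) ((U ^^ m) y) = cinner x y"
  by (induction m) (simp_all add: isometric_embeddingD(2)[OF assms])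

lemma cinner_funpow_shift:
  fixes U :: "'k::complex_hilbert \<Rightarrow> 'k"
  assumes "isometric_embedding U" "q \<le> p"
  shows "cinner ((U ^^ p) x) ((U ^^ q) y) = cinner ((U ^^ (p - q)) x) y"
proof -
  have "(U ^^ p) x = (U ^^ q) ((U ^^ (p - q)) x)"
    using \<open>q \<le> p\<close> funpow_add[of q "p - q" U] by simp
  then show ?thesis by (simp only: cinner_funpow[OF assms(1)])
qed

context
  fixes U :: "'k::complex_hilbert \<Rightarrow> 'k" and v :: 'k
  assumes U: "isometric_embedding U" and v: "v \<noteq> 0"
begin

text \<open>Fejer means of the formal Fourier series with coefficients the moments, written as a square:
  this makes their positivity evident.\<close>

definition fejer_density :: "nat \<Rightarrow> real \<Rightarrow> real" where
  "fejer_density N t = indicator {0..2*pi} t *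
     ((norm (\<Sum>k<N. scaleC (cis (- (of_nat k * t))) ((U ^^ k) v)))\<^sup>2 / (2 * pi * real N * (norm v)\<^sup>2))"

lemma fejer_density_nonneg: "fejer_density N t \<ge> 0"
  by (simp add: fejer_density_def)

text \<open>Expanding the square gives exponentials indexed by k, l < N, and integration keeps only
  those with k = l + j. There are N - j such pairs, all with the same coefficient because U is
  isometric.\<close>

lemma fejer_density_moment:
  assumes N: "N > 0" "j \<le> N"
  shows "has_bochner_integral lborel (\<lambda>t. fejer_density N t *\<^sub>R cis (of_nat j * t))
    (complex_of_real ((real N - real j) / real N) * cinner ((U ^^ j) v) v / (norm v)\<^sup>2)"
proof -
  define C where "C = complex_of_real (2 * pi * real N * (norm v)\<^sup>2)"
  define w where "w k l = cinner ((U ^^ k) v) ((U ^^ l) v) / C" for k l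
  have C0: "C \<noteq> 0" using N v by (simp add: C_def)
  have sq: "complex_of_real ((norm (\<Sum>k<N. scaleC (cis (- (of_nat k * t))) ((U ^^ k) v)))\<^sup>2)
      = (\<Sum>k<N. \<Sum>l<N. cis (of_int (int l - int k) * t) * cinner ((U ^^ k) v) ((U ^^ l) v))" for t
    unfolding cinner_self_norm[symmetric] cinner_sum_left cinner_sum_right
    by (subst sum.swap, intro sum.cong refl)
      (simp add: cinner_simps cis_cnj cis_mult algebra_simps mult.assoc[symmetric])
  have eq: "fejer_density N t *\<^sub>R cis (of_nat j * t)
      = (\<Sum>k<N. \<Sum>l<N. (indicator {0..2*pi} t *\<^sub>R cis (of_int (int l + int j - int k) * t)) * w k l)" for t
  proof -
    have "fejer_density N t *\<^sub>R cis (of_nat j * t)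
       = indicator {0..2*pi} t * (complex_of_real ((norm (\<Sum>k<N. scaleC (cis (- (of_nat k * t))) ((U ^^ k) v)))\<^sup>2) / C)
          * cis (of_nat j * t)"
      by (simp add: fejer_density_def scaleR_conv_of_real C_def indicator_def)
    also have "\<dots> = (\<Sum>k<N. \<Sum>l<N. indicator {0..2*pi} t * ((cis (of_int (int l - int k) * t) * cinner ((U ^^ k) v) ((U ^^ l) v)) / C)
          * cis (of_nat j * t))"
      unfolding sq by (simp add: sum_distrib_left sum_distrib_right sum_divide_distrib)
    also have "\<dots> = (\<Sum>k<N. \<Sum>l<N. (indicator {0..2*pi} t *\<^sub>R cis (of_int (int l + int j - int k) * t)) * w k l)"
    proof (intro sum.cong refl)
      fix k l
      have "cis (of_int (int l - int k) * t) * cis (of_nat j * t) = cis (of_int (int l + int j - int k) * t)"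
        by (simp add: cis_mult algebra_simps)
      then show "indicator {0..2*pi} t * ((cis (of_int (int l - int k) * t) * cinner ((U ^^ k) v) ((U ^^ l) v)) / C)
          * cis (of_nat j * t) = (indicator {0..2*pi} t *\<^sub>R cis (of_int (int l + int j - int k) * t)) * w k l"
        by (simp add: w_def scaleR_conv_of_real indicator_def)
    qed
    finally show ?thesis .
  qed
  have "has_bochner_integral lborel (\<lambda>t. fejer_density N t *\<^sub>R cis (of_nat j * t))
    (\<Sum>k<N. \<Sum>l<N. (if int l + int j - int k = 0 then 2 * pi else 0) * w k l)"
    unfolding eq
    by (intro has_bochner_integral_sum has_bochner_integral_mult_left has_bochner_integral_cis)
  also have "(\<Sum>k<N. \<Sum>l<N. (if int l + int j - int k = 0 then 2 * pi else 0) * w k l)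
      = (\<Sum>l<N. \<Sum>k<N. if k = l + j then complex_of_real (2 * pi) * w k l else 0)"
    by (subst sum.swap) (intro sum.cong refl, auto)
  also have "\<dots> = (\<Sum>l<N. if l + j < N then complex_of_real (2 * pi) * w (l + j) l else 0)"
    by (intro sum.cong refl) (simp add: sum.delta)
  also have "\<dots> = (\<Sum>l<N. if l < N - j then complex_of_real (2 * pi) * (cinner ((U ^^ j) v) v / C) else 0)"
    by (intro sum.cong refl) (auto simp: w_def cinner_funpow_shift[OF U])
  also have "\<dots> = (\<Sum>l<N - j. complex_of_real (2 * pi) * (cinner ((U ^^ j) v) v / C))"
  proof -
    have "{..<N} \<inter> {l. l < N - j} = {..<N - j}" by auto
    then show ?thesis by (simp add: sum.If_cases)
  qed
  also have "\<dots> = complex_of_real ((real N - real j) / real N) * cinner ((U ^^ j) v) v / (norm v)\<^sup>2"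
    using N v by (simp add: C_def of_nat_diff field_simps)
  finally show ?thesis .
qed

lemma fejer_density_measurable [measurable]: "fejer_density N \<in> borel_measurable borel"
proof -
  have "continuous_on UNIV (\<lambda>t. \<Sum>k<N. scaleC (cis (- (of_nat k * t))) ((U ^^ k) v))"
    by (intro continuous_on_sum bounded_bilinear.continuous_on[OF bounded_bilinear_scaleC] continuous_intros)
  then have "(\<lambda>t. (norm (\<Sum>k<N. scaleC (cis (- (of_nat k * t))) ((U ^^ k) v)))\<^sup>2) \<in> borel_measurable borel"
    by (intro borel_measurable_continuous_onI continuous_on_power continuous_on_norm)
  then show ?thesis unfolding fejer_density_def[abs_def] by simp
qed

lemma fejer_density_nn_integral:
  assumes "N > 0" shows "(\<integral>\<^sup>+t. ennreal (fejer_density N t) \<partial>lborel) = 1"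
proof -
  have "complex_of_real ((real N - real 0) / real N) * cinner ((U ^^ 0) v) v / (norm v)\<^sup>2 = 1"
    using assms v by (simp add: cinner_self_norm)
  then have "has_bochner_integral lborel (\<lambda>t. complex_of_real (fejer_density N t)) (complex_of_real 1)"
    using fejer_density_moment[OF assms, of 0] by (simp add: scaleR_conv_of_real)
  then have "has_bochner_integral lborel (fejer_density N) 1"
    using has_bochner_integral_Re by fastforce
  then show ?thesis
    using nn_integral_eq_integral[of lborel "fejer_density N"] fejer_density_nonneg
    by (simp add: has_bochner_integral_iff)
qed

text \<open>The Fejer densities live on a common bounded interval, so they are tight and a
  subsequence converges weakly. The moments are characteristic functions at integers and pass to the
  limit, where the weight (N - j) / N becomes 1. Working on the line makes this weak convergence
  theory applicable.\<close>

lemma trigonometric_moment_problem_line: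
  "\<exists>M. real_distribution M \<and> (\<forall>j. char M (of_nat j) = cinner ((U ^^ j) v) v / (norm v)\<^sup>2)"
proof -
  \<comment> \<open>The index \<open>Suc n\<close> keeps the number of summands positive, as
    normalisation requires.\<close>
  define \<mu> where "\<mu> n = density lborel (\<lambda>t. ennreal (fejer_density (Suc n) t))" for n
  have rd: "real_distribution (\<mu> n)" for n
  proof -
    have "prob_space (\<mu> n)"
      by (rule prob_spaceI) (simp add: \<mu>_def emeasure_density fejer_density_nn_integral)
    then show ?thesis by (simp add: real_distribution_def real_distribution_axioms_def \<mu>_def)
  qed
  have ch: "char (\<mu> n) (of_nat j) = complex_of_real ((real (Suc n) - real j) / real (Suc n)) * cinner ((U ^^ j) v) v / (norm v)\<^sup>2"
    if "j \<le> Suc n" for n j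
  proof -
    have "char (\<mu> n) (of_nat j) = (CLINT t|lborel. fejer_density (Suc n) t *\<^sub>R cis (of_nat j * t))"
      unfolding char_def \<mu>_def
      by (subst integral_density) (auto simp: cis_conv_exp fejer_density_nonneg)
    then show ?thesis using has_bochner_integral_integral_eq[OF fejer_density_moment[of "Suc n" j]] that by simp
  qed
  \<comment> \<open>The interval contains {0..2*pi} because pi < 4.\<close>
  have supp: "measure (\<mu> n) {-1<..8} = 1" for n
  proof -
    have "emeasure (\<mu> n) {-1<..8} = (\<integral>\<^sup>+t. ennreal (fejer_density (Suc n) t) * indicator {-1<..8} t \<partial>lborel)"
      by (simp add: \<mu>_def emeasure_density)
    also have "\<dots> = (\<integral>\<^sup>+t. ennreal (fejer_density (Suc n) t) \<partial>lborel)"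
    proof (intro nn_integral_cong)
      fix t
      have "fejer_density (Suc n) t = 0" if "t \<notin> {-1<..8}"
        using that pi_less_4 by (auto simp: fejer_density_def)
      then show "ennreal (fejer_density (Suc n) t) * indicator {-1<..8} t = ennreal (fejer_density (Suc n) t)"
        by (auto simp: indicator_def)
    qed
    finally show ?thesis by (simp add: fejer_density_nn_integral measure_def)
  qed
  have "tight \<mu>" unfolding tight_def
  proof (intro conjI allI impI)
    fix \<epsilon> :: real assume "\<epsilon> > 0"
    then show "\<exists>a b. a < b \<and> (\<forall>n. measure (\<mu> n) {a<..b} > 1 - \<epsilon>)"
      by (intro exI[of _ "-1"] exI[of _ 8]) (simp add: supp)
  qed (rule rd)
  then obtain r M where r: "strict_mono r" and M: "real_distribution M" and w: "weak_conv_m (\<mu> \<circ> id \<circ> r) M"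
    using tight_imp_convergent_subsubsequence[of \<mu> id] strict_mono_id by blast
  have "char M (of_nat j) = cinner ((U ^^ j) v) v / (norm v)\<^sup>2" for j
  proof (rule LIMSEQ_unique)
    show "(\<lambda>n. char (\<mu> (r n)) (of_nat j)) \<longlonglongrightarrow> char M (of_nat j)"
      using levy_continuity1[OF _ M w] rd by simp
    have "(\<lambda>n. (real (Suc n) - real j) / real (Suc n)) \<longlonglongrightarrow> 1" by real_asymp
    then have "(\<lambda>n. complex_of_real ((real (Suc n) - real j) / real (Suc n)) * cinner ((U ^^ j) v) v / (norm v)\<^sup>2)
        \<longlonglongrightarrow> complex_of_real 1 * cinner ((U ^^ j) v) v / (norm v)\<^sup>2"
      by (intro tendsto_intros) (use v in auto)
    moreover have "\<forall>\<^sub>F n in sequentially. complex_of_real ((real (Suc n) - real j) / real (Suc n)) * cinner ((U ^^ j) v) v / (norm v)\<^sup>2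
        = char (\<mu> n) (of_nat j)"
      using eventually_ge_at_top[of j] by eventually_elim (simp only: ch)
    ultimately have "(\<lambda>n. char (\<mu> n) (of_nat j)) \<longlonglongrightarrow> cinner ((U ^^ j) v) v / (norm v)\<^sup>2"
      using Lim_transform_eventually by fastforce
    then show "(\<lambda>n. char (\<mu> (r n)) (of_nat j)) \<longlonglongrightarrow> cinner ((U ^^ j) v) v / (norm v)\<^sup>2"
      using LIMSEQ_subseq_LIMSEQ[OF _ r] by (simp add: o_def)
  qed
  with M show ?thesis by blast
qed

end

text \<open>The image under \<open>cis\<close> of the measure on the line, after multiplying by
  |v|^2 to undo the normalisation to a probability measure.\<close>

theorem trigonometric_moment_problem:
  fixes U :: "'k::complex_hilbert \<Rightarrow> 'k"
  assumes U: "isometric_embedding U"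
  shows "\<exists>M. finite_measure M \<and> sets M = circ_borel \<and>
    (\<forall>j k. integral\<^sup>L M (\<lambda>a. a ^ j * cnj a ^ k) = cinner ((U ^^ j) v) ((U ^^ k) v))"
proof (cases "v = 0")
  case True
  have "(U ^^ k) 0 = 0" for k
    by (induction k) (simp_all add: clinear_mapD(3)[OF isometric_embeddingD(1)[OF U]])
  then show ?thesis using True
    by (intro exI[of _ "null_measure (restrict_space borel unit_circle)"])
      (auto simp: circ_borel_eq intro!: finite_measureI)
next
  case False
  then obtain M where M: "real_distribution M" and ch: "\<And>j. char M (of_nat j) = cinner ((U ^^ j) v) v / (norm v)\<^sup>2"
    using trigonometric_moment_problem_line[OF U] by blast
  interpret real_distribution M by fact
  define M' where "M' = density M (\<lambda>_. ennreal ((norm v)\<^sup>2))"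
  define N where "N = distr M' (restrict_space borel unit_circle) cis"
  have setsM': "sets M' = sets borel" by (simp add: M'_def)
  have cm: "cis \<in> measurable M' (restrict_space borel unit_circle)"
  proof (rule measurable_restrict_space2)
    show "cis \<in> space M' \<rightarrow> unit_circle" by (auto simp: unit_circle_def)
    have "cis \<in> borel_measurable borel" by (intro borel_measurable_continuous_onI continuous_intros)
    then show "cis \<in> borel_measurable M'" by (simp add: measurable_cong_sets[OF setsM' refl])
  qed
  have fm: "finite_measure M'"
    by (rule finite_measureI) (simp add: M'_def emeasure_density emeasure_space_1[simplified] ennreal_mult_eq_top_iff)
  have "finite_measure N" unfolding N_def by (rule finite_measure.finite_measure_distr[OF fm cm])
  moreover have "sets N = circ_borel" by (simp add: N_def circ_borel_eq)
  moreover have cis_power: "cis t ^ j * cnj (cis t) ^ k = cis (real j * t - real k * t)" for t j k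
  proof -
    have "cis t ^ j * cnj (cis t) ^ k = cis (real j * t) * cis (real k * (- t))"
      by (simp only: Complex.DeMoivre cis_cnj)
    then show ?thesis by (simp add: cis_mult)
  qed
  moreover have "integral\<^sup>L N (\<lambda>a. a ^ j * cnj a ^ k) = cinner ((U ^^ j) v) ((U ^^ k) v)" for j k
  proof -
    have mm: "(\<lambda>a. a ^ j * cnj a ^ k) \<in> borel_measurable (restrict_space borel unit_circle)"
      using circ_bounded_monomial[of j k] by (intro measurable_restrict_space1) (simp add: circ_bounded_def)
    have "integral\<^sup>L N (\<lambda>a. a ^ j * cnj a ^ k) = (CLINT t|M'. cis t ^ j * cnj (cis t) ^ k)"
      unfolding N_def by (rule integral_distr[OF cm mm])
    also have "\<dots> = (CLINT t|M. (norm v)\<^sup>2 *\<^sub>R (cis t ^ j * cnj (cis t) ^ k))"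
      unfolding M'_def
    proof (rule integral_density)
      have "(\<lambda>t. cis t ^ j * cnj (cis t) ^ k) \<in> borel_measurable borel"
        by (intro borel_measurable_continuous_onI continuous_intros)
      then show "(\<lambda>t. cis t ^ j * cnj (cis t) ^ k) \<in> borel_measurable M" by simp
    qed auto
    also have "\<dots> = (norm v)\<^sup>2 * (CLINT t|M. cis t ^ j * cnj (cis t) ^ k)"
      by (simp add: scaleR_conv_of_real)
    also have "(CLINT t|M. cis t ^ j * cnj (cis t) ^ k) = cinner ((U ^^ j) v) ((U ^^ k) v) / (norm v)\<^sup>2"
    proof (cases "k \<le> j")
      case True
      have "cis t ^ j * cnj (cis t) ^ k = iexp (of_nat (j - k) * t)" for t
        using True by (simp only: cis_power of_nat_diff left_diff_distrib) (simp add: cis_conv_exp)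
      then have "(CLINT t|M. cis t ^ j * cnj (cis t) ^ k) = char M (of_nat (j - k))" by (simp add: char_def)
      moreover have "cinner ((U ^^ j) v) ((U ^^ k) v) = cinner ((U ^^ (j - k)) v) v"
        by (rule cinner_funpow_shift[OF U True])
      ultimately show ?thesis by (simp only: ch)
    next
      \<comment> \<open>The characteristic function is known only at natural numbers; a negative
        difference of exponents is reached by conjugation.\<close>
      case kj: False
      have "cis t ^ j * cnj (cis t) ^ k = cnj (iexp (of_nat (k - j) * t))" for t
      proof -
        have "real (k - j) = real k - real j" using kj by (simp add: of_nat_diff)
        then have "cnj (iexp (of_nat (k - j) * t)) = cnj (cis (real k * t - real j * t))"
          by (simp add: cis_conv_exp left_diff_distrib)
        then show ?thesis unfolding cis_power by (simp add: cis_cnj)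
      qed
      then have "(CLINT t|M. cis t ^ j * cnj (cis t) ^ k) = cnj (char M (of_nat (k - j)))"
        by (simp only: char_def) simp
      moreover have "cinner ((U ^^ k) v) ((U ^^ j) v) = cinner ((U ^^ (k - j)) v) v"
        by (rule cinner_funpow_shift[OF U]) (use kj in simp)
      ultimately show ?thesis
        unfolding ch using cinner_commute[of "(U ^^ j) v" "(U ^^ k) v"] by simp
    qed
    finally show ?thesis using False by simp
  qed
  ultimately show ?thesis by blast
qed

subsection \<open>Existence of the spectral measure\<close>

context
  fixes U :: "'k::complex_hilbert \<Rightarrow> 'k" and \<nu>
  assumes U: "unitary_betw U"
    and fin: "\<And>v. finite_measure (\<nu> v)" and sets: "\<And>v. sets (\<nu> v) = circ_borel"
    and moment: "\<And>v j k. integral\<^sup>L (\<nu> v) (\<lambda>a. a ^ j * cnj a ^ k) = cinner ((U ^^ j) v) ((U ^^ k) v)"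
begin

lemma clinear_funpow:
  "(U ^^ k) (x + y) = (U ^^ k) x + (U ^^ k) y" "(U ^^ k) (scaleC c x) = scaleC c ((U ^^ k) x)"
  by (induction k) (simp_all add: clinear_mapD[OF isometric_embeddingD(1)[OF unitary_betwD(1)[OF U]]])

lemma cfunctional_form: "cfunctional (\<lambda>f. circ_form \<nu> f x y)"
  by (intro cfunctional_circ_form fin sets)

lemma circ_form_moment:
  "circ_form \<nu> (\<lambda>a. a ^ j * cnj a ^ k) x y = cinner ((U ^^ j) x) ((U ^^ k) y)"
proof -
  let ?c = "\<lambda>m::nat. \<i> ^ m" and ?p = "\<lambda>u v. cinner ((U ^^ j) u) ((U ^^ k) v)"
  have "circ_form \<nu> (\<lambda>a. a ^ j * cnj a ^ k) x y
      = (1/4) * (\<Sum>m\<in>{0..3}. ?c m * (?p x x + ?p x y * cnj (?c m) + ?c m * ?p y x + ?c m * cnj (?c m) * ?p y y))"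
    unfolding circ_form_def moment clinear_funpow by (simp add: cinner_simps algebra_simps)
  also have "\<dots> = ?p x y" by (simp add: eval_nat_numeral algebra_simps)
  finally show ?thesis .
qed

text \<open>Determination by moments: every identity between forms below reduces to an identity
  between inner products of powers of U.\<close>

lemma circ_form_eqI:
  assumes "cfunctional M" "\<And>j k. M (\<lambda>a. a ^ j * cnj a ^ k) = cinner ((U ^^ j) x) ((U ^^ k) y)" "circ_bounded f"
  shows "circ_form \<nu> f x y = M f"
  by (rule cfunctional_eqI_moments[OF cfunctional_form assms(1) _ assms(3)]) (simp add: circ_form_moment assms(2))

lemma circ_form_add_left: "circ_bounded f \<Longrightarrow> circ_form \<nu> f (x + y) z = circ_form \<nu> f x z + circ_form \<nu> f y z"
  by (rule circ_form_eqI[where M = "\<lambda>f. circ_form \<nu> f x z + circ_form \<nu> f y z"])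
    (simp_all add: cfunctional_plus cfunctional_form circ_form_moment clinear_funpow cinner_add_left)

lemma circ_form_scaleC_left: "circ_bounded f \<Longrightarrow> circ_form \<nu> f (scaleC c x) z = c * circ_form \<nu> f x z"
  by (rule circ_form_eqI[where M = "\<lambda>f. c * circ_form \<nu> f x z"])
    (simp_all add: cfunctional_scale cfunctional_form circ_form_moment clinear_funpow cinner_scaleC_left)

lemma circ_form_swap: "circ_bounded f \<Longrightarrow> circ_form \<nu> f y x = cnj (circ_form \<nu> (\<lambda>a. cnj (f a)) x y)"
proof (rule circ_form_eqI[where M = "\<lambda>f. cnj (circ_form \<nu> (\<lambda>a. cnj (f a)) x y)"])
  fix j k
  have "(\<lambda>a. cnj (a ^ j * cnj a ^ k)) = (\<lambda>a. a ^ k * cnj a ^ j)" by (simp add: mult.commute)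
  then show "cnj (circ_form \<nu> (\<lambda>a. cnj (a ^ j * cnj a ^ k)) x y) = cinner ((U ^^ j) y) ((U ^^ k) x)"
    using cinner_commute[of "(U ^^ j) y" "(U ^^ k) x"] by (simp only: circ_form_moment)
qed (auto intro: cfunctional_cnj cfunctional_form)

lemma circ_form_monomial:
  assumes "circ_bounded f"
  shows "circ_form \<nu> f ((U ^^ j) x) ((U ^^ k) y) = circ_form \<nu> (\<lambda>a. (a ^ j * cnj a ^ k) * f a) x y"
proof (rule circ_form_eqI[where M = "\<lambda>f. circ_form \<nu> (\<lambda>a. (a ^ j * cnj a ^ k) * f a) x y"])
  show "cfunctional (\<lambda>f. circ_form \<nu> (\<lambda>a. a ^ j * cnj a ^ k * f a) x y)"
    by (intro cfunctional_mult[OF cfunctional_form] circ_bounded_monomial)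
  fix l m
  have "(\<lambda>a. a ^ j * cnj a ^ k * (a ^ l * cnj a ^ m)) = (\<lambda>a. a ^ (l + j) * cnj a ^ (m + k))"
    by (simp add: power_add ac_simps)
  then show "circ_form \<nu> (\<lambda>a. a ^ j * cnj a ^ k * (a ^ l * cnj a ^ m)) x y
      = cinner ((U ^^ l) ((U ^^ j) x)) ((U ^^ m) ((U ^^ k) y))"
    by (simp only: circ_form_moment funpow_add o_apply)
qed (rule assms)

lemma circ_form_diag: "circ_bounded f \<Longrightarrow> circ_form \<nu> f x x = integral\<^sup>L (\<nu> x) f"
  by (rule circ_form_eqI) (simp_all add: cfunctional_integral fin sets moment)

lemma circ_form_one: "circ_form \<nu> (\<lambda>_. 1) x y = cinner x y"
  using circ_form_moment[of 0 0] by simp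

text \<open>Boundedness in x for the Riesz theorem. For a unit vector each of the four polarised
  measures has mass at most (1 + norm y)^2; homogeneity carries the bound to all x.\<close>

lemma cmod_circ_form_indicator_le:
  assumes A: "A \<in> circ_borel"
  shows "cmod (circ_form \<nu> (indicator A) x y) \<le> (1 + norm y)\<^sup>2 * norm x"
proof -
  have mA: "measure (\<nu> v) A \<le> (norm v)\<^sup>2" for v
  proof -
    interpret finite_measure "\<nu> v" by (rule fin)
    have "complex_of_real (measure (\<nu> v) (space (\<nu> v))) = integral\<^sup>L (\<nu> v) (\<lambda>_. 1)" by (simp add: scaleR_conv_of_real)
    also have "\<dots> = cinner v v" using moment[of v 0 0] by simp
    finally have "measure (\<nu> v) (space (\<nu> v)) = (norm v)\<^sup>2" by (simp only: cinner_self_norm of_real_eq_iff)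
    then show ?thesis using bounded_measure[of A] by simp
  qed
  have unit: "cmod (circ_form \<nu> (indicator A) u y) \<le> (1 + norm y)\<^sup>2" if u: "norm u = 1" for u
  proof -
    have "cmod (circ_form \<nu> (indicator A) u y)
        = (1/4) * cmod (\<Sum>k\<in>{0..3::nat}. \<i> ^ k * complex_of_real (measure (\<nu> (u + scaleC (\<i> ^ k) y)) A))"
      unfolding circ_form_def using A by (simp add: integral_indicator_complex fin sets norm_mult)
    also have "\<dots> \<le> (1/4) * (\<Sum>k\<in>{0..3::nat}. (1 + norm y)\<^sup>2)"
    proof (intro mult_left_mono sum_norm_le)
      fix k :: nat
      have "norm (u + scaleC (\<i> ^ k) y) \<le> 1 + norm y"
        using norm_triangle_ineq[of u "scaleC (\<i> ^ k) y"] u by (simp add: norm_scaleC norm_power)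
      then have "(norm (u + scaleC (\<i> ^ k) y))\<^sup>2 \<le> (1 + norm y)\<^sup>2" by (intro power_mono) auto
      with mA have "measure (\<nu> (u + scaleC (\<i> ^ k) y)) A \<le> (1 + norm y)\<^sup>2" by (rule order_trans)
      then show "cmod (\<i> ^ k * complex_of_real (measure (\<nu> (u + scaleC (\<i> ^ k) y)) A)) \<le> (1 + norm y)\<^sup>2"
        by (simp add: norm_mult norm_power)
    qed simp
    also have "\<dots> = (1 + norm y)\<^sup>2" by simp
    finally show ?thesis .
  qed
  have cb: "circ_bounded (indicator A)" by (intro circ_bounded_indicator circ_borel_sets A)
  show ?thesis
  proof (cases "x = 0")
    case True
    then show ?thesis using circ_form_scaleC_left[OF cb, of 0 0 y] by simp
  next
    case False
    define u where "u = scaleC (of_real (1 / norm x)) x"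
    have xu: "scaleC (of_real (norm x)) u = x" using False by (simp add: u_def scaleC_scaleC)
    have "circ_form \<nu> (indicator A) x y = of_real (norm x) * circ_form \<nu> (indicator A) u y"
      using circ_form_scaleC_left[OF cb, of "of_real (norm x)" u y] unfolding xu .
    moreover have "norm u = 1" using False by (simp add: u_def norm_scaleC norm_divide)
    ultimately show ?thesis using unit[of u] by (simp add: norm_mult mult.commute[of _ "norm x"] mult_left_mono)
  qed
qed

definition proj where
  "proj A y = (SOME z. \<forall>x. circ_form \<nu> (indicator A) x y = cinner x z)"

lemma cinner_proj:
  assumes A: "A \<in> circ_borel"
  shows "cinner x (proj A y) = circ_form \<nu> (indicator A) x y"
proof -
  have cb: "circ_bounded (indicator A)" by (intro circ_bounded_indicator circ_borel_sets A)
  have "\<exists>z. \<forall>x. circ_form \<nu> (indicator A) x y = cinner x z"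
    by (rule Riesz_representation[where K = "(1 + norm y)\<^sup>2"])
      (simp_all add: circ_form_add_left[OF cb] circ_form_scaleC_left[OF cb] cmod_circ_form_indicator_le[OF A])
  then have "\<forall>x. circ_form \<nu> (indicator A) x y = cinner x (proj A y)" unfolding proj_def by (rule someI_ex)
  then show ?thesis by simp
qed

lemma proj_self_adjoint:
  assumes A: "A \<in> circ_borel"
  shows "cinner (proj A x) y = cinner x (proj A y)"
proof -
  have cb: "circ_bounded (indicator A)" by (intro circ_bounded_indicator circ_borel_sets A)
  have i: "(\<lambda>a. cnj (indicator A a)) = (indicator A :: complex \<Rightarrow> complex)" by (auto simp: indicator_def)
  have "cinner (proj A x) y = cnj (circ_form \<nu> (indicator A) y x)"
    using cinner_commute[of "proj A x" y] by (simp add: cinner_proj[OF A])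
  also have "\<dots> = circ_form \<nu> (indicator A) x y" using circ_form_swap[OF cb, of x y] by (simp add: i)
  finally show ?thesis by (simp add: cinner_proj[OF A])
qed

lemma clinear_proj:
  assumes A: "A \<in> circ_borel" shows "clinear_map (proj A)"
  unfolding clinear_map_def
  by (intro conjI allI cinner_ext_left)
    (simp_all add: cinner_simps proj_self_adjoint[OF A, symmetric])

text \<open>Moving U through both slots of the form multiplies the integrand by a cnj a, which is 1
  on the circle. Surjectivity of U lets every x be written as U of something.\<close>

lemma proj_funpow:
  assumes A: "A \<in> circ_borel" shows "proj A ((U ^^ k) y) = (U ^^ k) (proj A y)"
proof (induction k)
  case (Suc k)
  have cb: "circ_bounded (indicator A)" by (intro circ_bounded_indicator circ_borel_sets A)
  have *: "proj A (U y) = U (proj A y)" for y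
  proof (rule cinner_ext_left)
    fix x
    have "cinner x (proj A (U y)) = circ_form \<nu> (indicator A) ((U ^^ 1) (inv U x)) ((U ^^ 1) y)"
      by (simp add: cinner_proj[OF A] unitary_betwD(4)[OF U])
    also have "\<dots> = circ_form \<nu> (\<lambda>a. (a ^ 1 * cnj a ^ 1) * indicator A a) (inv U x) y"
      by (rule circ_form_monomial[OF cb])
    also have "\<dots> = circ_form \<nu> (indicator A) (inv U x) y"
    proof (rule cfunctional_cong[OF cfunctional_form _ cb])
      show "circ_bounded (\<lambda>a. a ^ 1 * cnj a ^ 1 * indicator A a)" by (intro circ_bounded_mult[OF circ_bounded_monomial cb])
      fix a assume "a \<in> unit_circle"
      then have "a * cnj a = 1" using complex_norm_square[of a] by (simp add: unit_circle_def)
      then show "a ^ 1 * cnj a ^ 1 * indicator A a = indicator A a" by simp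
    qed
    also have "\<dots> = cinner x (U (proj A y))"
      using cinner_proj[OF A] unitary_betwD(6)[OF U, of "inv U x" "U (proj A y)"]
      by (simp add: unitary_betwD(4,5)[OF U])
    finally show "cinner x (proj A (U y)) = cinner x (U (proj A y))" .
  qed
  show ?case using Suc by (simp add: *)
qed simp

text \<open>The source of multiplicativity. The measures attached to \<open>proj A y\<close> are
  unrelated to those of y, but the moments agree because the projection commutes with the powers of
  U.\<close>

lemma circ_form_proj_right:
  assumes A: "A \<in> circ_borel" and f: "circ_bounded f"
  shows "circ_form \<nu> f x (proj A y) = circ_form \<nu> (\<lambda>a. indicator A a * f a) x y"
proof (rule circ_form_eqI[where M = "\<lambda>f. circ_form \<nu> (\<lambda>a. indicator A a * f a) x y", OF _ _ f])
  have cb: "circ_bounded (indicator A)" by (intro circ_bounded_indicator circ_borel_sets A)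
  show "cfunctional (\<lambda>f. circ_form \<nu> (\<lambda>a. indicator A a * f a) x y)"
    by (intro cfunctional_mult[OF cfunctional_form] cb)
  fix j k
  have "circ_form \<nu> (\<lambda>a. indicator A a * (a ^ j * cnj a ^ k)) x y = circ_form \<nu> (indicator A) ((U ^^ j) x) ((U ^^ k) y)"
    by (simp add: circ_form_monomial[OF cb] mult.commute)
  also have "\<dots> = cinner ((U ^^ j) x) ((U ^^ k) (proj A y))"
    by (simp add: cinner_proj[OF A, symmetric] proj_funpow[OF A])
  finally show "circ_form \<nu> (\<lambda>a. indicator A a * (a ^ j * cnj a ^ k)) x y = cinner ((U ^^ j) x) ((U ^^ k) (proj A y))" .
qed

lemma proj_Int:
  assumes A: "A \<in> circ_borel" and B: "B \<in> circ_borel"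
  shows "proj (A \<inter> B) y = proj A (proj B y)"
proof (rule cinner_ext_left)
  fix x
  have cb: "circ_bounded (indicator A)" by (intro circ_bounded_indicator circ_borel_sets A)
  have "(\<lambda>a. indicator B a * indicator A a) = (indicator (A \<inter> B) :: complex \<Rightarrow> complex)"
    by (auto simp: indicator_def)
  then show "cinner x (proj (A \<inter> B) y) = cinner x (proj A (proj B y))"
    by (simp add: cinner_proj A B circ_borel_Int circ_form_proj_right[OF B cb])
qed

lemma proj_circle: "proj unit_circle y = y"
proof (rule cinner_ext_left)
  fix x
  have "circ_form \<nu> (indicator unit_circle) x y = circ_form \<nu> (\<lambda>_. 1) x y"
    by (rule cfunctional_cong[OF cfunctional_form]) (auto intro: circ_bounded_indicator)
  then show "cinner x (proj unit_circle y) = cinner x y" by (simp add: cinner_proj circ_form_one)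
qed

text \<open>By idempotence the left side is <P(A)v, v>, and the diagonal of the form is integration
  against \<open>\<nu> v\<close>. So the projections give back the measures from which they were
  built.\<close>

lemma norm_proj_sq:
  assumes A: "A \<in> circ_borel" shows "(norm (proj A v))\<^sup>2 = measure (\<nu> v) A"
proof -
  have cb: "circ_bounded (indicator A)" by (intro circ_bounded_indicator circ_borel_sets A)
  have "complex_of_real ((norm (proj A v))\<^sup>2) = cinner v (proj A (proj A v))"
    by (simp only: cinner_self_norm[symmetric] proj_self_adjoint[OF A])
  also have "\<dots> = cinner v (proj A v)" using proj_Int[OF A A, of v] by simp
  also have "\<dots> = complex_of_real (measure (\<nu> v) A)"
    using A by (simp add: cinner_proj circ_form_diag[OF cb] integral_indicator_complex fin sets)
  finally show ?thesis using of_real_eq_iff by blast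
qed

text \<open>The remainder after n terms is the projection of the tail set \<open>R n\<close>. Its
  squared norm is the measure of \<open>R n\<close>, which tends to 0 since the tails decrease to
  the empty set.\<close>

lemma proj_sums:
  assumes F: "range F \<subseteq> circ_borel" "disjoint_family F"
  shows "(\<lambda>m. proj (F m) x) sums proj (\<Union>(range F)) x"
proof -
  interpret finite_measure "\<nu> x" by (rule fin)
  have Fm: "F m \<in> circ_borel" for m using F by auto
  have UF: "\<Union>(range F) \<in> circ_borel" using Fm unfolding circ_borel_eq by (intro sets.countable_UN) auto
  have UN: "(\<Union>m<n. F m) \<in> circ_borel" for n using Fm unfolding circ_borel_eq by (intro sets.countable_UN'') auto
  define R where "R n = \<Union>(range F) - (\<Union>m<n. F m)" for n
  have R: "R n \<in> circ_borel" for n using UF UN unfolding R_def circ_borel_eq by (intro sets.Diff)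
  have diff: "proj (\<Union>(range F)) x - (\<Sum>m<n. proj (F m) x) = proj (R n) x" for n
  proof (rule cinner_ext_left)
    fix y
    have ind: "(indicator Q :: complex \<Rightarrow> complex) a = indicator (Q - S) a + indicator S a" if "S \<subseteq> Q" for Q S a
      using that by (auto simp: indicator_def)
    have "(indicator (\<Union>(range F)) :: complex \<Rightarrow> complex) = (\<lambda>a. indicator (R n) a + (\<Sum>m<n. indicator (F m) a))"
    proof
      fix a
      have "disjoint_family_on F {..<n}" using F(2) by (auto simp: disjoint_family_on_def)
      then have "(\<Sum>m<n. indicator (F m) a :: complex) = indicator (\<Union>m<n. F m) a"
        by (simp add: indicator_UN_disjoint)
      moreover have "(indicator (\<Union>(range F)) a :: complex) = indicator (R n) a + indicator (\<Union>m<n. F m) a"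
        unfolding R_def by (rule ind) blast
      ultimately show "(indicator (\<Union>(range F)) a :: complex) = indicator (R n) a + (\<Sum>m<n. indicator (F m) a)"
        by simp
    qed
    then have "circ_form \<nu> (indicator (\<Union>(range F))) y x
        = circ_form \<nu> (\<lambda>a. indicator (R n) a + (\<Sum>m<n. indicator (F m) a)) y x"
      by (rule arg_cong[where f = "\<lambda>f. circ_form \<nu> f y x"])
    also have "\<dots> = circ_form \<nu> (indicator (R n)) y x + circ_form \<nu> (\<lambda>a. \<Sum>m<n. indicator (F m) a) y x"
      by (intro cfunctional_add[OF cfunctional_form] circ_bounded_sum circ_bounded_indicator circ_borel_sets R Fm)
    also have "circ_form \<nu> (\<lambda>a. \<Sum>m<n. indicator (F m) a) y x = (\<Sum>m<n. circ_form \<nu> (indicator (F m)) y x)"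
      by (intro cfunctional_sum[OF cfunctional_form] circ_bounded_indicator circ_borel_sets Fm)
    finally show "cinner y (proj (\<Union>(range F)) x - (\<Sum>m<n. proj (F m) x)) = cinner y (proj (R n) x)"
      by (simp add: cinner_diff_right cinner_sum_right cinner_proj UF Fm R)
  qed
  have "(\<lambda>n. measure (\<nu> x) (R n)) \<longlonglongrightarrow> measure (\<nu> x) (\<Inter>n. R n)"
  proof (rule finite_Lim_measure_decseq)
    show "range R \<subseteq> sets (\<nu> x)" using R by (auto simp: sets)
    show "decseq R" unfolding R_def decseq_def by (intro allI impI Diff_mono subset_refl UN_mono) auto
  qed
  moreover have "(\<Inter>n. R n) = {}"
  proof (rule equals0I)
    fix a assume a: "a \<in> (\<Inter>n. R n)"
    then obtain m where "a \<in> F m" by (auto simp: R_def)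
    moreover have "a \<in> R (Suc m)" using a by blast
    ultimately show False by (simp add: R_def)
  qed
  ultimately have "(\<lambda>n. (norm (proj (R n) x))\<^sup>2) \<longlonglongrightarrow> 0" by (simp add: norm_proj_sq R)
  then have "(\<lambda>n. sqrt ((norm (proj (R n) x))\<^sup>2)) \<longlonglongrightarrow> sqrt 0" by (rule tendsto_real_sqrt)
  then have "(\<lambda>n. proj (\<Union>(range F)) x - (\<Sum>m<n. proj (F m) x)) \<longlonglongrightarrow> 0"
    by (subst tendsto_norm_zero_iff[symmetric]) (simp add: diff)
  then have "(\<lambda>n. proj (\<Union>(range F)) x - (proj (\<Union>(range F)) x - (\<Sum>m<n. proj (F m) x)))
      \<longlonglongrightarrow> proj (\<Union>(range F)) x - 0"
    by (intro tendsto_diff tendsto_const)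
  then show ?thesis by (simp add: sums_def)
qed

lemma is_spectral_measure_proj: "is_spectral_measure U proj"
  unfolding is_spectral_measure_def
proof (intro conjI ballI allI impI)
  \<comment> \<open>This identifies \<open>spec_form\<close> of the new projections with
    \<open>circ_form \<nu>\<close>, whose moments are known.\<close>
  have scal: "scalar_spec_measure proj v = \<nu> v" for v
  proof -
    interpret finite_measure "\<nu> v" by (rule fin)
    have "scalar_spec_measure proj v = measure_of unit_circle circ_borel (emeasure (\<nu> v))"
      unfolding scalar_spec_measure_def
      by (rule measure_of_eq[OF circ_borel_Pow]) (simp add: sigma_sets_circ_borel norm_proj_sq emeasure_eq_measure)
    then show ?thesis using measure_of_of_measure[of "\<nu> v"] by (simp add: sets space_eq_unit_circle[OF sets])
  qed
  show "cinner (U x) y = spec_form proj (\<lambda>a. a) x y" for x y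
    using circ_form_moment[of 1 0 x y] by (simp add: spec_form_eq_circ_form scal[abs_def])
  show "proj unit_circle = id" by (auto simp: proj_circle)
  fix A assume A: "A \<in> circ_borel"
  show "clinear_map (proj A)" by (rule clinear_proj[OF A])
  show "proj A \<circ> proj A = proj A" using proj_Int[OF A A] by (auto simp: fun_eq_iff)
  show "cinner (proj A x) y = cinner x (proj A y)" for x y by (rule proj_self_adjoint[OF A])
  show "proj (A \<inter> B) = proj A \<circ> proj B" if "B \<in> circ_borel" for B using proj_Int[OF A that] by (auto simp: fun_eq_iff)
qed (rule proj_sums)

end

theorem spectral_measure_exists:
  assumes U: "unitary_betw U"
  shows "\<exists>P. is_spectral_measure U P"
proof -
  obtain \<nu> where "\<And>v. finite_measure (\<nu> v) \<and> sets (\<nu> v) = circ_borel \<and>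
      (\<forall>j k. integral\<^sup>L (\<nu> v) (\<lambda>a. a ^ j * cnj a ^ k) = cinner ((U ^^ j) v) ((U ^^ k) v))"
    using trigonometric_moment_problem[OF unitary_betwD(1)[OF U]] by metis
  then show ?thesis using is_spectral_measure_proj[OF U, of \<nu>] by blast
qed

lemma is_spectral_measure_of:
  "unitary_betw U \<Longrightarrow> is_spectral_measure U (spectral_measure_of U)"
  unfolding spectral_measure_of_def using spectral_measure_exists by (rule someI_ex)

text \<open>The Herglotz formula leaves the resolvent in the second slot; the outer conjugate moves
  it to the first, where it is a power series in cnj (b z).\<close>

lemma G_fun_eq_neumann:
  assumes U: "unitary_betw U" and z: "cmod (bfun z) < 1"
  shows "G_fun J \<iota> U z $ j $ k = cnj (2 * cinner (neumann U (cnj (bfun z)) (\<iota> (J (axis j 1)))) (\<iota> (J (axis k 1)))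
    - cinner (\<iota> (J (axis j 1))) (\<iota> (J (axis k 1))))"
  using spec_form_Herglotz[OF is_spectral_measure_of[OF U] isometric_embeddingD(5)[OF unitary_betwD(1)[OF U]] z,
      of "\<iota> (J (axis k 1))" "\<iota> (J (axis j 1))"]
    cinner_commute[of "\<iota> (J (axis k 1))" "neumann U (cnj (bfun z)) (\<iota> (J (axis j 1)))"]
    cinner_commute[of "\<iota> (J (axis k 1))" "\<iota> (J (axis j 1))"]
  by (simp add: G_fun_def)

subsection \<open>Partial isometries\<close>

definition ocproj :: "'a::complex_hilbert set \<Rightarrow> 'a \<Rightarrow> 'a" where
  "ocproj M x = (SOME m. m \<in> M \<and> x - m \<in> orth M)"

context
  fixes M :: "'a::complex_hilbert set" assumes M: "csubspace M" "closed M"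
begin

lemma ocproj_in: "ocproj M x \<in> M" and ocproj_orth: "x - ocproj M x \<in> orth M"
  using someI_ex[of "\<lambda>m. m \<in> M \<and> x - m \<in> orth M"] orth_projection_exists[OF M, of x]
  by (auto simp: ocproj_def)

lemma ocproj_unique:
  assumes "m \<in> M" "x - m \<in> orth M" shows "ocproj M x = m"
proof -
  have a: "ocproj M x - m \<in> M" using ocproj_in assms(1) by (rule csubspaceD(4)[OF M(1)])
  have "(x - m) - (x - ocproj M x) \<in> orth M" using assms(2) ocproj_orth by (rule csubspaceD(4)[OF csubspace_orth])
  then have "ocproj M x - m \<in> orth M" by simp
  with a have "cinner (ocproj M x - m) (ocproj M x - m) = 0" by (rule orth_commute)
  then show ?thesis by (simp add: cinner_self_eq_0_iff)
qed

lemma ocproj_id: "m \<in> M \<Longrightarrow> ocproj M m = m"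
  using csubspaceD(1)[OF csubspace_orth[of M]] by (intro ocproj_unique) auto

lemma clinear_map_ocproj: "clinear_map (ocproj M)"
  unfolding clinear_map_def
proof (intro conjI allI)
  fix x y c
  have "(x - ocproj M x) + (y - ocproj M y) \<in> orth M"
    using ocproj_orth ocproj_orth by (rule csubspaceD(2)[OF csubspace_orth])
  then show "ocproj M (x + y) = ocproj M x + ocproj M y"
    by (intro ocproj_unique csubspaceD(2)[OF M(1)] ocproj_in) (simp add: algebra_simps)
  have "scaleC c (x - ocproj M x) \<in> orth M" using ocproj_orth by (rule csubspaceD(3)[OF csubspace_orth])
  then show "ocproj M (scaleC c x) = scaleC c (ocproj M x)"
    by (intro ocproj_unique csubspaceD(3)[OF M(1)] ocproj_in) (simp add: scaleC_diff_right)
qed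

lemma cinner_ocproj_right: "y \<in> M \<Longrightarrow> cinner y (ocproj M x) = cinner y x"
  using ocproj_orth[of x] by (auto simp: orth_def cinner_diff_right)

lemma cinner_ocproj_left: "y \<in> M \<Longrightarrow> cinner (ocproj M x) y = cinner x y"
  using cinner_ocproj_right[of y x] cinner_commute[of "ocproj M x" y] cinner_commute[of x y] by simp

lemma norm_ocproj_le: "norm (ocproj M x) \<le> norm x"
proof -
  have "cinner (ocproj M x) (x - ocproj M x) = 0" using ocproj_orth[of x] ocproj_in[of x] by (auto simp: orth_def)
  then have "(norm x)\<^sup>2 = (norm (ocproj M x))\<^sup>2 + (norm (x - ocproj M x))\<^sup>2"
    using norm_add_sq[of "ocproj M x" "x - ocproj M x"] by simp
  then have "(norm (ocproj M x))\<^sup>2 \<le> (norm x)\<^sup>2" by simp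
  then show ?thesis by (rule power2_le_imp_le) simp
qed

end

text \<open>An abstract Cayley transform: M and N stand for ran (B + i) and ran (B - i). V is a
  total function constrained only on M.\<close>

locale partial_isometry =
  fixes M N :: "'h::complex_hilbert set" and V :: "'h \<Rightarrow> 'h"
  assumes M: "csubspace M" "closed M" and N: "csubspace N" "closed N"
    and V_add: "x \<in> M \<Longrightarrow> y \<in> M \<Longrightarrow> V (x + y) = V x + V y"
    and V_scaleC: "x \<in> M \<Longrightarrow> V (scaleC c x) = scaleC c (V x)"
    and V_cinner: "x \<in> M \<Longrightarrow> y \<in> M \<Longrightarrow> cinner (V x) (V y) = cinner x y"
    and V_image: "V ` M = N"
begin

lemma V_in: "x \<in> M \<Longrightarrow> V x \<in> N"
  using V_image by blast

lemma V_norm: "x \<in> M \<Longrightarrow> norm (V x) = norm x"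
proof -
  assume "x \<in> M"
  then have "complex_of_real ((norm (V x))\<^sup>2) = complex_of_real ((norm x)\<^sup>2)"
    using V_cinner[of x x] by (simp only: cinner_self_norm)
  then show "norm (V x) = norm x" by (subst (asm) of_real_eq_iff) (simp add: power2_eq_iff_nonneg)
qed

lemma V_inj: "inj_on V M"
proof (rule inj_onI)
  fix x y assume xy: "x \<in> M" "y \<in> M" "V x = V y"
  have "V (x - y) = V x - V y"
    using V_add[of "x - y" y] xy csubspaceD(4)[OF M(1)] by simp
  then have "norm (x - y) = 0" using V_norm[of "x - y"] xy csubspaceD(4)[OF M(1)] by simp
  then show "x = y" by simp
qed

text \<open>V extended by 0 on the orthogonal complement of M, a contraction of the whole
  space.\<close>

definition Vt where "Vt h = V (ocproj M h)"

text \<open>The Hilbert space adjoint of \<open>Vt\<close>: the inverse of V on N, and 0 on the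
  orthogonal complement of N.\<close>

definition Vadj where "Vadj h = inv_into M V (ocproj N h)"

lemma Vadj_in: "Vadj h \<in> M" and V_Vadj: "V (Vadj h) = ocproj N h"
  using ocproj_in[OF N, of h] V_image by (auto simp: Vadj_def inv_into_into f_inv_into_f)

lemma Vadj_eq: "g \<in> M \<Longrightarrow> V g = ocproj N h \<Longrightarrow> Vadj h = g"
  using V_inj Vadj_in[of h] V_Vadj[of h] by (simp add: inj_on_eq_iff[symmetric] inj_on_def)

lemma ccontraction_Vt: "ccontraction Vt"
  unfolding ccontraction_def clinear_map_def
  by (simp add: Vt_def clinear_mapD[OF clinear_map_ocproj[OF M]] V_add V_scaleC V_norm ocproj_in[OF M] norm_ocproj_le[OF M])

lemma ccontraction_Vadj: "ccontraction Vadj"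
  unfolding ccontraction_def clinear_map_def
proof (intro conjI allI)
  fix x y c
  show "Vadj (x + y) = Vadj x + Vadj y"
    by (rule Vadj_eq) (simp_all add: csubspaceD(2)[OF M(1)] Vadj_in V_add V_Vadj clinear_mapD[OF clinear_map_ocproj[OF N]])
  show "Vadj (scaleC c x) = scaleC c (Vadj x)"
    by (rule Vadj_eq) (simp_all add: csubspaceD(3)[OF M(1)] Vadj_in V_scaleC V_Vadj clinear_mapD[OF clinear_map_ocproj[OF N]])
  show "norm (Vadj x) \<le> norm x"
    using norm_ocproj_le[OF N, of x] V_norm[OF Vadj_in, of x] by (simp add: V_Vadj)
qed

lemma cinner_Vt: "cinner (Vt x) y = cinner x (Vadj y)"
proof -
  have "cinner (Vt x) y = cinner (Vt x) (ocproj N y)"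
    by (simp add: Vt_def cinner_ocproj_right[OF N] V_in ocproj_in[OF M])
  also have "\<dots> = cinner (V (ocproj M x)) (V (Vadj y))" by (simp add: Vt_def V_Vadj)
  also have "\<dots> = cinner x (Vadj y)" by (simp add: V_cinner ocproj_in[OF M] Vadj_in cinner_ocproj_left[OF M])
  finally show ?thesis .
qed

lemma Vt_eq: "g \<in> M \<Longrightarrow> Vt g = V g"
  by (simp add: Vt_def ocproj_id[OF M])

text \<open>The orthogonal complement of ran (1 - zeta V). For the Cayley transform and zeta = cnj
  (b z) it is ker (B^* - z).\<close>

definition E where "E \<zeta> = orth {g - scaleC \<zeta> (V g) | g. g \<in> M}"

lemma cinner_shift: "cinner (x - scaleC \<zeta> (Vt x)) w = cinner x (w - scaleC (cnj \<zeta>) (Vadj w))"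
  by (simp add: cinner_simps cinner_Vt)

lemma E_iff: "w \<in> E \<zeta> \<longleftrightarrow> w - scaleC (cnj \<zeta>) (Vadj w) \<in> orth M"
proof -
  have "w \<in> E \<zeta> \<longleftrightarrow> (\<forall>g\<in>M. cinner (g - scaleC \<zeta> (Vt g)) w = 0)"
    by (auto simp: E_def orth_def Vt_eq)
  then show ?thesis unfolding cinner_shift by (simp add: orth_def)
qed

text \<open>Membership in \<open>E \<zeta>\<close> means that 1 - cnj zeta \<open>Vadj\<close> maps
  w into \<open>orth M\<close>, and this operator is invertible. One fixed space thus parametrises
  all the defect spaces.\<close>

lemma E_eq_neumann:
  assumes "cmod \<zeta> < 1" shows "E \<zeta> = neumann Vadj (cnj \<zeta>) ` orth M"
proof -
  have z: "cmod (cnj \<zeta>) < 1" using assms by simp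
  show ?thesis
  proof (intro equalityI subsetI)
    fix w assume "w \<in> E \<zeta>"
    then show "w \<in> neumann Vadj (cnj \<zeta>) ` orth M"
      by (intro image_eqI[where x = "w - scaleC (cnj \<zeta>) (Vadj w)"])
        (simp_all only: neumann_shift[OF ccontraction_Vadj z] E_iff)
  next
    fix w assume "w \<in> neumann Vadj (cnj \<zeta>) ` orth M"
    then show "w \<in> E \<zeta>" by (auto simp only: E_iff neumann_inverse[OF ccontraction_Vadj z])
  qed
qed

text \<open>The resolvent is injective and carries a basis of \<open>orth M\<close> to a basis.
  Every defect space in the upper half-plane thus has a basis indexed by 'n, as the choice of basis
  in \<open>livsic_char\<close> presumes.\<close>

lemma E_basis:
  fixes u :: "'n::finite \<Rightarrow> 'h"
  assumes u: "is_onb (orth M) u" and z: "cmod \<zeta> < 1"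
  shows "is_basis (E \<zeta>) (\<lambda>k. neumann Vadj (cnj \<zeta>) (u k))"
proof -
  have z': "cmod (cnj \<zeta>) < 1" using z by simp
  note l = clinear_map_neumann[OF ccontraction_Vadj z']
  have sum: "neumann Vadj (cnj \<zeta>) (\<Sum>j\<in>J. scaleC (c j) (u j)) = (\<Sum>j\<in>J. scaleC (c j) (neumann Vadj (cnj \<zeta>) (u j)))" for c J
    by (induction J rule: infinite_finite_induct) (simp_all add: clinear_mapD[OF l])
  have "\<forall>j. c j = 0" if "(\<Sum>j\<in>UNIV. scaleC (c j) (neumann Vadj (cnj \<zeta>) (u j))) = 0" for c
  proof
    fix k
    have 0: "(\<Sum>j\<in>UNIV. scaleC (c j) (u j)) = 0"
      using that neumann_eq_0_iff[OF ccontraction_Vadj z'] by (simp flip: sum)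
    have "c k = (\<Sum>j\<in>UNIV. if j = k then c j else 0)" by simp
    also have "\<dots> = cinner (\<Sum>j\<in>UNIV. scaleC (c j) (u j)) (u k)"
      unfolding cinner_sum_left cinner_scaleC_left using u by (intro sum.cong) (auto simp: is_onb_def)
    finally show "c k = 0" by (simp add: 0)
  qed
  moreover have "E \<zeta> = {\<Sum>j\<in>UNIV. scaleC (c j) (neumann Vadj (cnj \<zeta>) (u j)) |c. True}"
    unfolding E_eq_neumann[OF z] sum[symmetric] using u by (auto simp: is_onb_def)
  ultimately show ?thesis by (simp add: is_basis_def)
qed

text \<open>In effect ran (1 - zeta V) is closed. The resolvent k of r under \<open>Vt\<close> is
  orthogonal to every u in \<open>orth M\<close>, since <k, u> = <r, w> with w in
  \<open>E \<zeta>\<close> the resolvent of u; hence k lies in M, where \<open>Vt\<close> is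
  V.\<close>

lemma decompose_left:
  assumes z: "cmod \<zeta> < 1" and r: "\<And>w. w \<in> E \<zeta> \<Longrightarrow> cinner r w = 0"
  obtains g where "g \<in> M" "r = g - scaleC \<zeta> (V g)"
proof -
  define k where "k = neumann Vt \<zeta> r"
  have r': "r = k - scaleC \<zeta> (Vt k)" unfolding k_def by (rule neumann_inverse[OF ccontraction_Vt z, symmetric])
  have "cinner u k = 0" if u: "u \<in> orth M" for u
  proof -
    define w where "w = neumann Vadj (cnj \<zeta>) u"
    have "w \<in> E \<zeta>" using u by (auto simp: E_eq_neumann[OF z] w_def)
    then have "cinner k (w - scaleC (cnj \<zeta>) (Vadj w)) = 0"
      using r by (simp add: r' flip: cinner_shift)
    then have "cinner k u = 0"
      using neumann_inverse[OF ccontraction_Vadj, of "cnj \<zeta>" u] z by (simp add: w_def)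
    then show ?thesis using cinner_commute[of u k] by simp
  qed
  then have "k \<in> orth (orth M)" by (simp add: orth_def[of "orth M"])
  then have "k \<in> M" by (simp add: orth_orth[OF M])
  then show thesis using that r' by (simp add: Vt_eq)
qed

text \<open>If k is the resolvent of h under \<open>Vadj\<close>, then h = k - cnj zeta
  \<open>Vadj\<close> k, and the N-component of k is V (\<open>Vadj\<close> k). This works for every
  point of the disc.\<close>

lemma decompose_right:
  assumes z: "cmod \<zeta> < 1"
  obtains g j where "g \<in> M" "j \<in> orth N" "h = V g - scaleC (cnj \<zeta>) g + j"
proof
  define k where "k = neumann Vadj (cnj \<zeta>) h"
  have "h = k - scaleC (cnj \<zeta>) (Vadj k)"
    unfolding k_def by (rule neumann_inverse[OF ccontraction_Vadj, symmetric]) (simp add: z)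
  then show "h = V (Vadj k) - scaleC (cnj \<zeta>) (Vadj k) + (k - ocproj N k)" by (simp add: V_Vadj)
qed (rule Vadj_in, rule ocproj_orth[OF N])

text \<open>Isolates the dependence on the extension in one term on \<open>orth N\<close>. Since U
  extends V, the resolvent sends the image of g - zeta V g to the image of g; the resolvent of j is
  orthogonal to the image of V g' - cnj zeta g'.\<close>

lemma cinner_neumann_decompose:
  fixes \<iota> :: "'h \<Rightarrow> 'k::complex_hilbert"
  assumes i: "isometric_embedding \<iota>" and U: "unitary_betw U" and z: "cmod \<zeta> < 1"
    and ext: "\<And>x. x \<in> M \<Longrightarrow> U (\<iota> x) = \<iota> (V x)"
    and g: "g \<in> M" and j: "j \<in> orth N" and g': "g' \<in> M"
  shows "cinner (neumann U \<zeta> (\<iota> (g - scaleC \<zeta> (V g) + j))) (\<iota> (V g' - scaleC (cnj \<zeta>) g' + j'))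
    = cinner g (V g' - scaleC (cnj \<zeta>) g' + j') + cinner (neumann U \<zeta> (\<iota> j)) (\<iota> j')"
proof -
  note Uc = isometric_embeddingD(5)[OF unitary_betwD(1)[OF U]]
  note li = clinear_mapD[OF isometric_embeddingD(1)[OF i]]
  note ln = clinear_mapD[OF clinear_map_neumann[OF Uc z]]
  define F where "F = neumann U \<zeta> (\<iota> j)"
  have F: "F = \<iota> j + scaleC \<zeta> (U F)" unfolding F_def by (rule neumann_unfold[OF Uc z])
  have "neumann U \<zeta> (\<iota> (g - scaleC \<zeta> (V g) + j)) = \<iota> g + F"
    using neumann_shift[OF Uc z, of "\<iota> g"] ext[OF g] by (simp add: li ln F_def)
  \<comment> \<open>Expand F once as j + zeta U F: j is orthogonal to V g', and U is isometric with
    U g' = V g', so <F, V g'> = zeta <F, g'>.\<close>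
  moreover have "cinner F (\<iota> (V g' - scaleC (cnj \<zeta>) g')) = 0"
  proof -
    have "cinner F (\<iota> (V g')) = cinner (\<iota> j + scaleC \<zeta> (U F)) (\<iota> (V g'))"
      by (rule arg_cong[OF F])
    also have "\<dots> = cinner j (V g') + \<zeta> * cinner (U F) (U (\<iota> g'))"
      by (simp add: cinner_simps isometric_embeddingD(2)[OF i] ext[OF g'])
    also have "\<dots> = \<zeta> * cinner F (\<iota> g')"
      using orth_commute[OF V_in[OF g'] j] by (simp add: isometric_embeddingD(2)[OF unitary_betwD(1)[OF U]])
    finally show ?thesis by (simp add: li cinner_simps)
  qed
  ultimately show ?thesis by (simp add: li(1) cinner_add_left cinner_add_right F_def
        isometric_embeddingD(2)[OF i] flip: li(2,4))
qed

end

subsection \<open>Symmetric operators and the Livsic function\<close>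

lemma cmod_bfun_less_1:
  assumes "Im z > 0" shows "cmod (bfun z) < 1"
proof -
  have "(cmod (z - \<i>))\<^sup>2 < (cmod (z + \<i>))\<^sup>2"
    using assms by (simp only: cmod_power2) (simp add: power2_eq_square algebra_simps)
  then have "cmod (z - \<i>) < cmod (z + \<i>)" by (rule power2_less_imp_less) simp
  then show ?thesis unfolding bfun_def norm_divide by (subst divide_less_eq_1_pos) (auto intro: le_less_trans[OF norm_ge_zero])
qed

lemma is_onb_expand:
  fixes v :: "'n::finite \<Rightarrow> 'a::complex_hilbert"
  assumes v: "is_onb S v" and s: "s \<in> S"
  shows "s = (\<Sum>l\<in>UNIV. scaleC (cinner s (v l)) (v l))"
proof -
  obtain c where c: "s = (\<Sum>l\<in>UNIV. scaleC (c l) (v l))" using v s by (auto simp: is_onb_def)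
  have "cinner s (v l) = c l" for l
  proof -
    have "cinner s (v l) = (\<Sum>j\<in>UNIV. if j = l then c j else 0)"
      unfolding c cinner_sum_left cinner_scaleC_left using v by (intro sum.cong) (auto simp: is_onb_def)
    then show ?thesis by simp
  qed
  then show ?thesis using c by simp
qed

lemma fin_isometry_expand:
  assumes J: "fin_isometry_into J S"
  shows "J x = (\<Sum>k\<in>UNIV. scaleC (x $ k) (J (axis k 1)))"
proof -
  have add: "J (x + y) = J x + J y" and sc: "J (c *s x) = scaleC c (J x)" for x y c
    using J by (auto simp: fin_isometry_into_def)
  have 0: "J 0 = 0" using sc[of 0 0] by simp
  have "J (\<Sum>k\<in>I. (x $ k) *s axis k 1) = (\<Sum>k\<in>I. scaleC (x $ k) (J (axis k 1)))" for I
    by (induction I rule: infinite_finite_induct) (simp_all add: 0 add sc)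
  from this[of UNIV] show ?thesis by (simp add: basis_expansion)
qed

text \<open>A dimension count through matrices: the matrix A of J in the basis v is square, so
  \<open>A ** cadj_mat A = mat 1\<close> reverses, and this expresses each \<open>v l\<close>
  through the columns of J.\<close>

lemma fin_isometry_range:
  fixes J :: "complex^'n \<Rightarrow> 'a::complex_hilbert" and v :: "'n \<Rightarrow> 'a"
  assumes J: "fin_isometry_into J S" and v: "is_onb S v"
  shows "range J = S"
proof
  have sc: "J (c *s x) = scaleC c (J x)" and add: "J (x + y) = J x + J y" and JS: "J x \<in> S"
    and ci: "cinner (J x) (J y) = (\<Sum>i\<in>UNIV. x $ i * cnj (y $ i))" for x y c
    using J by (auto simp: fin_isometry_into_def)
  show "range J \<subseteq> S" using JS by auto
  have cs: "csubspace (range J)" unfolding csubspace_def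
  proof (intro conjI ballI allI)
    have "J 0 = 0" using sc[of 0 0] by simp
    then show "0 \<in> range J" by (metis rangeI)
    fix x y c assume "x \<in> range J" "y \<in> range J"
    then obtain a b where "x = J a" "y = J b" by auto
    then show "x + y \<in> range J" "scaleC c x \<in> range J" by (simp_all flip: add sc)
  qed
  define A where "A = (\<chi> k l. cinner (J (axis k 1)) (v l))"
  have Jk: "J (axis k 1) = (\<Sum>l\<in>UNIV. scaleC (A $ k $ l) (v l))" for k
    using is_onb_expand[OF v JS] by (simp add: A_def)
  have "A ** cadj_mat A = mat 1"
  proof (intro vec_eq_iff[THEN iffD2] allI)
    fix k m
    have "(A ** cadj_mat A) $ k $ m = (\<Sum>l\<in>UNIV. A $ k $ l * cnj (A $ m $ l))"
      by (simp add: matrix_matrix_mult_def cadj_mat_def)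
    also have "\<dots> = cinner (J (axis k 1)) (\<Sum>l\<in>UNIV. scaleC (A $ m $ l) (v l))"
      by (simp add: cinner_sum_right cinner_scaleC_right A_def mult.commute)
    also have "\<dots> = cinner (J (axis k 1)) (J (axis m 1))" by (simp only: Jk[symmetric])
    also have "\<dots> = (\<Sum>i\<in>UNIV. if i = k then (if k = m then 1 else 0) else 0)"
      unfolding ci by (intro sum.cong) (auto simp: axis_def)
    also have "\<dots> = mat 1 $ k $ m" by (simp add: mat_def)
    finally show "(A ** cadj_mat A) $ k $ m = mat 1 $ k $ m" .
  qed
  then have AA: "cadj_mat A ** A = mat 1" by (simp add: matrix_left_right_inverse)
  have vl: "v l \<in> range J" for l
  proof -
    have "(\<Sum>k\<in>UNIV. scaleC (cnj (A $ k $ l)) (J (axis k 1)))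
        = (\<Sum>m\<in>UNIV. \<Sum>k\<in>UNIV. scaleC (cnj (A $ k $ l) * A $ k $ m) (v m))"
      unfolding Jk scaleC_sum_right scaleC_scaleC by (rule sum.swap)
    also have "\<dots> = (\<Sum>m\<in>UNIV. scaleC ((cadj_mat A ** A) $ l $ m) (v m))"
    proof (rule sum.cong[OF refl])
      fix m
      have "(\<Sum>k\<in>I. scaleC (f k) x) = scaleC (\<Sum>k\<in>I. f k) x" for I :: "'n set" and f and x :: 'a
        by (induction I rule: infinite_finite_induct) (simp_all add: scaleC_add_left)
      then show "(\<Sum>k\<in>UNIV. scaleC (cnj (A $ k $ l) * A $ k $ m) (v m)) = scaleC ((cadj_mat A ** A) $ l $ m) (v m)"
        by (simp add: matrix_matrix_mult_def cadj_mat_def)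
    qed
    also have "\<dots> = (\<Sum>m\<in>UNIV. if m = l then v m else 0)"
      unfolding AA by (intro sum.cong) (auto simp: mat_def)
    finally have "v l = (\<Sum>k\<in>UNIV. scaleC (cnj (A $ k $ l)) (J (axis k 1)))" by simp
    also have "\<dots> \<in> range J" by (intro csubspaceD(6)[OF cs] csubspaceD(3)[OF cs] rangeI)
    finally show ?thesis .
  qed
  show "S \<subseteq> range J"
  proof
    fix s assume "s \<in> S"
    have "(\<Sum>l\<in>UNIV. scaleC (cinner s (v l)) (v l)) \<in> range J"
      by (intro csubspaceD(6)[OF cs] csubspaceD(3)[OF cs] vl)
    then show "s \<in> range J" using is_onb_expand[OF v \<open>s \<in> S\<close>] by simp
  qed
qed

section \<open>The Cayley transform of a closed symmetric operator\<close>

definition cayley :: "'h::complex_hilbert set \<Rightarrow> ('h \<Rightarrow> 'h) \<Rightarrow> 'h \<Rightarrow> 'h" where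
  "cayley D T g = (let x = (SOME x. x \<in> D \<and> T x + scaleC \<i> x = g) in T x - scaleC \<i> x)"

context
  fixes D :: "'h::complex_hilbert set" and T
  assumes lin: "lin_transf D T" and sym: "symmetric_op D T" and cl: "closed_op D T"
begin

lemma D_csubspace: "csubspace D"
  and T_add: "x \<in> D \<Longrightarrow> y \<in> D \<Longrightarrow> T (x + y) = T x + T y"
  and T_scaleC: "x \<in> D \<Longrightarrow> T (scaleC c x) = scaleC c (T x)"
  using lin by (auto simp: lin_transf_def)

lemma T_diff: "x \<in> D \<Longrightarrow> y \<in> D \<Longrightarrow> T (x - y) = T x - T y"
  using T_add[of "x - y" y] csubspaceD(4)[OF D_csubspace] by simp

lemma csubspace_ran_shift: "csubspace (ran_shift D T z)"
  unfolding csubspace_def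
proof (intro conjI ballI allI)
  have "T 0 = 0" using T_scaleC[of 0 0] csubspaceD(1)[OF D_csubspace] by simp
  then show "0 \<in> ran_shift D T z" using csubspaceD(1)[OF D_csubspace] by (force simp: ran_shift_def)
  fix x y c assume "x \<in> ran_shift D T z" "y \<in> ran_shift D T z"
  then obtain a b where a: "a \<in> D" "x = T a - scaleC z a" and b: "b \<in> D" "y = T b - scaleC z b"
    by (auto simp: ran_shift_def)
  have "x + y = T (a + b) - scaleC z (a + b)" using a b by (simp add: T_add scaleC_add_right)
  then show "x + y \<in> ran_shift D T z" using csubspaceD(2)[OF D_csubspace] a b by (auto simp: ran_shift_def)
  have "scaleC c x = T (scaleC c a) - scaleC z (scaleC c a)"
    using a by (simp add: T_scaleC scaleC_diff_right scaleC_scaleC mult.commute)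
  then show "scaleC c x \<in> ran_shift D T z" using csubspaceD(3)[OF D_csubspace] a by (auto simp: ran_shift_def)
qed

text \<open>Symmetry makes <Tx, x> real, so the cross term vanishes. Injectivity of T + i and
  closedness of both ranges rest on this identity.\<close>

lemma norm_shift_sq:
  assumes x: "x \<in> D" and z: "z = \<i> \<or> z = - \<i>"
  shows "(norm (T x - scaleC z x))\<^sup>2 = (norm (T x))\<^sup>2 + (norm x)\<^sup>2"
proof -
  have "cinner (T x) x = cnj (cinner (T x) x)"
    using sym x cinner_commute[of x "T x"] by (simp add: symmetric_op_def)
  then have "Im (cinner (T x) x) = 0" by (metis complex_cnj_cancel_iff Reals_cnj_iff complex_is_Real_iff)
  moreover have "cmod z = 1" using z by auto
  ultimately show ?thesis using z by (subst norm_diff_sq) (auto simp: norm_scaleC cinner_scaleC_right)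
qed

text \<open>By \<open>norm_shift_sq\<close>, if (T - z) x_n converges then x_n and T x_n are both
  Cauchy, and the closed graph contains their limit.\<close>

lemma closed_ran_shift:
  assumes z: "z = \<i> \<or> z = - \<i>"
  shows "closed (ran_shift D T z)"
proof (rule closed_sequential_limits[THEN iffD2], intro allI impI, elim conjE)
  fix y l assume y: "\<forall>n. y n \<in> ran_shift D T z" and l: "y \<longlonglongrightarrow> l"
  then obtain x where x: "\<And>n. x n \<in> D" "\<And>n. y n = T (x n) - scaleC z (x n)"
    unfolding ran_shift_def by simp metis
  have sq: "(norm (y m - y n))\<^sup>2 = (norm (T (x m) - T (x n)))\<^sup>2 + (norm (x m - x n))\<^sup>2" for m n
    using norm_shift_sq[OF csubspaceD(4)[OF D_csubspace x(1) x(1)] z, of m n]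
    by (simp add: x T_diff scaleC_diff_right algebra_simps)
  have le: "norm (x m - x n) \<le> norm (y m - y n)" "norm (T (x m) - T (x n)) \<le> norm (y m - y n)" for m n
    by (rule power2_le_imp_le; simp add: sq)+
  have C: "Cauchy y" using l by (rule LIMSEQ_imp_Cauchy)
  have "Cauchy x" using C le(1) unfolding Cauchy_iff by (meson le_less_trans)
  then obtain a where a: "x \<longlonglongrightarrow> a" using Cauchy_convergent_iff convergentD by blast
  have "Cauchy (\<lambda>n. T (x n))" using C le(2) unfolding Cauchy_iff by (meson le_less_trans)
  then obtain b where b: "(\<lambda>n. T (x n)) \<longlonglongrightarrow> b" using Cauchy_convergent_iff convergentD by blast
  have "(a, b) \<in> {(x, T x) | x. x \<in> D}"
    by (rule closed_sequentially[OF cl[unfolded closed_op_def] _ tendsto_Pair[OF a b]]) (use x in auto)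
  then have ab: "a \<in> D" "b = T a" by auto
  have "y \<longlonglongrightarrow> b - scaleC z a" unfolding x(2)[abs_def]
    by (intro tendsto_diff b tendsto_scaleC tendsto_const a)
  then have "l = b - scaleC z a" using l LIMSEQ_unique by blast
  then show "l \<in> ran_shift D T z" using ab by (auto simp: ran_shift_def)
qed

lemma cayley_eq:
  assumes x: "x \<in> D" shows "cayley D T (T x + scaleC \<i> x) = T x - scaleC \<i> x"
proof -
  have "y = x" if "y \<in> D \<and> T y + scaleC \<i> y = T x + scaleC \<i> x" for y
  proof -
    have "T (y - x) - scaleC (- \<i>) (y - x) = 0"
      using that x by (simp add: T_diff scaleC_diff_right scaleC_minus_left algebra_simps)
    then have "(norm (y - x))\<^sup>2 \<le> 0"
      using norm_shift_sq[of "y - x" "- \<i>"] that x csubspaceD(4)[OF D_csubspace]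
      by (simp add: sum_power2_eq_zero_iff)
    then show ?thesis by simp
  qed
  then have "(SOME y. y \<in> D \<and> T y + scaleC \<i> y = T x + scaleC \<i> x) = x"
    using x by (intro some_equality) blast+
  then show ?thesis by (simp add: cayley_def)
qed

lemma ran_shift_minus_i: "ran_shift D T (- \<i>) = {T x + scaleC \<i> x | x. x \<in> D}"
  by (simp add: ran_shift_def scaleC_minus_left)

lemma partial_isometry_cayley:
  "partial_isometry (ran_shift D T (- \<i>)) (ran_shift D T \<i>) (cayley D T)"
proof
  show "csubspace (ran_shift D T (- \<i>))" "csubspace (ran_shift D T \<i>)" by (rule csubspace_ran_shift)+
  show "closed (ran_shift D T (- \<i>))" "closed (ran_shift D T \<i>)" by (rule closed_ran_shift; simp)+
  show "cayley D T ` ran_shift D T (- \<i>) = ran_shift D T \<i>"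
  proof (intro equalityI subsetI)
    fix y assume "y \<in> cayley D T ` ran_shift D T (- \<i>)"
    then obtain x where "x \<in> D" "y = cayley D T (T x + scaleC \<i> x)" unfolding ran_shift_minus_i by blast
    then show "y \<in> ran_shift D T \<i>" by (auto simp: ran_shift_def cayley_eq)
  next
    fix y assume "y \<in> ran_shift D T \<i>"
    then obtain x where x: "x \<in> D" "y = T x - scaleC \<i> x" by (auto simp: ran_shift_def)
    show "y \<in> cayley D T ` ran_shift D T (- \<i>)"
      by (rule image_eqI[where x = "T x + scaleC \<i> x"]) (use x in \<open>auto simp: cayley_eq ran_shift_minus_i\<close>)
  qed
  fix g h c assume "g \<in> ran_shift D T (- \<i>)" "h \<in> ran_shift D T (- \<i>)"
  then obtain x y where x: "x \<in> D" "g = T x + scaleC \<i> x" and y: "y \<in> D" "h = T y + scaleC \<i> y"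
    by (auto simp: ran_shift_minus_i)
  have "g + h = T (x + y) + scaleC \<i> (x + y)" using x y by (simp add: T_add scaleC_add_right)
  then show "cayley D T (g + h) = cayley D T g + cayley D T h"
    using x y csubspaceD(2)[OF D_csubspace] by (simp only: cayley_eq) (simp add: T_add scaleC_add_right)
  have "scaleC c g = T (scaleC c x) + scaleC \<i> (scaleC c x)"
    using x by (simp add: T_scaleC scaleC_add_right scaleC_scaleC mult.commute)
  then show "cayley D T (scaleC c g) = scaleC c (cayley D T g)"
    using x csubspaceD(3)[OF D_csubspace]
    by (simp only: cayley_eq) (simp add: T_scaleC scaleC_diff_right scaleC_scaleC mult.commute)
  have "cinner (T x) y = cinner x (T y)" using sym x y by (simp add: symmetric_op_def)
  then show "cinner (cayley D T g) (cayley D T h) = cinner g h"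
    using x y by (simp add: cayley_eq cinner_simps algebra_simps)
qed

section \<open>Defect spaces and solvability near a boundary point\<close>

interpretation partial_isometry "ran_shift D T (- \<i>)" "ran_shift D T \<i>" "cayley D T"
  by (rule partial_isometry_cayley)

text \<open>With zeta = cnj (b z), applying 1 - zeta V to (T + i)x gives (1 - zeta)(T - cnj z)x, and
  1 - zeta is nonzero. Both spaces are complements of the same range.\<close>

lemma E_eq_defect:
  assumes z: "Im z > 0"
  shows "E (cnj (bfun z)) = defect D T z"
proof -
  define \<zeta> where "\<zeta> = cnj (bfun z)"
  have nz: "cnj z - \<i> \<noteq> 0" using z by (auto simp: complex_eq_iff)
  have c: "cinner (T x + scaleC \<i> x - scaleC \<zeta> (T x - scaleC \<i> x)) w = (1 - \<zeta>) * cinner (T x - scaleC (cnj z) x) w" for x w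
  proof -
    have "\<zeta> = (cnj z + \<i>) / (cnj z - \<i>)" by (simp add: \<zeta>_def bfun_def)
    then have "(1 + \<zeta>) * \<i> = (1 - \<zeta>) * (- cnj z)" using nz by (simp add: field_simps)
    from arg_cong[OF this, of "\<lambda>t. t * cinner x w"] show ?thesis by (simp add: cinner_simps algebra_simps)
  qed
  have "cmod \<zeta> < 1" using cmod_bfun_less_1[OF z] by (simp add: \<zeta>_def)
  then have n: "1 - \<zeta> \<noteq> 0" by auto
  have "w \<in> E \<zeta> \<longleftrightarrow> (\<forall>x\<in>D. cinner (T x + scaleC \<i> x - scaleC \<zeta> (T x - scaleC \<i> x)) w = 0)" for w
  proof -
    have "{g - scaleC \<zeta> (cayley D T g) |g. g \<in> ran_shift D T (- \<i>)}
        = (\<lambda>g. g - scaleC \<zeta> (cayley D T g)) ` (\<lambda>x. T x + scaleC \<i> x) ` D"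
      unfolding ran_shift_minus_i by blast
    then show ?thesis unfolding E_def orth_def by (simp add: cayley_eq)
  qed
  also have "\<dots> w \<longleftrightarrow> w \<in> defect D T z" for w
    unfolding c defect_def orth_def ran_shift_def using n by auto
  finally show ?thesis by (auto simp: \<zeta>_def)
qed

text \<open>Finding l in L with the same inner products against the w_j as h is a linear system with
  matrix A. The coefficients are conjugated because l enters the antilinear slot.\<close>

lemma decompose_if_det_nz:
  fixes w v :: "'n::finite \<Rightarrow> 'h"
  assumes w: "is_basis W w" and v: "is_onb L v"
    and det: "det (\<chi> j k. cinner (w j) (v k)) \<noteq> 0"
  shows "\<exists>l\<in>L. \<forall>x\<in>W. cinner (h - l) x = 0"
proof -
  define A where "A = (\<chi> j k. cinner (w j) (v k))"
  have "invertible A" using det by (simp add: A_def invertible_det_nz)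
  then obtain A' where A': "A ** A' = mat 1" by (auto simp: invertible_def)
  define c where "c = A' *v (\<chi> j. cinner (w j) h)"
  have Ac: "A *v c = (\<chi> j. cinner (w j) h)"
    by (simp add: c_def matrix_vector_mul_assoc A')
  define l where "l = (\<Sum>k\<in>UNIV. scaleC (cnj (c $ k)) (v k))"
  have "l \<in> L" using v by (auto simp: is_onb_def l_def)
  moreover have "cinner (h - l) (w j) = 0" for j
  proof -
    have "cinner (w j) l = (A *v c) $ j"
      by (simp add: l_def cinner_sum_right cinner_scaleC_right matrix_vector_mult_def A_def mult.commute)
    then have "cinner (w j) l = cinner (w j) h" by (simp add: Ac)
    then have "cnj (cinner (w j) l) = cnj (cinner (w j) h)" by simp
    then show ?thesis using cinner_commute[of l "w j"] cinner_commute[of h "w j"] by (simp add: cinner_diff_left)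
  qed
  then have "cinner (h - l) x = 0" if "x \<in> W" for x
    using that w by (auto simp: is_basis_def cinner_sum_right cinner_scaleC_right)
  ultimately show ?thesis by blast
qed

text \<open>A unitary boundary value has nonzero determinant, so the determinant of the Livsic
  function stays nonzero on a short vertical segment above x, and A(z) is a factor of that
  function.\<close>

lemma decompose_near_boundary:
  fixes u v :: "'n::finite \<Rightarrow> 'h"
  assumes inner: "livsic_inner TYPE('n) D T"
    and u: "is_onb (defect D T \<i>) u" and v: "is_onb (defect D T (- \<i>)) v"
  obtains x \<delta> where "\<delta> > 0"
    "\<And>y h. 0 < y \<Longrightarrow> y < \<delta> \<Longrightarrow> \<exists>l\<in>defect D T (- \<i>).
        \<forall>w\<in>defect D T (complex_of_real x + \<i> * complex_of_real y). cinner (h - l) w = 0"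
proof -
  let ?z = "\<lambda>x y. complex_of_real x + \<i> * complex_of_real y"
  have "AE x in lborel. \<exists>M. ((\<lambda>y. livsic_char D T u v (?z x y)) \<longlongrightarrow> M) (at_right 0) \<and> unitary_mat M"
    using inner u v by (simp add: livsic_inner_def)
  \<comment> \<open>Lebesgue measure is not the zero measure, so an almost everywhere property holds
    at some x.\<close>
  moreover have "ae_filter lborel \<noteq> bot" by (simp add: ae_filter_eq_bot_iff)
  ultimately obtain x M where M: "((\<lambda>y. livsic_char D T u v (?z x y)) \<longlongrightarrow> M) (at_right 0)" "unitary_mat M"
    using eventually_happens' by blast
  have "det M * det (cadj_mat M) = det (mat 1 :: complex^'n^'n)"
    using M(2) by (simp only: unitary_mat_def det_mul[symmetric])
  then have "det M \<noteq> 0" by auto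
  moreover have "((\<lambda>y. det (livsic_char D T u v (?z x y))) \<longlongrightarrow> det M) (at_right 0)"
    unfolding det_def by (intro tendsto_sum tendsto_mult tendsto_const tendsto_prod tendsto_vec_nth M)
  ultimately have "\<forall>\<^sub>F y in at_right 0. det (livsic_char D T u v (?z x y)) \<noteq> 0"
    by (intro tendsto_imp_eventually_ne)
  then obtain \<delta> where d: "\<delta> > 0" "\<And>y. 0 < y \<Longrightarrow> y < \<delta> \<Longrightarrow> det (livsic_char D T u v (?z x y)) \<noteq> 0"
    by (auto simp: eventually_at_right_field)
  show thesis
  proof (rule that[OF d(1)])
    fix y h assume y: "0 < y" "y < \<delta>"
    define z where "z = ?z x y"
    have z: "Im z > 0" using y by (simp add: z_def)
    define w where "w = (SOME w :: 'n \<Rightarrow> 'h. is_basis (defect D T z) w)"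
    \<comment> \<open>A witness for the choice defining w; the double conjugate arises because the
      point of the disc is already cnj (b z).\<close>
    have "is_basis (defect D T z) (\<lambda>k. neumann Vadj (cnj (cnj (bfun z))) (u k))"
      unfolding E_eq_defect[OF z, symmetric]
      by (rule E_basis) (use u cmod_bfun_less_1[OF z] in \<open>simp_all add: defect_def\<close>)
    then have w: "is_basis (defect D T z) w" unfolding w_def by (rule someI[where P = "is_basis (defect D T z)"])
    define A where "A = (\<chi> j k. cinner (w j) (v k))"
    define Bm where "Bm = (\<chi> j k. cinner (w j) (u k))"
    have "livsic_char D T u v z = map_matrix (\<lambda>c. bfun z * c) (matrix_inv Bm ** A)"
      by (simp add: livsic_char_def Let_def w_def A_def Bm_def)
    also have "\<dots> = mat (bfun z) ** (matrix_inv Bm ** A)"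
      by (simp add: vec_eq_iff matrix_matrix_mult_def mat_def map_matrix_def if_distrib[of "\<lambda>c. c * _"] cong: if_cong)
    finally have eq: "livsic_char D T u v z = mat (bfun z) ** (matrix_inv Bm ** A)" .
    have "det (livsic_char D T u v z) \<noteq> 0" unfolding z_def by (rule d(2)[OF y])
    then have "det (mat (bfun z) :: complex^'n^'n) * (det (matrix_inv Bm) * det A) \<noteq> 0"
      unfolding eq det_mul .
    \<comment> \<open>A nonzero product of determinants has no zero factor, whatever
      \<open>matrix_inv Bm\<close> is.\<close>
    then have "det A \<noteq> 0" by auto
    then show "\<exists>l\<in>defect D T (- \<i>). \<forall>w\<in>defect D T (?z x y). cinner (h - l) w = 0"
      using decompose_if_det_nz[OF w v] by (simp add: A_def z_def)
  qed
qed

end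

subsection \<open>Compressed resolvents and moments\<close>

lemma neumann_moments_sums:
  assumes "ccontraction U" "cmod \<zeta> < 1"
  shows "(\<lambda>m. cinner ((U ^^ m) x) y * \<zeta> ^ m) sums cinner (neumann U \<zeta> x) y"
  using cinner_summable_sums[OF summable_neumann[OF assms], of x y]
  by (simp add: neumann_def cinner_scaleC_left mult.commute)

text \<open>The difference of the two pairings is a power series on the disc that vanishes on Z. The
  identity theorem makes it vanish identically, hence all its coefficients.\<close>

lemma moments_eq_if_neumann_eq:
  assumes U1: "ccontraction U1" and U2: "ccontraction U2"
    and Z: "Z \<subseteq> ball 0 1" and \<xi>: "\<xi> \<in> ball 0 1" "\<xi> islimpt Z"
    and eq: "\<And>\<zeta>. \<zeta> \<in> Z \<Longrightarrow> cinner (neumann U1 \<zeta> x1) y1 = cinner (neumann U2 \<zeta> x2) y2"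
  shows "cinner ((U1 ^^ m) x1) y1 = cinner ((U2 ^^ m) x2) y2"
proof -
  define a where "a m = cinner ((U1 ^^ m) x1) y1 - cinner ((U2 ^^ m) x2) y2" for m
  define f where "f \<zeta> = cinner (neumann U1 \<zeta> x1) y1 - cinner (neumann U2 \<zeta> x2) y2" for \<zeta>
  have sums: "(\<lambda>m. a m * (\<zeta> - 0) ^ m) sums f \<zeta>" if "\<zeta> \<in> ball 0 1" for \<zeta>
    using sums_diff[OF neumann_moments_sums[OF U1, of \<zeta> x1 y1] neumann_moments_sums[OF U2, of \<zeta> x2 y2]] that
    by (simp add: a_def f_def left_diff_distrib)
  have hol: "f holomorphic_on ball 0 1" by (rule power_series_holomorphic[OF sums])
  have f0: "f \<zeta> = 0" if "\<zeta> \<in> ball 0 1" for \<zeta>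
    by (rule analytic_continuation[OF hol open_ball connected_ball Z \<xi> _ that]) (simp add: f_def eq)
  have "a m = 0"
  \<comment> \<open>Isolation of the zero at the origin is available for a nonzero coefficient of
    positive index; the constant coefficient is the value at 0.\<close>
  proof (cases "m = 0")
    case True
    have "(\<lambda>m. a m * 0 ^ m) sums f 0" using sums[of 0] unfolding diff_zero by simp
    then have "a 0 = f 0" using powser_sums_zero[of a] sums_unique2 by blast
    then show ?thesis using True f0 by simp
  next
    case False
    show ?thesis
    proof (rule ccontr)
      assume am: "a m \<noteq> 0"
      obtain s where s: "0 < s" "\<And>z. z \<in> cball 0 s - {0} \<Longrightarrow> f z \<noteq> 0"
      proof (rule powser_0_nonzero[where \<xi> = 0 and f = f and r = 1 and a = a and m = m])
        show "(\<lambda>n. a n * (z - 0) ^ n) sums f z" if "cmod (z - 0) < 1" for z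
          by (rule sums) (use that in simp)
        show "f 0 = 0" by (rule f0) simp
      qed (use False am in simp_all)
      have "complex_of_real (min s (1/2)) \<in> cball 0 s - {0}" using s(1) by auto
      moreover have "complex_of_real (min s (1/2)) \<in> ball 0 1" using s(1) by auto
      ultimately show False using s(2) f0 by blast
    qed
  qed
  then show ?thesis by (simp add: a_def)
qed

section \<open>The matrix function G and its Cayley transform\<close>

lemma clinear_map_sum:
  "clinear_map f \<Longrightarrow> f (\<Sum>i\<in>I. scaleC (c i) (x i)) = (\<Sum>i\<in>I. scaleC (c i) (f (x i)))"
  by (induction I rule: infinite_finite_induct) (simp_all add: clinear_mapD)

context
  fixes J :: "complex^'n \<Rightarrow> 'h::complex_hilbert" and \<iota> :: "'h \<Rightarrow> 'k::complex_hilbert"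
    and U :: "'k \<Rightarrow> 'k" and S
  assumes J: "fin_isometry_into J S" and i: "isometric_embedding \<iota>" and U: "unitary_betw U"
begin

lemma Uc: "ccontraction U"
  by (rule isometric_embeddingD(5)[OF unitary_betwD(1)[OF U]])

lemma cinner_neumann_expand:
  assumes "cmod \<zeta> < 1"
  shows "cinner (neumann U \<zeta> (\<iota> (J x))) (\<iota> (J y))
    = (\<Sum>k\<in>UNIV. \<Sum>j\<in>UNIV. cnj (y $ k) * (x $ j * cinner (neumann U \<zeta> (\<iota> (J (axis j 1)))) (\<iota> (J (axis k 1)))))"
proof -
  note l = clinear_map_sum[OF isometric_embeddingD(1)[OF i]]
    clinear_map_sum[OF clinear_map_neumann[OF Uc assms]]
  show ?thesis
    unfolding fin_isometry_expand[OF J, of x] fin_isometry_expand[OF J, of y] l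
    by (simp add: cinner_sum_left cinner_sum_right cinner_scaleC_left cinner_scaleC_right sum_distrib_left)
qed

text \<open>The vectors J e_j are orthonormal and the embedding keeps them so. Adding the identity
  cancels the subtracted Gram matrix in the Herglotz formula and leaves the bare resolvent.\<close>

lemma G_plus_one:
  assumes z: "Im z > 0"
  shows "(G_fun J \<iota> U z + mat 1) $ j $ k
    = cnj (2 * cinner (neumann U (cnj (bfun z)) (\<iota> (J (axis j 1)))) (\<iota> (J (axis k 1))))"
proof -
  have "cinner (\<iota> (J (axis j 1))) (\<iota> (J (axis k 1))) = (\<Sum>i\<in>UNIV. axis j 1 $ i * cnj (axis k 1 $ i))"
    using J by (simp add: isometric_embeddingD(2)[OF i] fin_isometry_into_def)
  also have "\<dots> = (\<Sum>i\<in>UNIV. if i = j then (if j = k then 1 else 0) else 0)"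
    by (intro sum.cong) (auto simp: axis_def)
  also have "\<dots> = mat 1 $ j $ k" by (simp add: mat_def)
  finally show ?thesis
    by (simp add: G_fun_eq_neumann[OF U cmod_bfun_less_1[OF z]]) (simp add: mat_def)
qed

text \<open>A kernel vector c would make the pairing of J c with its own resolvent zero, against
  positivity of its real part.\<close>

lemma invertible_G_plus_one:
  assumes z: "Im z > 0"
  shows "invertible (G_fun J \<iota> U z + mat 1)"
proof -
  define \<zeta> where "\<zeta> = cnj (bfun z)"
  have z': "cmod \<zeta> < 1" using cmod_bfun_less_1[OF z] by (simp add: \<zeta>_def)
  have "c = 0" if c: "(G_fun J \<iota> U z + mat 1) *v c = 0" for c
  proof -
    \<comment> \<open>The entries of G + 1 are conjugates of twice the resolvent entries, which
      accounts for \<open>cnj\<close> and the division by 2.\<close>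
    have "cinner (neumann U \<zeta> (\<iota> (J c))) (\<iota> (J c)) = (\<Sum>j\<in>UNIV. c $ j * cnj (((G_fun J \<iota> U z + mat 1) *v c) $ j) / 2)"
      unfolding matrix_vector_mult_def vec_lambda_beta G_plus_one[OF z] \<zeta>_def[symmetric]
      by (subst cinner_neumann_expand[OF z'], subst sum.swap) (intro sum.cong refl, simp add: sum_distrib_left sum_divide_distrib mult_ac)
    then have "cinner (neumann U \<zeta> (\<iota> (J c))) (\<iota> (J c)) = 0" by (simp add: c)
    then have "\<iota> (J c) = 0" using Re_cinner_neumann_pos[OF Uc z', of "\<iota> (J c)"] by (cases "\<iota> (J c) = 0") simp_all
    then have "cinner (J c) (J c) = 0" using isometric_embeddingD(2)[OF i, of "J c" "J c"] by simp
    then have "(\<Sum>i\<in>UNIV. complex_of_real ((cmod (c $ i))\<^sup>2)) = 0"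
      using J unfolding fin_isometry_into_def by (simp only: complex_norm_square)
    then have "(\<Sum>i\<in>UNIV. (cmod (c $ i))\<^sup>2) = 0" by (simp only: of_real_sum[symmetric] of_real_eq_0_iff)
    then show "c = 0" by (simp add: sum_nonneg_eq_0_iff vec_eq_iff)
  qed
  then show ?thesis by (simp add: invertible_left_inverse matrix_left_invertible_ker)
qed

end

lemma matrix_inv_cancel:
  fixes A :: "complex^'n^'n"
  assumes "invertible A"
  shows "A ** matrix_inv A = mat 1" "matrix_inv A ** A = mat 1"
  using someI_ex[OF assms[unfolded invertible_def]] by (simp_all add: matrix_inv_def)

text \<open>(G - 1)(G + 1)^{-1} = 1 - 2 (G + 1)^{-1}, so equal Cayley transforms have equal inverses
  of G + 1.\<close>

lemma cayley_matrix_inj: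
  fixes G1 G2 :: "complex^'n^'n"
  assumes i1: "invertible (G1 + mat 1)" and i2: "invertible (G2 + mat 1)"
    and eq: "(G1 - mat 1) ** matrix_inv (G1 + mat 1) = (G2 - mat 1) ** matrix_inv (G2 + mat 1)"
  shows "G1 = G2"
proof -
  have e: "((G - mat 1) ** matrix_inv (G + mat 1)) $ i $ j = mat 1 $ i $ j - 2 * matrix_inv (G + mat 1) $ i $ j"
    if "invertible (G + mat 1)" for G :: "complex^'n^'n" and i j
  proof -
    have "(G - mat 1) ** X = (G + mat 1) ** X - mat 2 ** X" for X :: "complex^'n^'n"
    proof -
      have "(G - mat 1) $ i $ k = (G + mat 1) $ i $ k - mat 2 $ i $ k" for i k by (simp add: mat_def)
      then show ?thesis
        by (simp only: vec_eq_iff matrix_matrix_mult_def vec_lambda_beta vector_minus_component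
            left_diff_distrib sum_subtractf) simp
    qed
    moreover have "(mat 2 ** X) $ i $ j = 2 * X $ i $ j" for X :: "complex^'n^'n"
      by (simp add: matrix_matrix_mult_def mat_def if_distrib[of "\<lambda>c. c * _"] cong: if_cong)
    ultimately show ?thesis by (simp add: matrix_inv_cancel(1)[OF that])
  qed
  have "matrix_inv (G1 + mat 1) $ i $ j = matrix_inv (G2 + mat 1) $ i $ j" for i j
    using e[OF i1, of i j] e[OF i2, of i j] eq by simp
  then have inv: "matrix_inv (G1 + mat 1) = matrix_inv (G2 + mat 1)" by (simp add: vec_eq_iff)
  have "G1 + mat 1 = (G1 + mat 1) ** (matrix_inv (G2 + mat 1) ** (G2 + mat 1))"
    by (simp add: matrix_inv_cancel(2)[OF i2])
  also have "\<dots> = ((G1 + mat 1) ** matrix_inv (G1 + mat 1)) ** (G2 + mat 1)"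
    by (simp add: inv matrix_mul_assoc)
  also have "\<dots> = G2 + mat 1" by (simp add: matrix_inv_cancel(1)[OF i1])
  finally show ?thesis by simp
qed

subsection \<open>Intertwining unitaries\<close>

text \<open>The future graph of W, kept as a relation so that W need not be defined on a dense span
  and then extended. The product carries only a real vector space structure here, so complex scaling
  is a separate clause; invariance under the inverses makes the projections reducing.\<close>

definition intertwining_graph ::
  "('a::complex_hilbert \<Rightarrow> 'a) \<Rightarrow> ('b::complex_hilbert \<Rightarrow> 'b) \<Rightarrow> ('a \<times> 'b) set \<Rightarrow> bool" where
  "intertwining_graph U1 U2 G \<longleftrightarrow> closed G \<and> subspace G
    \<and> (\<forall>x y x' y'. (x, y) \<in> G \<longrightarrow> (x', y') \<in> G \<longrightarrow> cinner x x' = cinner y y')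
    \<and> (\<forall>x y c. (x, y) \<in> G \<longrightarrow> (scaleC c x, scaleC c y) \<in> G)
    \<and> (\<forall>x y. (x, y) \<in> G \<longrightarrow> (U1 x, U2 y) \<in> G \<and> (inv U1 x, inv U2 y) \<in> G)"

lemma intertwining_graph_swap:
  fixes G :: "('a::complex_hilbert \<times> 'b::complex_hilbert) set"
  assumes "intertwining_graph U1 U2 G"
  shows "intertwining_graph U2 U1 (prod.swap -` G)"
proof -
  have "closed (prod.swap -` G)"
    using assms continuous_on_swap[of UNIV] continuous_on_closed_vimage[of UNIV prod.swap]
    by (auto simp: intertwining_graph_def)
  moreover have "subspace (prod.swap -` G)"
  proof (rule linear_subspace_vimage)
    show "linear (prod.swap :: 'b \<times> 'a \<Rightarrow> 'a \<times> 'b)" by (rule linearI) (simp_all add: prod_eq_iff)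
    show "subspace G" using assms by (simp add: intertwining_graph_def)
  qed
  ultimately show ?thesis using assms by (auto simp: intertwining_graph_def)
qed

text \<open>The first projection of the graph is a closed reducing subspace containing H, so
  minimality of the extension makes it everything.\<close>

lemma intertwining_graph_fst:
  assumes G: "intertwining_graph U1 U2 G" and \<iota>: "\<And>h. (\<iota>1 h, \<iota>2 h) \<in> G" and ext: "in_Ext D T \<iota>1 U1"
  shows "\<exists>y. (x, y) \<in> G"
proof -
  have cl: "closed G" and sub: "subspace G"
    and ip: "\<And>x y x' y'. (x, y) \<in> G \<Longrightarrow> (x', y') \<in> G \<Longrightarrow> cinner x x' = cinner y y'"
    and sc: "\<And>x y c. (x, y) \<in> G \<Longrightarrow> (scaleC c x, scaleC c y) \<in> G"
    and UG: "\<And>x y. (x, y) \<in> G \<Longrightarrow> (U1 x, U2 y) \<in> G" "\<And>x y. (x, y) \<in> G \<Longrightarrow> (inv U1 x, inv U2 y) \<in> G"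
    using G by (auto simp: intertwining_graph_def)
  have U1: "unitary_betw U1" using ext by (simp add: in_Ext_def)
  let ?M = "fst ` G"
  have "csubspace ?M" unfolding csubspace_def
  proof (intro conjI ballI allI)
    show "0 \<in> ?M" using subspace_0[OF sub] by (force simp: zero_prod_def)
    fix x y c assume "x \<in> ?M" "y \<in> ?M"
    then obtain a b where "(x, a) \<in> G" "(y, b) \<in> G" by auto
    then show "x + y \<in> ?M" "scaleC c x \<in> ?M"
      using subspace_add[OF sub, of "(x, a)" "(y, b)"] sc[of x a c] by force+
  qed
  moreover have "closed ?M"
  proof (rule closed_sequential_limits[THEN iffD2], intro allI impI, elim conjE)
    fix f l assume "\<forall>n. f n \<in> ?M" and l: "f \<longlonglongrightarrow> l"
    then have "\<forall>n. \<exists>k. (f n, k) \<in> G" by fastforce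
    then obtain g where g: "\<And>n. (f n, g n) \<in> G" by metis
    \<comment> \<open>Isometry of the relation makes the second coordinates Cauchy as well, which is
      why the projection is closed.\<close>
    have "norm (g m - g n) = norm (f m - f n)" for m n
    proof -
      have "(f m - f n, g m - g n) \<in> G" using subspace_diff[OF sub g g, of m n] by simp
      then have "complex_of_real ((norm (f m - f n))\<^sup>2) = complex_of_real ((norm (g m - g n))\<^sup>2)"
        using ip by (simp only: cinner_self_norm[symmetric])
      then show ?thesis by (subst (asm) of_real_eq_iff) (simp add: power2_eq_iff_nonneg)
    qed
    then have "Cauchy g" using LIMSEQ_imp_Cauchy[OF l] by (simp add: Cauchy_iff)
    then obtain k where "g \<longlonglongrightarrow> k" using Cauchy_convergent_iff convergentD by blast
    then have "(\<lambda>n. (f n, g n)) \<longlonglongrightarrow> (l, k)" by (intro tendsto_Pair l)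
    then have "(l, k) \<in> G" using closed_sequentially[OF cl, of "\<lambda>n. (f n, g n)"] g by simp
    then show "l \<in> ?M" by force
  qed
  moreover have "reduces U1 ?M" unfolding reduces_def
  proof
    show "U1 ` ?M \<subseteq> ?M" using UG(1) by force
    \<comment> \<open>Invariance under the inverse of U1, its adjoint, is what keeps the orthogonal
      complement invariant.\<close>
    have inv: "inv U1 x \<in> ?M" if "x \<in> ?M" for x using UG(2) that by force
    show "U1 ` orth ?M \<subseteq> orth ?M"
    proof
      fix y assume "y \<in> U1 ` orth ?M"
      then obtain w where w: "w \<in> orth ?M" "y = U1 w" by auto
      have "cinner x y = 0" if "x \<in> ?M" for x
      proof -
        have "cinner (U1 w) x = cinner w (inv U1 x)" by (rule unitary_betwD(6)[OF U1])
        also have "\<dots> = 0" using inv[OF that] w(1) by (rule orth_commute)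
        finally show ?thesis using w(2) cinner_commute[of x y] by simp
      qed
      then show "y \<in> orth ?M" by (simp add: orth_def)
    qed
  qed
  moreover have "range \<iota>1 \<subseteq> ?M" using \<iota> by force
  ultimately have "?M = UNIV" using ext by (simp add: in_Ext_def)
  then have "x \<in> ?M" by simp
  then show ?thesis by force
qed

text \<open>Isometry makes the relation single-valued: a pair (0, d) has |d| = 0. Minimality of U1
  makes W total, and minimality of U2, through the swapped graph, makes it onto.\<close>

lemma intertwining_unitary_if_graph:
  assumes G: "intertwining_graph U1 U2 G" and \<iota>: "\<And>h. (\<iota>1 h, \<iota>2 h) \<in> G"
    and ext1: "in_Ext D T \<iota>1 U1" and ext2: "in_Ext D T \<iota>2 U2"
  shows "\<exists>W. unitary_betw W \<and> (\<forall>h. W (\<iota>1 h) = \<iota>2 h) \<and> W \<circ> U1 = U2 \<circ> W"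
proof -
  have sub: "subspace G"
    and ip: "\<And>x y x' y'. (x, y) \<in> G \<Longrightarrow> (x', y') \<in> G \<Longrightarrow> cinner x x' = cinner y y'"
    and sc: "\<And>x y c. (x, y) \<in> G \<Longrightarrow> (scaleC c x, scaleC c y) \<in> G"
    and UG: "\<And>x y. (x, y) \<in> G \<Longrightarrow> (U1 x, U2 y) \<in> G"
    using G by (auto simp: intertwining_graph_def)
  obtain W where W: "\<And>x. (x, W x) \<in> G"
    using intertwining_graph_fst[OF G \<iota> ext1] by metis
  have uniq: "W x = y" if "(x, y) \<in> G" for x y
  proof -
    have "(0, W x - y) \<in> G" using subspace_diff[OF sub W[of x] that] by simp
    from ip[OF this this] show ?thesis using cinner_self_eq_0_iff[of "W x - y"] by simp
  qed
  have "W (x + y) = W x + W y" for x y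
    using subspace_add[OF sub W[of x] W[of y]] by (intro uniq) simp
  moreover have "W (scaleC c x) = scaleC c (W x)" for c x by (intro uniq sc W)
  moreover have "cinner (W x) (W y) = cinner x y" for x y using ip[OF W W] by simp
  moreover have "surj W"
  proof (rule surjI)
    fix y
    show "W (SOME x. (x, y) \<in> G) = y"
    proof (rule uniq, rule someI_ex)
      show "\<exists>x. (x, y) \<in> G"
        using intertwining_graph_fst[OF intertwining_graph_swap[OF G] _ ext2, of \<iota>1 y] \<iota> by simp
    qed
  qed
  moreover have "W (\<iota>1 h) = \<iota>2 h" for h by (rule uniq[OF \<iota>])
  moreover have "W (U1 x) = U2 (W x)" for x by (rule uniq[OF UG[OF W]])
  ultimately show ?thesis
    by (intro exI[of _ W]) (auto simp: unitary_betw_def isometric_embedding_def clinear_map_def)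
qed

section \<open>Closed spans and inverse powers of a unitary\<close>

lemma closure_span_subset:
  fixes S :: "'a::real_normed_vector set"
  shows "S \<subseteq> C \<Longrightarrow> subspace C \<Longrightarrow> closed C \<Longrightarrow> closure (span S) \<subseteq> C"
  by (intro closure_minimal span_minimal)

lemma funpow_inv_unitary:
  fixes U :: "'k::complex_hilbert \<Rightarrow> 'k"
  assumes "unitary_betw U"
  shows "(U ^^ n) ((inv U ^^ n) x) = x"
  by (induction n arbitrary: x) (simp_all add: unitary_betwD(4)[OF assms] funpow_swap1[of U])

text \<open>Applying the power n + n' of U to both entries trades inverse powers for positive ones,
  so moments with natural exponents suffice.\<close>

lemma cinner_funpow_inv_unitary:
  fixes U :: "'k::complex_hilbert \<Rightarrow> 'k"
  assumes U: "unitary_betw U"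
  shows "cinner ((inv U ^^ n) x) ((inv U ^^ n') y) = cinner ((U ^^ n') x) ((U ^^ n) y)"
proof -
  have "cinner ((inv U ^^ n) x) ((inv U ^^ n') y)
      = cinner ((U ^^ (n' + n)) ((inv U ^^ n) x)) ((U ^^ (n + n')) ((inv U ^^ n') y))"
    by (simp only: cinner_funpow[OF unitary_betwD(1)[OF U]] add.commute[of n' n])
  then show ?thesis by (simp add: funpow_add funpow_inv_unitary[OF U])
qed

lemma clinear_map_funpow: "clinear_map f \<Longrightarrow> clinear_map (f ^^ n)" for f :: "'k::complex_hilbert \<Rightarrow> 'k"
  by (induction n) (simp_all add: clinear_map_def)

lemma subspace_closure:
  fixes S :: "'a::real_normed_vector set"
  assumes S: "subspace S" shows "subspace (closure S)"
  unfolding subspace_def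
proof (intro conjI ballI allI)
  show "0 \<in> closure S" using subspace_0[OF S] closure_subset by blast
  fix x y c assume "x \<in> closure S" "y \<in> closure S"
  then obtain f g where fg: "\<And>n. f n \<in> S" "\<And>n. g n \<in> S" "f \<longlonglongrightarrow> x" "g \<longlonglongrightarrow> y"
    unfolding closure_sequential by blast
  show "x + y \<in> closure S" unfolding closure_sequential
    using fg by (intro exI[of _ "\<lambda>n. f n + g n"]) (auto intro: subspace_add[OF S] tendsto_add)
  show "c *\<^sub>R x \<in> closure S" unfolding closure_sequential
    using fg by (intro exI[of _ "\<lambda>n. c *\<^sub>R f n"]) (auto intro: subspace_scale[OF S] tendsto_scaleR tendsto_const)
qed

lemma closure_span_invariant:
  fixes S :: "'a::real_normed_vector set"
  assumes f: "bounded_linear f" and S: "\<And>p. p \<in> S \<Longrightarrow> f p \<in> S" and p: "p \<in> closure (span S)"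
  shows "f p \<in> closure (span S)"
proof -
  have "closure (span S) \<subseteq> f -` closure (span S)"
  proof (rule closure_span_subset)
    show "S \<subseteq> f -` closure (span S)" using S closure_subset[of "span S"] span_superset[of S] by blast
    show "subspace (f -` closure (span S))"
      by (intro linear_subspace_vimage bounded_linear.linear[OF f] subspace_closure subspace_span)
    show "closed (f -` closure (span S))"
      by (rule continuous_closed_vimage[OF closed_closure linear_continuous_at[OF f]])
  qed
  then show ?thesis using p by blast
qed

text \<open>The graph is the closed span of the pairs formed by the same word in U and its inverse
  applied to the two copies of h; equal moments make the pairing isometric on these
  generators.\<close>

lemma intertwining_unitary_if_moments_eq:
  fixes \<iota>1 :: "'h::complex_hilbert \<Rightarrow> 'k1::complex_hilbert" and \<iota>2 :: "'h \<Rightarrow> 'k2::complex_hilbert"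
  assumes ext1: "in_Ext D T \<iota>1 U1" and ext2: "in_Ext D T \<iota>2 U2"
    and eq: "\<And>m h h'. cinner ((U1 ^^ m) (\<iota>1 h)) (\<iota>1 h') = cinner ((U2 ^^ m) (\<iota>2 h)) (\<iota>2 h')"
  shows "\<exists>W. unitary_betw W \<and> (\<forall>h. W (\<iota>1 h) = \<iota>2 h) \<and> W \<circ> U1 = U2 \<circ> W"
proof (rule intertwining_unitary_if_graph[OF _ _ ext1 ext2])
  have U1: "unitary_betw U1" and U2: "unitary_betw U2" and i1: "isometric_embedding \<iota>1" and i2: "isometric_embedding \<iota>2"
    using ext1 ext2 by (auto simp: in_Ext_def)
  \<comment> \<open>Two natural exponents in place of one integer: the generators may repeat, but U
    and its inverse then act by shifting an index.\<close>
  define s where "s n m h = ((inv U1 ^^ n) ((U1 ^^ m) (\<iota>1 h)), (inv U2 ^^ n) ((U2 ^^ m) (\<iota>2 h)))" for n m h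
  define S where "S = {s n m h | n m h. True}"
  define G where "G = closure (span S)"
  have sS: "s n m h \<in> S" for n m h by (auto simp: S_def)
  have SG: "S \<subseteq> G" unfolding G_def using closure_subset[of "span S"] span_superset[of S] by blast
  have moments: "cinner ((U1 ^^ p) (\<iota>1 h)) ((U1 ^^ q) (\<iota>1 h')) = cinner ((U2 ^^ p) (\<iota>2 h)) ((U2 ^^ q) (\<iota>2 h'))" for p q h h'
  proof -
    have le: "cinner ((U1 ^^ p) (\<iota>1 h)) ((U1 ^^ q) (\<iota>1 h')) = cinner ((U2 ^^ p) (\<iota>2 h)) ((U2 ^^ q) (\<iota>2 h'))"
      if "q \<le> p" for p q h h'
      using that by (simp add: cinner_funpow_shift unitary_betwD(1)[OF U1] unitary_betwD(1)[OF U2] eq)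
    show ?thesis
    proof (cases "q \<le> p")
      case False
      then show ?thesis
        using le[of p q h' h] cinner_commute[of "(U1 ^^ p) (\<iota>1 h)" "(U1 ^^ q) (\<iota>1 h')"]
          cinner_commute[of "(U2 ^^ p) (\<iota>2 h)" "(U2 ^^ q) (\<iota>2 h')"] by simp
    qed (rule le)
  qed
  have ipS: "cinner (fst p) (fst q) = cinner (snd p) (snd q)" if "p \<in> S" "q \<in> S" for p q
  proof -
    have "cinner ((U1 ^^ n') ((U1 ^^ m) (\<iota>1 h))) ((U1 ^^ n) ((U1 ^^ m') (\<iota>1 h')))
        = cinner ((U2 ^^ n') ((U2 ^^ m) (\<iota>2 h))) ((U2 ^^ n) ((U2 ^^ m') (\<iota>2 h')))" for n n' m m' h h'
      using moments[of "n' + m" h "n + m'" h'] by (simp add: funpow_add)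
    then show ?thesis
      using that by (auto simp: S_def s_def cinner_funpow_inv_unitary[OF U1] cinner_funpow_inv_unitary[OF U2])
  qed
  have zero_set: "subspace {p. f p = 0} \<and> closed {p. f p = 0}" if "bounded_linear f" for f :: "'k1 \<times> 'k2 \<Rightarrow> complex"
    using that by (intro conjI linear_subspace_kernel bounded_linear.linear closed_Collect_eq linear_continuous_on continuous_on_const)
  have bl1: "bounded_linear (\<lambda>p. cinner (fst p) (fst q) - cinner (snd p) (snd q))" for q :: "'k1 \<times> 'k2"
    by (intro bounded_linear_sub bounded_linear_compose[OF bounded_bilinear.bounded_linear_left[OF bounded_bilinear_cinner]]
        bounded_linear_fst bounded_linear_snd)
  have bl2: "bounded_linear (\<lambda>q. cinner (fst p) (fst q) - cinner (snd p) (snd q))" for p :: "'k1 \<times> 'k2"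
    by (intro bounded_linear_sub bounded_linear_compose[OF bounded_bilinear.bounded_linear_right[OF bounded_bilinear_cinner]]
        bounded_linear_fst bounded_linear_snd)
  \<comment> \<open>The identity passes from generators to the closed span one slot at a time, each
    time as the kernel of a bounded real-linear map.\<close>
  have ip1: "cinner (fst p) (fst q) - cinner (snd p) (snd q) = 0" if "p \<in> G" "q \<in> S" for p q
  proof -
    have "G \<subseteq> {p. cinner (fst p) (fst q) - cinner (snd p) (snd q) = 0}"
      unfolding G_def using zero_set[OF bl1[of q]] ipS \<open>q \<in> S\<close> by (intro closure_span_subset) auto
    then show ?thesis using that by blast
  qed
  have ip2: "cinner (fst p) (fst q) - cinner (snd p) (snd q) = 0" if "p \<in> G" "q \<in> G" for p q
  proof -
    have "closure (span S) \<subseteq> {q. cinner (fst p) (fst q) - cinner (snd p) (snd q) = 0}"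
      using zero_set[OF bl2[of p]] ip1[OF \<open>p \<in> G\<close>] by (intro closure_span_subset) auto
    then show ?thesis using that unfolding G_def by blast
  qed
  have pair: "bounded_linear (\<lambda>p. (A (fst p), B (snd p)))"
    if "bounded_linear A" "bounded_linear B" for A :: "'k1 \<Rightarrow> 'k1" and B :: "'k2 \<Rightarrow> 'k2"
    by (intro bounded_linear_Pair bounded_linear_compose[OF that(1)] bounded_linear_compose[OF that(2)]
        bounded_linear_fst bounded_linear_snd)
  have invG: "(A x, B y) \<in> G" if "bounded_linear A" "bounded_linear B"
    "\<And>n m h. (A (fst (s n m h)), B (snd (s n m h))) \<in> S" "(x, y) \<in> G"
    for A :: "'k1 \<Rightarrow> 'k1" and B :: "'k2 \<Rightarrow> 'k2" and x y
  proof -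
    have "(A (fst p), B (snd p)) \<in> S" if "p \<in> S" for p
    proof -
      obtain n m h where "p = s n m h" using \<open>p \<in> S\<close> unfolding S_def by blast
      then show ?thesis using \<open>\<And>n m h. (A (fst (s n m h)), B (snd (s n m h))) \<in> S\<close> by simp
    qed
    from closure_span_invariant[OF pair[OF that(1,2)] this, of "(x, y)"] show ?thesis
      using that(4) by (simp add: G_def)
  qed
  have sc: "(scaleC c x, scaleC c y) \<in> G" if "(x, y) \<in> G" for x y c
  proof (rule invG[OF bounded_linear_scaleC_right bounded_linear_scaleC_right _ that])
    fix n m h
    note lin = clinear_mapD(2)[OF clinear_map_funpow] isometric_embeddingD(1)
    have "(scaleC c (fst (s n m h)), scaleC c (snd (s n m h))) = s n m (scaleC c h)"
      by (simp add: s_def lin unitary_betwD(1) unitary_betw_inv U1 U2 clinear_mapD(2)[OF isometric_embeddingD(1)] i1 i2)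
    then show "(scaleC c (fst (s n m h)), scaleC c (snd (s n m h))) \<in> S" by (simp add: sS)
  qed
  have U: "(U1 x, U2 y) \<in> G" if "(x, y) \<in> G" for x y
  proof (rule invG[OF _ _ _ that])
    show "bounded_linear U1" "bounded_linear U2"
      by (intro ccontraction_bounded_linear isometric_embeddingD(5) unitary_betwD(1) U1 U2)+
    fix n m h
    \<comment> \<open>U lowers the inverse exponent n as long as there is one, and otherwise raises
      m.\<close>
    have "(U1 (fst (s n m h)), U2 (snd (s n m h))) = (if n = 0 then s 0 (Suc m) h else s (n - 1) m h)"
      by (cases n) (simp_all add: s_def unitary_betwD(4)[OF U1] unitary_betwD(4)[OF U2])
    then show "(U1 (fst (s n m h)), U2 (snd (s n m h))) \<in> S" by (simp add: sS)
  qed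
  have Ui: "(inv U1 x, inv U2 y) \<in> G" if "(x, y) \<in> G" for x y
  proof (rule invG[OF _ _ _ that])
    show "bounded_linear (inv U1)" "bounded_linear (inv U2)"
      by (intro ccontraction_bounded_linear isometric_embeddingD(5) unitary_betwD(1) unitary_betw_inv U1 U2)+
    fix n m h
    have "(inv U1 (fst (s n m h)), inv U2 (snd (s n m h))) = s (Suc n) m h" by (simp add: s_def)
    then show "(inv U1 (fst (s n m h)), inv U2 (snd (s n m h))) \<in> S" by (simp add: sS)
  qed
  show "intertwining_graph U1 U2 G" unfolding intertwining_graph_def
  proof (intro conjI allI impI)
    show "closed G" "subspace G" by (simp_all add: G_def subspace_closure)
    show "cinner x x' = cinner y y'" if "(x, y) \<in> G" "(x', y') \<in> G" for x y x' y'
      using ip2[OF that] by simp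
  qed (use sc U Ui in auto)
  show "(\<iota>1 h, \<iota>2 h) \<in> G" for h
    using SG sS[of 0 0 h] by (auto simp: s_def)
qed

subsection \<open>Equivalence of extensions\<close>

text \<open>Injectivity of the Moebius map keeps images of distinct points of the segment distinct,
  so the image of its midpoint is a limit point of the image.\<close>

lemma bfun_vertical_line_islimpt:
  fixes x y0 \<delta> :: real
  assumes y0: "y0 > 0" and \<delta>: "\<delta> = 2 * y0"
  defines "\<zeta> \<equiv> \<lambda>y. cnj (bfun (complex_of_real x + \<i> * complex_of_real y))"
  shows "\<zeta> y0 islimpt \<zeta> ` {0<..<\<delta>}"
proof -
  have nz: "complex_of_real x + \<i> * complex_of_real y + \<i> \<noteq> 0" if "y > 0" for y
    using that by (simp add: complex_eq_iff)
  have inj: "y = y'" if "\<zeta> y = \<zeta> y'" "y > 0" "y' > 0" for y y'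
  proof -
    have "bfun (complex_of_real x + \<i> * complex_of_real y) = bfun (complex_of_real x + \<i> * complex_of_real y')"
      using that(1) by (simp add: \<zeta>_def)
    then have "complex_of_real y = complex_of_real y'"
      using nz[OF that(2)] nz[OF that(3)] by (simp add: bfun_def frac_eq_eq) (simp add: algebra_simps)
    then show ?thesis by simp
  qed
  \<comment> \<open>The summand 2 keeps the sequence strictly below \<open>\<delta>\<close> already
    for n = 0.\<close>
  define f where "f n = y0 + y0 / (real n + 2)" for n
  have f: "f n > 0" "f n < \<delta>" "f n \<noteq> y0" for n
  proof -
    have "0 < y0 / (real n + 2)" using y0 by simp
    moreover have "y0 / (real n + 2) < y0" using y0 by (simp add: divide_less_eq)
    ultimately show "f n > 0" "f n < \<delta>" "f n \<noteq> y0" unfolding f_def using y0 \<delta> by linarith+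
  qed
  have "f \<longlonglongrightarrow> y0 + 0" unfolding f_def
    by (intro tendsto_add tendsto_const) real_asymp
  then have lim: "f \<longlonglongrightarrow> y0" by simp
  have "(\<lambda>n. \<zeta> (f n)) \<longlonglongrightarrow> \<zeta> y0" unfolding \<zeta>_def bfun_def
    by (intro tendsto_intros lim) (use nz[OF y0] in auto)
  moreover have "\<zeta> (f n) \<in> \<zeta> ` {0<..<\<delta>} - {\<zeta> y0}" for n
    using f[of n] inj[of "f n" y0] y0 by auto
  ultimately show ?thesis unfolding islimpt_sequential by (intro exI[of _ "\<lambda>n. \<zeta> (f n)"]) simp
qed

text \<open>Both vectors split into pieces that depend on B and z alone; by
  \<open>cinner_neumann_decompose\<close> the extension enters only through the pairing of l with
  l'.\<close>

lemma neumann_eq_if_eq_on_defect: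
  fixes \<iota>1 :: "'h::complex_hilbert \<Rightarrow> 'k1::complex_hilbert" and \<iota>2 :: "'h \<Rightarrow> 'k2::complex_hilbert"
  assumes lin: "lin_transf D T" and sym: "symmetric_op D T" and cl: "closed_op D T"
    and ext1: "in_Ext D T \<iota>1 U1" and ext2: "in_Ext D T \<iota>2 U2" and z: "Im z > 0"
    and dec: "\<And>h. \<exists>l\<in>defect D T (- \<i>). \<forall>w\<in>defect D T z. cinner (h - l) w = 0"
    and eq: "\<And>l l'. l \<in> defect D T (- \<i>) \<Longrightarrow> l' \<in> defect D T (- \<i>) \<Longrightarrow>
      cinner (neumann U1 (cnj (bfun z)) (\<iota>1 l)) (\<iota>1 l') = cinner (neumann U2 (cnj (bfun z)) (\<iota>2 l)) (\<iota>2 l')"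
  shows "cinner (neumann U1 (cnj (bfun z)) (\<iota>1 h)) (\<iota>1 h') = cinner (neumann U2 (cnj (bfun z)) (\<iota>2 h)) (\<iota>2 h')"
proof -
  interpret partial_isometry "ran_shift D T (- \<i>)" "ran_shift D T \<i>" "cayley D T"
    by (rule partial_isometry_cayley[OF lin sym cl])
  define \<zeta> where "\<zeta> = cnj (bfun z)"
  have z': "cmod \<zeta> < 1" using cmod_bfun_less_1[OF z] by (simp add: \<zeta>_def)
  have def: "defect D T (- \<i>) = orth (ran_shift D T \<i>)" by (simp add: defect_def)
  obtain l where l: "l \<in> orth (ran_shift D T \<i>)" "\<And>w. w \<in> defect D T z \<Longrightarrow> cinner (h - l) w = 0"
    using dec[of h] unfolding def by blast
  have "cinner (h - l) w = 0" if "w \<in> E \<zeta>" for w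
    using l(2) that E_eq_defect[OF lin sym cl z] by (simp add: \<zeta>_def)
  then obtain g where g: "g \<in> ran_shift D T (- \<i>)" "h - l = g - scaleC \<zeta> (cayley D T g)"
    using decompose_left[OF z'] by blast
  have h: "h = g - scaleC \<zeta> (cayley D T g) + l" using g(2) by (simp add: algebra_simps)
  obtain g' l' where g': "g' \<in> ran_shift D T (- \<i>)" "l' \<in> orth (ran_shift D T \<i>)"
    and h': "h' = cayley D T g' - scaleC (cnj \<zeta>) g' + l'"
    by (rule decompose_right[OF z'])
  have ext: "U1 (\<iota>1 x) = \<iota>1 (cayley D T x)" "U2 (\<iota>2 x) = \<iota>2 (cayley D T x)" if "x \<in> ran_shift D T (- \<i>)" for x
  proof -
    obtain a where "a \<in> D" "x = T a + scaleC \<i> a"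
      using \<open>x \<in> ran_shift D T (- \<i>)\<close> unfolding ran_shift_minus_i[OF lin sym cl] by blast
    then show "U1 (\<iota>1 x) = \<iota>1 (cayley D T x)" "U2 (\<iota>2 x) = \<iota>2 (cayley D T x)"
      using ext1 ext2 by (simp_all add: in_Ext_def cayley_eq[OF lin sym cl])
  qed
  have "isometric_embedding \<iota>1" "unitary_betw U1" "isometric_embedding \<iota>2" "unitary_betw U2"
    using ext1 ext2 by (auto simp: in_Ext_def)
  note d = cinner_neumann_decompose[OF this(1,2) z' ext(1) g(1) l(1) g'(1), of l']
    cinner_neumann_decompose[OF this(3,4) z' ext(2) g(1) l(1) g'(1), of l']
  have "cinner (neumann U1 \<zeta> (\<iota>1 l)) (\<iota>1 l') = cinner (neumann U2 \<zeta> (\<iota>2 l)) (\<iota>2 l')"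
    using eq[of l l'] l(1) g'(2) by (simp add: def \<zeta>_def)
  with d show ?thesis unfolding \<zeta>_def[symmetric] h h' by simp
qed

lemma Phi_eq_iff_G_fun_eq:
  assumes "fin_isometry_into J S" "in_Ext D T \<iota>1 U1" "in_Ext D T \<iota>2 U2" "Im z > 0"
  shows "Phi J \<iota>1 U1 z = Phi J \<iota>2 U2 z \<longleftrightarrow> G_fun J \<iota>1 U1 z = G_fun J \<iota>2 U2 z"
proof -
  have "invertible (G_fun J \<iota>1 U1 z + mat 1)" "invertible (G_fun J \<iota>2 U2 z + mat 1)"
    using assms by (auto simp: in_Ext_def intro: invertible_G_plus_one)
  from cayley_matrix_inj[OF this] show ?thesis by (auto simp: Phi_def)
qed

lemma neumann_intertwine:
  assumes W: "clinear_map W" and WU: "W \<circ> U1 = U2 \<circ> W" and U1: "ccontraction U1" and U2: "ccontraction U2"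
    and z: "cmod \<zeta> < 1"
  shows "neumann U2 \<zeta> (W x) = W (neumann U1 \<zeta> x)"
proof (rule neumann_unique[OF U2 z, symmetric])
  have "U2 (W y) = W (U1 y)" for y using fun_cong[OF WU, of y] by simp
  then have "W (neumann U1 \<zeta> x) - scaleC \<zeta> (U2 (W (neumann U1 \<zeta> x))) = W (neumann U1 \<zeta> x - scaleC \<zeta> (U1 (neumann U1 \<zeta> x)))"
    by (simp add: clinear_mapD[OF W])
  then show "W (neumann U1 \<zeta> x) - scaleC \<zeta> (U2 (W (neumann U1 \<zeta> x))) = W x"
    by (simp only: neumann_inverse[OF U1 z])
qed

theorem mainTheorem3:
  fixes D :: "'h::complex_hilbert set" and T :: "'h \<Rightarrow> 'h"
    and J :: "complex^'n \<Rightarrow> 'h"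
    and \<iota>1 :: "'h \<Rightarrow> 'k1::complex_hilbert" and U1 :: "'k1 \<Rightarrow> 'k1"
    and \<iota>2 :: "'h \<Rightarrow> 'k2::complex_hilbert" and U2 :: "'k2 \<Rightarrow> 'k2"
  assumes sep: "\<exists>S :: 'h set. countable S \<and> closure S = UNIV"
    and B: "in_S_n TYPE('n) D T"
    and inner: "livsic_inner TYPE('n) D T"
    and J: "fin_isometry_into J (defect D T (- \<i>))"
    and U1: "in_Ext D T \<iota>1 U1"
    and U2: "in_Ext D T \<iota>2 U2"
  shows "(\<forall>z. 0 < Im z \<longrightarrow> Phi J \<iota>1 U1 z = Phi J \<iota>2 U2 z) \<longleftrightarrow>
    (\<exists>W :: 'k1 \<Rightarrow> 'k2. unitary_betw W \<and> (\<forall>h. W (\<iota>1 h) = \<iota>2 h) \<and> W \<circ> U1 = U2 \<circ> W)"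
proof
  have i: "isometric_embedding \<iota>1" "isometric_embedding \<iota>2" and u: "unitary_betw U1" "unitary_betw U2"
    using U1 U2 by (auto simp: in_Ext_def)
  have c: "ccontraction U1" "ccontraction U2"
    using u by (auto intro: isometric_embeddingD(5) unitary_betwD(1))
  {
    assume "\<exists>W :: 'k1 \<Rightarrow> 'k2. unitary_betw W \<and> (\<forall>h. W (\<iota>1 h) = \<iota>2 h) \<and> W \<circ> U1 = U2 \<circ> W"
    then obtain W :: "'k1 \<Rightarrow> 'k2" where W: "unitary_betw W" "\<And>h. W (\<iota>1 h) = \<iota>2 h" "W \<circ> U1 = U2 \<circ> W" by blast
    note Wi = isometric_embeddingD[OF unitary_betwD(1)[OF W(1)]]
    show "\<forall>z. 0 < Im z \<longrightarrow> Phi J \<iota>1 U1 z = Phi J \<iota>2 U2 z"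
    proof (intro allI impI)
      fix z assume z: "0 < Im z"
      have z': "cmod (cnj (bfun z)) < 1" using cmod_bfun_less_1[OF z] by simp
      have "cinner (neumann U2 (cnj (bfun z)) (\<iota>2 h)) (\<iota>2 h') = cinner (neumann U1 (cnj (bfun z)) (\<iota>1 h)) (\<iota>1 h')" for h h'
        using neumann_intertwine[OF Wi(1) W(3) c z', of "\<iota>1 h"]
          Wi(2)[of "neumann U1 (cnj (bfun z)) (\<iota>1 h)" "\<iota>1 h'"] by (simp add: W(2))
      then have "G_fun J \<iota>1 U1 z = G_fun J \<iota>2 U2 z"
        by (simp add: vec_eq_iff G_fun_eq_neumann u cmod_bfun_less_1[OF z] isometric_embeddingD(2)[OF i(1)] isometric_embeddingD(2)[OF i(2)])
      then show "Phi J \<iota>1 U1 z = Phi J \<iota>2 U2 z" by (simp add: Phi_eq_iff_G_fun_eq[OF J U1 U2 z])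
    qed
  next
    assume Phi: "\<forall>z. 0 < Im z \<longrightarrow> Phi J \<iota>1 U1 z = Phi J \<iota>2 U2 z"
    from B obtain v u :: "'n \<Rightarrow> 'h" where D: "lin_transf D T" "symmetric_op D T" "closed_op D T"
      and uv: "is_onb (defect D T \<i>) u" "is_onb (defect D T (- \<i>)) v"
      by (auto simp: in_S_n_def)
    \<comment> \<open>Equality of G gives agreement on the vectors J e_j only; surjectivity of J
      onto the defect space extends it to all l and l'.\<close>
    have rJ: "range J = defect D T (- \<i>)" by (rule fin_isometry_range[OF J uv(2)])
    have eqJ: "cinner (neumann U1 (cnj (bfun z)) (\<iota>1 l)) (\<iota>1 l') = cinner (neumann U2 (cnj (bfun z)) (\<iota>2 l)) (\<iota>2 l')"
      if z: "Im z > 0" and l: "l \<in> defect D T (- \<i>)" "l' \<in> defect D T (- \<i>)" for z l l'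
    proof -
      have z': "cmod (cnj (bfun z)) < 1" using cmod_bfun_less_1[OF z] by simp
      have "G_fun J \<iota>1 U1 z = G_fun J \<iota>2 U2 z" using Phi z by (simp add: Phi_eq_iff_G_fun_eq[OF J U1 U2])
      then have "(G_fun J \<iota>1 U1 z + mat 1) $ j $ k = (G_fun J \<iota>2 U2 z + mat 1) $ j $ k" for j k by simp
      then have "cinner (neumann U1 (cnj (bfun z)) (\<iota>1 (J (axis j 1)))) (\<iota>1 (J (axis k 1)))
          = cinner (neumann U2 (cnj (bfun z)) (\<iota>2 (J (axis j 1)))) (\<iota>2 (J (axis k 1)))" for j k
        unfolding G_plus_one[OF J i(1) u(1) z] G_plus_one[OF J i(2) u(2) z] by simp
      moreover obtain a b where "l = J a" "l' = J b" using l rJ by blast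
      ultimately show ?thesis
        by (simp only: cinner_neumann_expand[OF J i(1) u(1) z', of a b] cinner_neumann_expand[OF J i(2) u(2) z', of a b])
    qed
    obtain x \<delta> where \<delta>: "\<delta> > 0" and dec: "\<And>y h. 0 < y \<Longrightarrow> y < \<delta> \<Longrightarrow> \<exists>l\<in>defect D T (- \<i>).
        \<forall>w\<in>defect D T (complex_of_real x + \<i> * complex_of_real y). cinner (h - l) w = 0"
      by (rule decompose_near_boundary[OF D inner uv]) (rule that; assumption)
    define \<zeta> where "\<zeta> = (\<lambda>y. cnj (bfun (complex_of_real x + \<i> * complex_of_real y)))"
    have ball: "\<zeta> y \<in> ball 0 1" if "y > 0" for y
      using cmod_bfun_less_1[of "complex_of_real x + \<i> * complex_of_real y"] that by (simp add: \<zeta>_def)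
    have "cinner ((U1 ^^ m) (\<iota>1 h)) (\<iota>1 h') = cinner ((U2 ^^ m) (\<iota>2 h)) (\<iota>2 h')" for m h h'
    \<comment> \<open>The limit point must lie inside the disc, hence the midpoint of the segment: b
      maps its real end x to the unit circle.\<close>
    proof (rule moments_eq_if_neumann_eq[OF c])
      show "\<zeta> ` {0<..<\<delta>} \<subseteq> ball 0 1" using ball by auto
      show "\<zeta> (\<delta> / 2) \<in> ball 0 1" using ball \<delta> by simp
      show "\<zeta> (\<delta> / 2) islimpt \<zeta> ` {0<..<\<delta>}"
        unfolding \<zeta>_def by (rule bfun_vertical_line_islimpt) (use \<delta> in auto)
      fix w assume "w \<in> \<zeta> ` {0<..<\<delta>}"
      then obtain y where y: "0 < y" "y < \<delta>" "w = \<zeta> y" by auto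
      show "cinner (neumann U1 w (\<iota>1 h)) (\<iota>1 h') = cinner (neumann U2 w (\<iota>2 h)) (\<iota>2 h')"
        unfolding y(3) \<zeta>_def
        by (rule neumann_eq_if_eq_on_defect[OF D U1 U2 _ dec[OF y(1,2)] eqJ]) (use y in auto)
    qed
    then show "\<exists>W :: 'k1 \<Rightarrow> 'k2. unitary_betw W \<and> (\<forall>h. W (\<iota>1 h) = \<iota>2 h) \<and> W \<circ> U1 = U2 \<circ> W"
      by (rule intertwining_unitary_if_moments_eq[OF U1 U2])
  }
qed

end
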